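(* Let $1\le p\neq q<\infty$. Let $E_1=\ell_p^{(2)}(\ell_q^{(2)})$ and $E_{n+1}=\ell_p^{(2)}(\ell_q^{(2)}(E_n))$ for $n\ge1$ (complex spaces). Then for every $1\le s<\infty$ and every $n\ge 1$, $$C_s^a(E_n)\ \ge\ S^a(E_n)\ \ge\ \kappa(p,q)^n,$$ where $S^a(E_n)$ is computed with respect to the canonical basis of $E_n$. Moreover, if $1<p,q<\infty$, then there exists $\kappa_2=\kappa_2(p,q,s)$, depending only on $p,q,s$, such that $C_s^a(E_n)\le\kappa_2^n$ for all $n\ge 1$.
   Context: All Banach spaces are over $\mathbb C$. $\mathbb T$ is the unit circle with normalised Haar measure $m$. **Hardy martingales.** Let $z=(z_n)_{n\ge0}$ denote the general element of $\mathbb T^{\mathbb N}$ with $m_\infty=m^{\otimes\mathbb N}$, with the convention $z_0\equiv1$. Let $\mathcal G_n=\sigma(z_0,\dots,z_n)$, so $\mathcal G_0$ is trivial. For $1\le s\le\infty$, an $X$-valued Hardy martingale in $L_s(\mathbb T^{\mathbb N};X)$ is a martingale $(f_n)_{n\ge0}$ with respect to $(\mathcal G_n)$ with $\sup_n\|f_n\|_{L_s(X)}<\infty$ such that, for $n\ge1$, $df_n=f_n-f_{n-1}$ is analytic in the last variable: $df_n=\sum_{k\ge1}\phi_{n,k}(z_0,\dots,z_{n-1})z_n^k$ (by convention $df_0=f_0$). $H_s(\mathbb T^{\mathbb N})$ is the set of $f\in L_s(\mathbb T^{\mathbb N},m_\infty)$ such that $(\mathbb E^{\mathcal G_n}f)_n$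 is a Hardy martingale. **AUMD constant.** For $1\le s<\infty$, $C_s^a(X)\in[0,\infty]$ is the best constant $C$ with $\sup_{\varepsilon_k=\pm1}\|\sum_{k=0}^n\varepsilon_k\,df_k\|_{L_s(X)}\le C\|\sum_{k=0}^n df_k\|_{L_s(X)}$ for all $n\ge0$ and all $X$-valued Hardy martingales in $L_s(\mathbb T^{\mathbb N};X)$. **The constant $S^a$.** For a family $\{x_i\}_{i\in I}$ in $X$, $S^a(X)=S^a(X;\{x_i\})\in[0,\infty]$ is the best constant $C$ such that $$\Big\|\sum_{k=0}^N\mathbb E^{\mathcal G_k}(\theta_k)x_{i_k}\Big\|_{L_1(m_\infty;X)}\le C\Big\|\sum_{k=0}^N\theta_kx_{i_k}\Big\|_{L_\infty(m_\infty;X)}$$ for every $N\in\mathbb N$, all distinct indices $i_0,\dots,i_N\in I$ and all $\theta_0,\dots,\theta_N\in H_\infty(\mathbb T^{\mathbb N})$ ($\infty$ if no such constant exists). **The spaces.** $\ell_r^{(2)}(F)$ is $F\times F$ with norm $\|(x_1,x_2)\|=\|(\|x_1\|,\|x_2\|)\|_{\ell_r}$, and $\ell_r^{(2)}$ is the 2-dimensional $\ell_r$ space. The canonical basis of $E_n$ consists of the $4^n$ tensor products of canonical basis vectors of the successive factors. **The constant $\kappa(p,q)$.** $\kappa(p,q)$ is the best constant $C$ such that for any measurable partition $\mathbb T=A\,\dot\cup\,B$ with $m(A)=m(B)=\frac12$, any $f=f_1\chi_A+f_2\chi_B$ with scalars $f_1,f_2>0$ and any $g=g_1\chi_A+g_2\chi_B$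 with scalars $g_1,g_2$, one has $\int_{\mathbb T}(M(|f|)^q+|g|^q)^{p/q}dm\le C^p\int_{\mathbb T}(|f|^q+|g|^q)^{p/q}dm$, where $M(|f|)=\exp\int_{\mathbb T}\log|f|\,dm$ is the geometric mean. *)

theory Defs
  imports "HOL-Probability.Probability"
begin

section \<open>The infinite torus\<close>

definition circ :: "complex measure" where
  "circ = distr (uniform_measure lborel {0..2 * pi}) (restrict_space borel (sphere 0 1)) cis"

text \<open>The random coordinates are \<open>z\<^sub>1, z\<^sub>2, \<dots>\<close>; \<open>z\<^sub>0\<close> is the constant 1. Since \<open>\<Pi>\<^sub>M\<close> uses
  extensional functions, the value of \<open>\<omega> 0\<close> carries no information.\<close>

type_synonym torus = "nat \<Rightarrow> complex"

definition m_inf :: "torus measure" where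
  "m_inf = (\<Pi>\<^sub>M n\<in>{1..}. circ)"

definition coord :: "nat \<Rightarrow> torus \<Rightarrow> complex" where
  "coord n \<omega> = (if n = 0 then 1 else \<omega> n)"

definition filt :: "nat \<Rightarrow> torus measure" where
  "filt n = sigma (space m_inf) {coord k -` A \<inter> space m_inf | k A. k \<le> n \<and> A \<in> sets borel}"

definition cexp :: "nat \<Rightarrow> (torus \<Rightarrow> complex) \<Rightarrow> torus \<Rightarrow> complex" where
  "cexp n f \<omega> = Complex (real_cond_exp m_inf (filt n) (\<lambda>\<omega>. Re (f \<omega>)) \<omega>)
                        (real_cond_exp m_inf (filt n) (\<lambda>\<omega>. Im (f \<omega>)) \<omega>)"

section \<open>Normed spaces of coordinate vectors\<close>

text \<open>The dimension of \<open>E_space p q n\<close> varies inside a formula, so the spaces cannot be types. A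
  finite-dimensional Banach space with a distinguished basis is represented by the finite set \<open>idx\<close>
  indexing the basis together with the norm as a function of the coordinates; coordinates outside
  \<open>idx\<close> are ignored. Measurability, integrability and conditional expectation of functions with
  values in such a space are coordinatewise notions.\<close>

record 'i coord_space =
  idx :: "'i set"
  nrm :: "('i \<Rightarrow> complex) \<Rightarrow> real"

definition basis_vec :: "'i \<Rightarrow> 'i \<Rightarrow> complex" where
  "basis_vec i = (\<lambda>j. if j = i then 1 else 0)"

definition scalars :: "bool list coord_space" where
  "scalars = \<lparr>idx = {[]}, nrm = (\<lambda>x. cmod (x []))\<rparr>"

text \<open>\<open>\<ell>\<^sub>r\<^sup>2(F)\<close>: the coordinates with index \<open>b # w\<close> are those of the component \<open>x\<^sub>1\<close> or \<open>x\<^sub>2\<close> selected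
  by \<open>b\<close>, so basis vectors correspond to tensors \<open>e\<^sub>b \<otimes> e\<^sub>w\<close>. In particular \<open>ell2 r scalars\<close> is the
  two-dimensional \<open>\<ell>\<^sub>r\<close> space.\<close>

definition ell2 :: "real \<Rightarrow> bool list coord_space \<Rightarrow> bool list coord_space" where
  "ell2 r F =
    \<lparr>idx = {b # w | b w. w \<in> idx F},
     nrm = (\<lambda>x. (nrm F (\<lambda>w. x (False # w)) powr r + nrm F (\<lambda>w. x (True # w)) powr r) powr (1 / r))\<rparr>"

primrec E_space :: "real \<Rightarrow> real \<Rightarrow> nat \<Rightarrow> bool list coord_space" where
  "E_space p q 0 = scalars"
| "E_space p q (Suc n) = ell2 p (ell2 q (E_space p q n))"

section \<open>Hardy martingales\<close>

text \<open>The \<open>L\<^sub>s\<close> norm of a nonnegative measurable function, \<open>1 \<le> s \<le> \<infinity>\<close>.\<close>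

definition Lnorm :: "ennreal \<Rightarrow> 'a measure \<Rightarrow> ('a \<Rightarrow> real) \<Rightarrow> ennreal" where
  "Lnorm s M u =
    (if s = \<infinity> then esssup M (\<lambda>\<omega>. ennreal (u \<omega>))
     else let r = enn2real s; J = (\<integral>\<^sup>+ \<omega>. ennreal (u \<omega> powr r) \<partial>M)
          in if J = \<infinity> then \<infinity> else ennreal (enn2real J powr (1 / r)))"

text \<open>By convention the difference at index 0 is \<open>f\<^sub>0\<close>.\<close>

definition diffs :: "(nat \<Rightarrow> torus \<Rightarrow> 'i \<Rightarrow> complex) \<Rightarrow> nat \<Rightarrow> torus \<Rightarrow> 'i \<Rightarrow> complex" where
  "diffs f n \<omega> i = (if n = 0 then f 0 \<omega> i else f n \<omega> i - f (n - 1) \<omega> i)"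

definition fourier_coeff :: "(complex \<Rightarrow> complex) \<Rightarrow> int \<Rightarrow> complex" where
  "fourier_coeff g k = (\<integral>t. g t * t powi (- k) \<partial>circ)"

text \<open>\<open>d = \<Sum>\<^bsub>k\<ge>1\<^esub> \<phi>\<^sub>k(z\<^sub>0, \<dots>, z\<^bsub>n-1\<^esub>) z\<^sub>n\<^sup>k\<close>, read as an identity of Fourier series in the variable
  \<open>z\<^sub>n\<close> for almost every value of the other variables.\<close>

definition analytic_in_last :: "'i coord_space \<Rightarrow> nat \<Rightarrow> (torus \<Rightarrow> 'i \<Rightarrow> complex) \<Rightarrow> bool" where
  "analytic_in_last X n d \<longleftrightarrow>
    (\<exists>\<phi> :: int \<Rightarrow> torus \<Rightarrow> 'i \<Rightarrow> complex.
       (\<forall>k\<ge>1. \<forall>i\<in>idx X. (\<lambda>\<omega>. \<phi> k \<omega> i) \<in> borel_measurable (filt (n - 1))) \<and>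
       (\<forall>i\<in>idx X. AE \<omega> in m_inf. \<forall>k.
          fourier_coeff (\<lambda>t. d (fun_upd \<omega> n t) i) k = (if k \<ge> 1 then \<phi> k \<omega> i else 0)))"

definition hardy_martingale ::
    "ennreal \<Rightarrow> 'i coord_space \<Rightarrow> (nat \<Rightarrow> torus \<Rightarrow> 'i \<Rightarrow> complex) \<Rightarrow> bool" where
  "hardy_martingale s X f \<longleftrightarrow>
    (\<forall>n. \<forall>i\<in>idx X. (\<lambda>\<omega>. f n \<omega> i) \<in> borel_measurable (filt n)) \<and>
    (\<forall>m n. m \<le> n \<longrightarrow> (\<forall>i\<in>idx X. AE \<omega> in m_inf. cexp m (\<lambda>\<omega>. f n \<omega> i) \<omega> = f m \<omega> i)) \<and>
    (SUP n. Lnorm s m_inf (\<lambda>\<omega>. nrm X (f n \<omega>))) < \<infinity> \<and>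
    (\<forall>n\<ge>1. analytic_in_last X n (diffs f n))"

definition hardy_space :: "ennreal \<Rightarrow> (torus \<Rightarrow> complex) set" where
  "hardy_space s =
    {f. f \<in> borel_measurable m_inf \<and> Lnorm s m_inf (\<lambda>\<omega>. cmod (f \<omega>)) < \<infinity> \<and>
        hardy_martingale s scalars (\<lambda>n \<omega> _. cexp n f \<omega>)}"

section \<open>The constants\<close>

definition best_constant :: "(ennreal \<Rightarrow> bool) \<Rightarrow> ennreal" where
  "best_constant P = Inf {ennreal C | C. 0 \<le> C \<and> P (ennreal C)}"

definition AUMD_constant :: "real \<Rightarrow> 'i coord_space \<Rightarrow> ennreal" where
  "AUMD_constant s X = best_constant (\<lambda>C.
    \<forall>f n. hardy_martingale (ennreal s) X f \<longrightarrow>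
      (SUP \<epsilon>\<in>{\<epsilon> :: nat \<Rightarrow> real. \<forall>k. \<epsilon> k = 1 \<or> \<epsilon> k = - 1}.
         Lnorm (ennreal s) m_inf (\<lambda>\<omega>. nrm X (\<lambda>i. \<Sum>k\<le>n. of_real (\<epsilon> k) * diffs f k \<omega> i)))
      \<le> C * Lnorm (ennreal s) m_inf (\<lambda>\<omega>. nrm X (\<lambda>i. \<Sum>k\<le>n. diffs f k \<omega> i)))"

definition S_constant :: "'i coord_space \<Rightarrow> 'j set \<Rightarrow> ('j \<Rightarrow> 'i \<Rightarrow> complex) \<Rightarrow> ennreal" where
  "S_constant X I x = best_constant (\<lambda>C.
    \<forall>(N :: nat) \<iota> \<theta>. inj_on \<iota> {..N} \<and> \<iota> ` {..N} \<subseteq> I \<and> (\<forall>k\<le>N. \<theta> k \<in> hardy_space \<infinity>) \<longrightarrow>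
      Lnorm 1 m_inf (\<lambda>\<omega>. nrm X (\<lambda>i. \<Sum>k\<le>N. cexp k (\<theta> k) \<omega> * x (\<iota> k) i))
      \<le> C * Lnorm \<infinity> m_inf (\<lambda>\<omega>. nrm X (\<lambda>i. \<Sum>k\<le>N. \<theta> k \<omega> * x (\<iota> k) i)))"

definition geometric_mean :: "(complex \<Rightarrow> real) \<Rightarrow> real" where
  "geometric_mean h = exp (\<integral>t. ln (h t) \<partial>circ)"

definition kappa :: "real \<Rightarrow> real \<Rightarrow> ennreal" where
  "kappa p q = Inf {ennreal C | C. 0 \<le> C \<and>
    (\<forall>A B (f1 :: real) (f2 :: real) (g1 :: complex) (g2 :: complex).
       A \<in> sets circ \<and> B \<in> sets circ \<and> A \<union> B = sphere 0 1 \<and> A \<inter> B = {} \<and>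
       measure circ A = 1 / 2 \<and> measure circ B = 1 / 2 \<and> f1 > 0 \<and> f2 > 0 \<longrightarrow>
       (let f = (\<lambda>t. f1 * indicator A t + f2 * indicator B t);
            g = (\<lambda>t. g1 * indicator A t + g2 * indicator B t)
        in (\<integral>t. (geometric_mean (\<lambda>t. \<bar>f t\<bar>) powr q + cmod (g t) powr q) powr (p / q) \<partial>circ)
           \<le> C powr p * (\<integral>t. (\<bar>f t\<bar> powr q + cmod (g t) powr q) powr (p / q) \<partial>circ)))}"

end

theory Submission
  imports Defs "HOL-Complex_Analysis.Complex_Analysis"
begin

text \<open>
  \<^emph>\<open>From \<open>S\<^sup>a\<close> to AUMD.\<close> Put independent rotations \<open>w\<^sub>0, w\<^sub>1, \<dots>\<close> between the variables \<open>z\<^sub>1, z\<^sub>2, \<dots>\<close> and consider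
  the Hardy martingale of \<open>\<Sum> w\<^sub>k \<theta>\<^sub>k(z) x\<^sub>k\<close>. Its differences in the steps that reveal the \<open>w\<^sub>k\<close> are
  \<open>w\<^sub>k E\<^sub>k(\<theta>\<^sub>k) x\<^sub>k\<close>, so one choice of signs isolates them, and the rotations do not change a lattice norm.

  \<^emph>\<open>From \<open>\<kappa>\<close> to \<open>S\<^sup>a\<close>.\<close> An outer function whose modulus takes two values, each on a half circle, has the
  geometric mean as modulus of its mean. Four such functions, paired so that their moduli only get
  permuted along the circle, give functions for \<open>E\<^sub>1\<close> with both norms in the definition of \<open>S\<^sup>a\<close> constant;
  taking products in fresh variables for each branch of the tensor words multiplies the ratio.

  \<^emph>\<open>The upper bound.\<close> The space \<open>E\<^sub>n\<close> has \<open>4\<^sup>n\<close> coordinates and a norm between the maximum and the sum of their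
  moduli, so an exponential bound follows from the finiteness of the scalar constant. The latter comes from
  the function \<open>u\<^sup>m - K w u\<^bsup>m-1\<^esup> - L w\<^sup>m\<close> with \<open>m = s/2\<close>, \<open>w = |f|\<^sup>2 + e\<close> and \<open>u = w + |g|\<^sup>2\<close>. It is superharmonic in
  \<open>t\<close> along \<open>(f + t, g \<plusminus> t)\<close>, so its expectation decreases when \<open>f\<close> is a Hardy martingale and \<open>g\<close> a transform of it,
  and it dominates \<open>u\<^sup>m/2 - C w\<^sup>m\<close>.
\<close>

section \<open>The infinite torus\<close>

text \<open>Signs act on single martingale differences, while \<open>E_k(\<theta>_k)\<close> is a
  whole conditional expectation; an extra rotation revealed right after \<open>z_k\<close> has mean
  zero, so it turns that expectation into one difference. Conditional expectations are rewritten as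
  integrals over resampled coordinates, which reduces their identities to Fubini and almost
  everywhere statements. One fixed partition, the upper and lower half circle, is enough for the
  lower bound, since the integrals in \<open>kappa\<close> see only the values on the two sets and
  the measures 1/2. In the upper bound \<open>s = 1\<close> is allowed, and \<open>m - 1\<close> is
  negative for \<open>s < 2\<close>: hence the shift \<open>e > 0\<close> in \<open>w\<close>,
  removed at the end. Analyticity is given only through Fourier coefficients of an
  \<open>L_s\<close> function, so superharmonicity is proved along polynomials and transferred by
  Fejer means. Passing between the coordinates and the norm costs a power of the dimension
  \<open>4^n\<close>, which a bound of the form \<open>\<kappa>^n\<close> absorbs.\<close>

lemma space_circ [simp]: "space circ = sphere 0 1"
  by (simp add: circ_def space_restrict_space)

lemma sets_circ [measurable_cong]: "sets circ = sets (restrict_space borel (sphere 0 1))"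
  by (simp add: circ_def)

lemma measurable_cis_restrict [measurable]:
  "cis \<in> measurable borel (restrict_space borel (sphere 0 1))"
  by (rule measurable_restrict_space2) (auto intro!: borel_measurable_continuous_onI continuous_intros)

lemma prob_space_circ: "prob_space circ"
proof -
  have "prob_space (uniform_measure lborel {0..2 * pi})"
    by (rule prob_space_uniform_measure) auto
  then show ?thesis
    unfolding circ_def by (rule prob_space.prob_space_distr) simp
qed

interpretation circ: prob_space circ by (rule prob_space_circ)

interpretation m_inf: product_prob_space "\<lambda>_. circ" "{1..} :: nat set"
  rewrites "(\<Pi>\<^sub>M n\<in>{1..}. circ) = m_inf"
  by unfold_locales (simp add: m_inf_def)

lemma prob_space_m_inf: "prob_space m_inf"
  using m_inf.prob_space_axioms .

lemma measure_m_inf_space: "measure m_inf (space m_inf) = 1"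
  by (rule prob_space.prob_space[OF prob_space_m_inf])

interpretation mm: pair_prob_space m_inf m_inf ..
interpretation mc: pair_prob_space m_inf circ ..

lemma space_m_inf: "space m_inf = (\<Pi>\<^sub>E i\<in>{1..}. sphere 0 1)"
  by (simp add: m_inf_def space_PiM)

lemma measurable_component_m_inf [measurable]: "1 \<le> n \<Longrightarrow> (\<lambda>\<omega>. \<omega> n) \<in> measurable m_inf circ"
  unfolding m_inf_def by (rule measurable_component_singleton) simp

lemma id_borel_circ [measurable]: "(\<lambda>t. t) \<in> borel_measurable circ"
  by (simp add: measurable_cong_sets[OF sets_circ refl] measurable_restrict_space1)

lemma continuous_borel_circ:
  assumes "continuous_on (sphere 0 1) f" shows "f \<in> borel_measurable circ"
  unfolding measurable_cong_sets[OF sets_circ refl] using assms by (rule borel_measurable_continuous_on_restrict)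

section \<open>Resampling, replacing and thinning of coordinates\<close>

lemma measurable_into_m_inf:
  assumes f: "\<And>i. 1 \<le> i \<Longrightarrow> f i \<in> measurable N circ" and u: "\<And>x. x \<in> space N \<Longrightarrow> f 0 x = undefined"
  shows "(\<lambda>x i. f i x) \<in> measurable N m_inf"
  unfolding m_inf_def
proof (rule measurable_PiM_single')
  show "(\<lambda>\<omega> i. f i \<omega>) \<in> space N \<rightarrow> (\<Pi>\<^sub>E i\<in>{1..}. space circ)"
  proof (intro Pi_I PiE_I)
    fix x and i :: nat assume x: "x \<in> space N"
    show "f i x \<in> space circ" if "i \<in> {1..}"
      by (rule measurable_space[OF f x]) (use that in simp)
    show "f i x = undefined" if "i \<notin> {1..}"
      using u[OF x] that by (cases i) simp_all
  qed
qed (use f in simp)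

text \<open>With \<open>S = {1..n}\<close> the second argument resamples the coordinates beyond
  \<open>n\<close>, so averaging over it is the conditional expectation given \<open>filt n\<close>;
  with the complement of a point one coordinate is replaced by an independent copy.\<close>

definition mix :: "nat set \<Rightarrow> torus \<Rightarrow> torus \<Rightarrow> torus" where
  "mix S \<omega> \<omega>' = (\<lambda>i. if i \<in> S then \<omega> i else \<omega>' i)"

lemma measurable_mix [measurable]:
  "(\<lambda>(\<omega>, \<omega>'). mix S \<omega> \<omega>') \<in> measurable (m_inf \<Otimes>\<^sub>M m_inf) m_inf"
proof -
  have "(\<lambda>x i. if i \<in> S then fst x i else snd x i) \<in> measurable (m_inf \<Otimes>\<^sub>M m_inf) m_inf"
  proof (rule measurable_into_m_inf)
    fix i :: nat assume "1 \<le> i"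
    then show "(\<lambda>x. if i \<in> S then fst x i else snd x i) \<in> measurable (m_inf \<Otimes>\<^sub>M m_inf) circ"
      by (cases "i \<in> S")
        (simp_all add: measurable_compose[OF measurable_fst measurable_component_m_inf]
          measurable_compose[OF measurable_snd measurable_component_m_inf])
  qed (simp add: space_pair_measure space_m_inf PiE_def extensional_def mem_Times_iff)
  then show ?thesis by (simp add: mix_def split_beta')
qed

text \<open>A cylinder over \<open>J\<close> pulls back to a rectangle whose sides are cylinders
  over \<open>J \<inter> S\<close> and \<open>J - S\<close>, so its measure is the product over all
  of \<open>J\<close>; the cylinders determine the product measure.\<close>

lemma distr_mix: "distr (m_inf \<Otimes>\<^sub>M m_inf) m_inf (\<lambda>(\<omega>, \<omega>'). mix S \<omega> \<omega>') = m_inf"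
proof (rule m_inf.PiM_eq)
  show "sets (distr (m_inf \<Otimes>\<^sub>M m_inf) m_inf (\<lambda>(\<omega>, \<omega>'). mix S \<omega> \<omega>')) = sets m_inf" by simp
next
  fix J :: "nat set" and F assume J: "finite J" "J \<subseteq> {1..}" and F: "\<And>j. j \<in> J \<Longrightarrow> F j \<in> sets circ"
  let ?e = "\<lambda>K :: nat set. prod_emb {1..} (\<lambda>_. circ) K (\<Pi>\<^sub>E j\<in>K. F j)"
  have m: "?e K \<in> sets m_inf" if "K \<subseteq> J" for K
  proof -
    have "finite K" "K \<subseteq> {1..}" "\<forall>i\<in>K. F i \<in> sets circ"
      using finite_subset[OF that] that J F by blast+
    then show ?thesis unfolding m_inf_def by (rule sets_PiM_I)
  qed
  have e: "?e K = {\<omega> \<in> space m_inf. \<forall>j\<in>K. \<omega> j \<in> F j}" if "K \<subseteq> J" for K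
    by (auto simp add: prod_emb_def space_m_inf restrict_PiE_iff Pi_iff)
  have sp: "x \<in> space (m_inf \<Otimes>\<^sub>M m_inf) \<Longrightarrow> mix S (fst x) (snd x) \<in> space m_inf" for x
    using measurable_space[OF measurable_mix, of x S] by (simp add: split_beta')
  have "(\<lambda>(\<omega>, \<omega>'). mix S \<omega> \<omega>') -` ?e J \<inter> space (m_inf \<Otimes>\<^sub>M m_inf)
      = {x \<in> space (m_inf \<Otimes>\<^sub>M m_inf). \<forall>j\<in>J. mix S (fst x) (snd x) j \<in> F j}"
    using sp by (subst e) (auto simp: split_beta')
  also have "\<dots> = {\<omega> \<in> space m_inf. \<forall>j\<in>J \<inter> S. \<omega> j \<in> F j} \<times> {\<omega> \<in> space m_inf. \<forall>j\<in>J - S. \<omega> j \<in> F j}"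
    by (auto simp: space_pair_measure mix_def)
  also have "\<dots> = ?e (J \<inter> S) \<times> ?e (J - S)"
    by (simp only: e Int_lower1 Diff_subset)
  finally have im: "(\<lambda>(\<omega>, \<omega>'). mix S \<omega> \<omega>') -` ?e J \<inter> space (m_inf \<Otimes>\<^sub>M m_inf) = ?e (J \<inter> S) \<times> ?e (J - S)" .
  have "emeasure (distr (m_inf \<Otimes>\<^sub>M m_inf) m_inf (\<lambda>(\<omega>, \<omega>'). mix S \<omega> \<omega>')) (?e J)
      = emeasure (m_inf \<Otimes>\<^sub>M m_inf) (?e (J \<inter> S) \<times> ?e (J - S))"
    by (subst emeasure_distr[OF measurable_mix m[OF order_refl]]) (simp only: im)
  also have "\<dots> = emeasure m_inf (?e (J \<inter> S)) * emeasure m_inf (?e (J - S))"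
    by (intro m_inf.emeasure_pair_measure_Times m) auto
  also have "\<dots> = (\<Prod>j\<in>J \<inter> S. emeasure circ (F j)) * (\<Prod>j\<in>J - S. emeasure circ (F j))"
  proof -
    have "emeasure m_inf (?e K) = (\<Prod>j\<in>K. emeasure circ (F j))" if "K \<subseteq> J" for K
      using that J F finite_subset[OF that] by (intro m_inf.emeasure_PiM_emb) blast+
    then show ?thesis by (simp only: Int_lower1 Diff_subset)
  qed
  also have "\<dots> = (\<Prod>j\<in>(J \<inter> S) \<union> (J - S). emeasure circ (F j))"
    using J by (intro prod.union_disjoint[symmetric]) auto
  also have "(J \<inter> S) \<union> (J - S) = J" by auto
  finally show "emeasure (distr (m_inf \<Otimes>\<^sub>M m_inf) m_inf (\<lambda>(\<omega>, \<omega>'). mix S \<omega> \<omega>')) (?e J) = (\<Prod>j\<in>J. emeasure circ (F j))" .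
qed

lemma distr_component: "1 \<le> n \<Longrightarrow> distr m_inf circ (\<lambda>\<omega>. \<omega> n) = circ"
  using m_inf.PiM_component[of n] by simp

lemma measurable_upd [measurable]:
  assumes "1 \<le> n"
  shows "(\<lambda>(\<omega>, t). fun_upd \<omega> n t) \<in> measurable (m_inf \<Otimes>\<^sub>M circ) m_inf"
proof -
  have "(\<lambda>x i. if i = n then snd x else fst x i) \<in> measurable (m_inf \<Otimes>\<^sub>M circ) m_inf"
  proof (rule measurable_into_m_inf)
    fix i :: nat assume "1 \<le> i"
    then show "(\<lambda>x. if i = n then snd x else fst x i) \<in> measurable (m_inf \<Otimes>\<^sub>M circ) circ"
      by (cases "i = n") (simp_all add: measurable_compose[OF measurable_fst measurable_component_m_inf])
  qed (use assms in \<open>simp add: space_pair_measure space_m_inf PiE_def extensional_def mem_Times_iff\<close>)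
  moreover have "(\<lambda>(x :: torus \<times> complex) i. if i = n then snd x else fst x i) = (\<lambda>(\<omega>, t). fun_upd \<omega> n t)"
    by (auto simp: fun_eq_iff)
  ultimately show ?thesis by simp
qed

text \<open>The new value of coordinate \<open>n\<close> may be taken from an independent second
  point of the torus, which reduces the claim to \<open>distr_mix\<close> for the complement of
  \<open>{n}\<close>.\<close>

lemma distr_upd:
  assumes n: "1 \<le> n"
  shows "distr (m_inf \<Otimes>\<^sub>M circ) m_inf (\<lambda>(\<omega>, t). fun_upd \<omega> n t) = m_inf"
proof -
  have "m_inf \<Otimes>\<^sub>M circ = distr m_inf m_inf (\<lambda>\<omega>. \<omega>) \<Otimes>\<^sub>M distr m_inf circ (\<lambda>\<omega>. \<omega> n)"
    using n by (simp add: distr_component distr_id2)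
  also have "\<dots> = distr (m_inf \<Otimes>\<^sub>M m_inf) (m_inf \<Otimes>\<^sub>M circ) (\<lambda>(\<omega>, \<omega>'). (\<omega>, \<omega>' n))"
    using n by (intro pair_measure_distr) (auto simp: distr_component circ.sigma_finite_measure_axioms)
  finally have "distr (m_inf \<Otimes>\<^sub>M circ) m_inf (\<lambda>(\<omega>, t). fun_upd \<omega> n t)
     = distr (distr (m_inf \<Otimes>\<^sub>M m_inf) (m_inf \<Otimes>\<^sub>M circ) (\<lambda>(\<omega>, \<omega>'). (\<omega>, \<omega>' n))) m_inf (\<lambda>(\<omega>, t). fun_upd \<omega> n t)"
    by simp
  also have "\<dots> = distr (m_inf \<Otimes>\<^sub>M m_inf) m_inf ((\<lambda>(\<omega>, t). fun_upd \<omega> n t) \<circ> (\<lambda>(\<omega>, \<omega>'). (\<omega>, \<omega>' n)))"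
    using n by (intro distr_distr) auto
  also have "(\<lambda>(\<omega>, t). fun_upd \<omega> n t) \<circ> (\<lambda>(\<omega>, \<omega>'). (\<omega>, \<omega>' n)) = (\<lambda>(\<omega>, \<omega>'). mix (- {n}) \<omega> \<omega>')"
    by (auto simp: fun_eq_iff mix_def)
  finally show ?thesis by (simp only: distr_mix)
qed

text \<open>The even coordinates form a copy of the torus, and the odd ones stay free for the
  independent rotations interleaved with it. Index 0 must be \<open>undefined\<close>, as the
  product space is extensional.\<close>

definition evens :: "torus \<Rightarrow> torus" where
  "evens \<omega> = (\<lambda>i\<in>{1..}. \<omega> (2 * i))"

lemma distr_evens: "distr m_inf m_inf evens = m_inf"
  unfolding m_inf_def evens_def
  by (rule distr_PiM_reindex) (auto simp: prob_space_circ inj_on_def)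

lemma measurable_evens [measurable]: "evens \<in> measurable m_inf m_inf"
  unfolding evens_def restrict_def by (rule measurable_into_m_inf) (simp_all add: measurable_component_m_inf)

lemma AE_mix:
  assumes "AE \<omega> in m_inf. P \<omega>"
  shows "AE \<omega> in m_inf. AE \<omega>' in m_inf. P (mix S \<omega> \<omega>')"
proof -
  have "AE x in m_inf \<Otimes>\<^sub>M m_inf. P ((\<lambda>(\<omega>, \<omega>'). mix S \<omega> \<omega>') x)"
    by (rule AE_distrD[OF measurable_mix]) (use assms in \<open>unfold distr_mix\<close>)
  from mm.AE_pair[OF this] show ?thesis by simp
qed

lemma AE_upd:
  assumes n: "1 \<le> n" and "AE \<omega> in m_inf. P \<omega>"
  shows "AE \<omega> in m_inf. AE t in circ. P (fun_upd \<omega> n t)"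
proof -
  have "AE x in m_inf \<Otimes>\<^sub>M circ. P ((\<lambda>(\<omega>, t). fun_upd \<omega> n t) x)"
    by (rule AE_distrD[OF measurable_upd[OF n]]) (use assms in \<open>unfold distr_upd[OF n]\<close>)
  from mc.AE_pair[OF this] show ?thesis by simp
qed

lemma AE_evens: "AE \<omega> in m_inf. P \<omega> \<Longrightarrow> AE \<omega> in m_inf. P (evens \<omega>)"
  by (rule AE_distrD[OF measurable_evens]) (unfold distr_evens)

lemma integrable_mix:
  fixes f :: "torus \<Rightarrow> 'b :: {banach, second_countable_topology}"
  assumes "integrable m_inf f"
  shows "integrable (m_inf \<Otimes>\<^sub>M m_inf) (\<lambda>(\<omega>, \<omega>'). f (mix S \<omega> \<omega>'))"
  using integrable_distr[OF measurable_mix, of S f] assms unfolding distr_mix by (simp add: split_beta')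

lemma integral_mix:
  fixes f :: "torus \<Rightarrow> 'b :: {banach, second_countable_topology}"
  assumes f: "integrable m_inf f"
  shows "integrable m_inf (\<lambda>\<omega>. \<integral>\<omega>'. f (mix S \<omega> \<omega>') \<partial>m_inf)"
    and "(\<integral>\<omega>. (\<integral>\<omega>'. f (mix S \<omega> \<omega>') \<partial>m_inf) \<partial>m_inf) = (\<integral>\<omega>. f \<omega> \<partial>m_inf)"
    and "AE \<omega> in m_inf. integrable m_inf (\<lambda>\<omega>'. f (mix S \<omega> \<omega>'))"
proof -
  note i = integrable_mix[OF f, of S]
  show "integrable m_inf (\<lambda>\<omega>. \<integral>\<omega>'. f (mix S \<omega> \<omega>') \<partial>m_inf)"
    using mm.integrable_fst'[OF i] by simp
  have "(\<integral>\<omega>. f \<omega> \<partial>m_inf) = (\<integral>\<omega>. f \<omega> \<partial>distr (m_inf \<Otimes>\<^sub>M m_inf) m_inf (\<lambda>(\<omega>, \<omega>'). mix S \<omega> \<omega>'))"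
    by (simp add: distr_mix)
  also have "\<dots> = (\<integral>x. f ((\<lambda>(\<omega>, \<omega>'). mix S \<omega> \<omega>') x) \<partial>(m_inf \<Otimes>\<^sub>M m_inf))"
    using f by (intro integral_distr) auto
  also have "\<dots> = (\<integral>\<omega>. (\<integral>\<omega>'. f (mix S \<omega> \<omega>') \<partial>m_inf) \<partial>m_inf)"
    using mm.integral_fst'[OF i] by (simp add: split_beta')
  finally show "(\<integral>\<omega>. (\<integral>\<omega>'. f (mix S \<omega> \<omega>') \<partial>m_inf) \<partial>m_inf) = (\<integral>\<omega>. f \<omega> \<partial>m_inf)" ..
  show "AE \<omega> in m_inf. integrable m_inf (\<lambda>\<omega>'. f (mix S \<omega> \<omega>'))"
    using mm.AE_integrable_fst'[OF i] by simp
qed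

lemma integral_upd:
  fixes f :: "torus \<Rightarrow> 'b :: {banach, second_countable_topology}"
  assumes n: "1 \<le> n" and f: "integrable m_inf f"
  shows "integrable m_inf (\<lambda>\<omega>. \<integral>t. f (fun_upd \<omega> n t) \<partial>circ)"
    and "(\<integral>\<omega>. (\<integral>t. f (fun_upd \<omega> n t) \<partial>circ) \<partial>m_inf) = (\<integral>\<omega>. f \<omega> \<partial>m_inf)"
    and "AE \<omega> in m_inf. integrable circ (\<lambda>t. f (fun_upd \<omega> n t))"
proof -
  have i: "integrable (m_inf \<Otimes>\<^sub>M circ) (\<lambda>(\<omega>, t). f (fun_upd \<omega> n t))"
    using integrable_distr[OF measurable_upd[OF n], of f] f unfolding distr_upd[OF n] by (simp add: split_beta')
  show "integrable m_inf (\<lambda>\<omega>. \<integral>t. f (fun_upd \<omega> n t) \<partial>circ)"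
    using mc.integrable_fst'[OF i] by simp
  have "(\<integral>\<omega>. f \<omega> \<partial>m_inf) = (\<integral>\<omega>. f \<omega> \<partial>distr (m_inf \<Otimes>\<^sub>M circ) m_inf (\<lambda>(\<omega>, t). fun_upd \<omega> n t))"
    by (simp add: distr_upd[OF n])
  also have "\<dots> = (\<integral>x. f ((\<lambda>(\<omega>, t). fun_upd \<omega> n t) x) \<partial>(m_inf \<Otimes>\<^sub>M circ))"
    using f n by (intro integral_distr) auto
  also have "\<dots> = (\<integral>\<omega>. (\<integral>t. f (fun_upd \<omega> n t) \<partial>circ) \<partial>m_inf)"
    using mc.integral_fst'[OF i] by (simp add: split_beta')
  finally show "(\<integral>\<omega>. (\<integral>t. f (fun_upd \<omega> n t) \<partial>circ) \<partial>m_inf) = (\<integral>\<omega>. f \<omega> \<partial>m_inf)" ..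
  show "AE \<omega> in m_inf. integrable circ (\<lambda>t. f (fun_upd \<omega> n t))"
    using mc.AE_integrable_fst'[OF i] by simp
qed

lemma integral_evens:
  fixes f :: "torus \<Rightarrow> 'b :: {banach, second_countable_topology}"
  assumes "f \<in> borel_measurable m_inf"
  shows "(\<integral>\<omega>. f (evens \<omega>) \<partial>m_inf) = (\<integral>\<omega>. f \<omega> \<partial>m_inf)"
  using integral_distr[OF measurable_evens assms] by (simp add: distr_evens)

section \<open>The filtration and its conditional expectations as integrals\<close>

lemma space_filt [simp]: "space (filt n) = space m_inf"
  by (simp add: filt_def space_measure_of_conv)

lemma measurable_coord: "coord k \<in> borel_measurable m_inf"
proof (cases "k = 0")
  case False
  then have "(\<lambda>\<omega>. \<omega> k) \<in> borel_measurable m_inf"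
    using measurable_compose[OF measurable_component_m_inf id_borel_circ, of k] by simp
  with False show ?thesis by (simp add: coord_def[abs_def])
qed (simp add: coord_def[abs_def])

lemma sets_filt:
  "sets (filt n) = sigma_sets (space m_inf) {coord k -` A \<inter> space m_inf | k A. k \<le> n \<and> A \<in> sets borel}"
  by (subst filt_def, rule sets_measure_of) auto

lemma subalgebra_filt: "subalgebra m_inf (filt n)"
proof -
  have "sets (filt n) \<subseteq> sets m_inf"
    unfolding sets_filt by (rule sets.sigma_sets_subset) (use measurable_sets[OF measurable_coord] in auto)
  then show ?thesis by (simp add: subalgebra_def)
qed

lemma subalgebra_filt_mono:
  assumes "k \<le> j" shows "subalgebra (filt j) (filt k)"
proof -
  have "sets (filt k) \<subseteq> sets (filt j)"
    unfolding sets_filt using assms by (intro sigma_sets_mono') (auto intro: order_trans)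
  then show ?thesis by (simp add: subalgebra_def)
qed

lemma measurable_filt: "f \<in> measurable (filt n) N \<Longrightarrow> f \<in> measurable m_inf N"
  using measurable_from_subalg[OF subalgebra_filt] .

lemma component_filt: 
  assumes "1 \<le> i" "i \<le> n"
  shows "(\<lambda>\<omega>. \<omega> i) \<in> measurable (filt n) circ"
proof -
  have "(\<lambda>\<omega>. \<omega> i) \<in> borel_measurable (filt n)"
  proof (rule measurableI)
    fix A :: "complex set" assume "A \<in> sets borel"
    moreover have "(\<lambda>\<omega>. \<omega> i) -` A \<inter> space (filt n) = coord i -` A \<inter> space m_inf"
      using assms by (auto simp: coord_def)
    ultimately show "(\<lambda>\<omega>. \<omega> i) -` A \<inter> space (filt n) \<in> sets (filt n)"
      unfolding sets_filt using assms by auto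
  qed auto
  then show ?thesis
    unfolding measurable_cong_sets[OF refl sets_circ]
    by (rule measurable_restrict_space2[rotated]) (use assms in \<open>auto simp: space_m_inf PiE_def\<close>)
qed

lemma measurable_into_filt:
  assumes sp: "\<And>x. x \<in> space N \<Longrightarrow> f x \<in> space m_inf"
    and f: "\<And>i. 1 \<le> i \<Longrightarrow> i \<le> n \<Longrightarrow> (\<lambda>x. f x i) \<in> measurable N circ"
  shows "f \<in> measurable N (filt n)"
proof (rule measurable_sigma_sets[OF sets_filt])
  show "f \<in> space N \<rightarrow> space m_inf" using sp by blast
  fix y assume "y \<in> {coord k -` A \<inter> space m_inf | k A. k \<le> n \<and> A \<in> sets borel}"
  then obtain k A where k: "k \<le> n" "A \<in> sets borel" and y: "y = coord k -` A \<inter> space m_inf" by blast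
  have "(\<lambda>x. coord k (f x)) \<in> borel_measurable N"
  proof (cases "k = 0")
    case False
    then have "(\<lambda>x. f x k) \<in> borel_measurable N"
      using measurable_compose[OF f id_borel_circ] k by simp
    then show ?thesis using False by (simp add: coord_def)
  qed (simp add: coord_def)
  moreover have "f -` y \<inter> space N = (\<lambda>x. coord k (f x)) -` A \<inter> space N"
    using sp by (auto simp: y)
  ultimately show "f -` y \<inter> space N \<in> sets N"
    using measurable_sets k(2) by simp
qed blast

text \<open>The generators of \<open>filt n\<close> do not separate points that agree up to
  coordinate \<open>n\<close>, and complements and countable unions preserve this.\<close>

lemma filt_sets_cong:
  assumes "A \<in> sets (filt n)" "\<omega> \<in> space m_inf" "\<omega>' \<in> space m_inf" "\<And>i. 1 \<le> i \<Longrightarrow> i \<le> n \<Longrightarrow> \<omega> i = \<omega>' i"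
  shows "\<omega> \<in> A \<longleftrightarrow> \<omega>' \<in> A"
  using assms(1) unfolding sets_filt
proof induction
  case (Basic a)
  then show ?case using assms(2-4) by (auto simp: coord_def Suc_le_eq)
qed (use assms in auto)

text \<open>The level set of \<open>f\<close> through \<open>f \<omega>\<close> is measurable, so
  \<open>filt_sets_cong\<close> applies to it. This is what allows earlier terms of a martingale to
  be treated as constants in the newest variable.\<close>

lemma filt_cong:
  fixes f :: "torus \<Rightarrow> 'b :: {second_countable_topology, t2_space}"
  assumes f: "f \<in> borel_measurable (filt n)"
    and "\<omega> \<in> space m_inf" "\<omega>' \<in> space m_inf" "\<And>i. 1 \<le> i \<Longrightarrow> i \<le> n \<Longrightarrow> \<omega> i = \<omega>' i"
  shows "f \<omega> = f \<omega>'"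
proof -
  have "f -` {f \<omega>} \<inter> space (filt n) \<in> sets (filt n)"
    using f by (rule measurable_sets) auto
  from filt_sets_cong[OF this assms(2-4)] assms(2,3) show ?thesis by auto
qed

lemma measurable_mix_filt:
  "(\<lambda>(\<omega>, \<omega>'). mix {1..n} \<omega> \<omega>') \<in> measurable (filt n \<Otimes>\<^sub>M m_inf) m_inf"
proof -
  have "(\<lambda>x i. if i \<in> {1..n} then fst x i else snd x i) \<in> measurable (filt n \<Otimes>\<^sub>M m_inf) m_inf"
  proof (rule measurable_into_m_inf)
    fix i :: nat assume "1 \<le> i"
    then show "(\<lambda>x. if i \<in> {1..n} then fst x i else snd x i) \<in> measurable (filt n \<Otimes>\<^sub>M m_inf) circ"
      by (cases "i \<in> {1..n}")
        (simp_all add: measurable_compose[OF measurable_fst component_filt]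
          measurable_compose[OF measurable_snd measurable_component_m_inf])
  qed (simp add: space_pair_measure space_m_inf PiE_def extensional_def mem_Times_iff)
  then show ?thesis by (simp add: mix_def split_beta')
qed

lemma mix_in_space: "\<omega> \<in> space m_inf \<Longrightarrow> \<omega>' \<in> space m_inf \<Longrightarrow> mix S \<omega> \<omega>' \<in> space m_inf"
  by (auto simp: space_m_inf mix_def PiE_def Pi_def extensional_def)

text \<open>The average over the coordinates beyond \<open>n\<close> is measurable by Fubini, and
  for \<open>A\<close> in \<open>filt n\<close> the indicator of \<open>A\<close> is unaffected by
  resampling, so it passes through the inner integral.\<close>

lemma real_cond_exp_filt:
  assumes f: "integrable m_inf f"
  shows "AE \<omega> in m_inf. real_cond_exp m_inf (filt n) f \<omega> = (\<integral>\<omega>'. f (mix {1..n} \<omega> \<omega>') \<partial>m_inf)"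
proof -
  interpret F: finite_measure_subalgebra m_inf "filt n"
    by unfold_locales (rule subalgebra_filt)
  show ?thesis
  proof (rule F.real_cond_exp_charact[OF _ f integral_mix(1)[OF f]])
    have "(\<lambda>x. f ((\<lambda>(\<omega>, \<omega>'). mix {1..n} \<omega> \<omega>') x)) \<in> borel_measurable (filt n \<Otimes>\<^sub>M m_inf)"
      using f by (intro measurable_compose[OF measurable_mix_filt]) auto
    then show "(\<lambda>\<omega>. \<integral>\<omega>'. f (mix {1..n} \<omega> \<omega>') \<partial>m_inf) \<in> borel_measurable (filt n)"
      by (intro m_inf.borel_measurable_lebesgue_integral) (simp add: split_beta')
  next
    fix A assume A: "A \<in> sets (filt n)"
    then have Am: "A \<in> sets m_inf" using subalgebra_filt by (auto simp: subalgebra_def)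
    have i: "integrable m_inf (\<lambda>\<omega>. indicator A \<omega> *\<^sub>R f \<omega>)"
      using Am f by (rule integrable_mult_indicator)
    have "(\<integral>\<omega>. indicator A \<omega> *\<^sub>R f \<omega> \<partial>m_inf)
       = (\<integral>\<omega>. (\<integral>\<omega>'. indicator A (mix {1..n} \<omega> \<omega>') *\<^sub>R f (mix {1..n} \<omega> \<omega>') \<partial>m_inf) \<partial>m_inf)"
      using integral_mix(2)[OF i, of "{1..n}"] by simp
    also have "\<dots> = (\<integral>\<omega>. (\<integral>\<omega>'. indicator A \<omega> *\<^sub>R f (mix {1..n} \<omega> \<omega>') \<partial>m_inf) \<partial>m_inf)"
    proof (intro Bochner_Integration.integral_cong refl)
      fix \<omega> \<omega>' assume "\<omega> \<in> space m_inf" "\<omega>' \<in> space m_inf"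
      then have "mix {1..n} \<omega> \<omega>' \<in> A \<longleftrightarrow> \<omega> \<in> A"
        by (intro filt_sets_cong[OF A] mix_in_space) (auto simp: mix_def)
      then show "indicator A (mix {1..n} \<omega> \<omega>') *\<^sub>R f (mix {1..n} \<omega> \<omega>') = indicator A \<omega> *\<^sub>R f (mix {1..n} \<omega> \<omega>')"
        by (simp add: indicator_def)
    qed
    finally show "(\<integral>\<omega>\<in>A. f \<omega> \<partial>m_inf) = (\<integral>\<omega>\<in>A. (\<integral>\<omega>'. f (mix {1..n} \<omega> \<omega>') \<partial>m_inf) \<partial>m_inf)"
      by (simp add: set_lebesgue_integral_def)
  qed
qed

lemma cexp_filt:
  assumes f: "integrable m_inf f"
  shows "AE \<omega> in m_inf. cexp n f \<omega> = (\<integral>\<omega>'. f (mix {1..n} \<omega> \<omega>') \<partial>m_inf)"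
  using real_cond_exp_filt[OF integrable_Re[OF f], of n] real_cond_exp_filt[OF integrable_Im[OF f], of n]
    integral_mix(3)[OF f, of "{1..n}"]
  by eventually_elim (simp add: cexp_def complex_eq_iff)

lemma measurable_cexp: "cexp n f \<in> borel_measurable (filt n)"
proof -
  have "(\<lambda>\<omega>. Complex (real_cond_exp m_inf (filt n) (\<lambda>\<omega>. Re (f \<omega>)) \<omega>)
      (real_cond_exp m_inf (filt n) (\<lambda>\<omega>. Im (f \<omega>)) \<omega>)) \<in> borel_measurable (filt n)"
    unfolding Complex_eq by measurable
  then show ?thesis by (simp add: cexp_def[abs_def])
qed

section \<open>Superharmonicity along circles\<close>

text \<open>In the variable \<open>t = ln r\<close> the mean over the circle of radius \<open>r\<close> is concave, and it stays bounded as
  \<open>t\<close> tends to minus infinity; hence it is nonincreasing.\<close>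

lemma superharmonic_circle_mean:
  fixes V Vt Vtt Vh Vhh :: "real \<Rightarrow> real \<Rightarrow> real"
  assumes Vt: "\<And>t h. ((\<lambda>t. V t h) has_real_derivative Vt t h) (at t)"
    and Vtt: "\<And>t h. ((\<lambda>t. Vt t h) has_real_derivative Vtt t h) (at t)"
    and Vhh: "\<And>t h. ((\<lambda>h. Vh t h) has_real_derivative Vhh t h) (at h)"
    and per: "\<And>t. Vh t (2 * pi) = Vh t 0"
    and cont: "continuous_on UNIV (\<lambda>(t, h). V t h)" "continuous_on UNIV (\<lambda>(t, h). Vt t h)"
      "continuous_on UNIV (\<lambda>(t, h). Vtt t h)"
    and super: "\<And>t h. Vtt t h + Vhh t h \<le> 0"
    and lim: "((\<lambda>t. integral {0..2 * pi} (V t)) \<longlongrightarrow> l) at_bot"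
  shows "integral {0..2 * pi} (V 0) \<le> l"
proof -
  let ?I = "{0..2 * pi}"
  have slice: "continuous_on S (W t)" if "continuous_on UNIV (\<lambda>(t, h). W t h)" for S t and W :: "real \<Rightarrow> real \<Rightarrow> real"
    by (rule continuous_on_compose2[OF that, of S "\<lambda>h. (t, h)", simplified]) (intro continuous_intros)
  define M where "M t = integral ?I (V t)" for t
  define M1 where "M1 t = integral ?I (Vt t)" for t
  have dM: "(M has_real_derivative M1 t) (at t)" for t
  proof -
    have "((\<lambda>t. integral (cbox 0 (2 * pi)) (V t)) has_real_derivative integral (cbox 0 (2 * pi)) (Vt t)) (at t within UNIV)"
      by (rule leibniz_rule_field_derivative)
        (use Vt cont in \<open>auto intro!: integrable_continuous_interval slice intro: continuous_on_subset\<close>)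
    then show ?thesis by (simp add: M_def[abs_def] M1_def)
  qed
  have dM1: "(M1 has_real_derivative integral ?I (Vtt t)) (at t)" for t
  proof -
    have "((\<lambda>t. integral (cbox 0 (2 * pi)) (Vt t)) has_real_derivative integral (cbox 0 (2 * pi)) (Vtt t)) (at t within UNIV)"
      by (rule leibniz_rule_field_derivative)
        (use Vtt cont in \<open>auto intro!: integrable_continuous_interval slice intro: continuous_on_subset\<close>)
    then show ?thesis by (simp add: M1_def[abs_def])
  qed
  \<comment> \<open>By periodicity of \<open>Vh\<close> the integral of \<open>Vhh\<close> over a
    full period vanishes, so the Laplacian and \<open>Vtt\<close> have the same mean.\<close>
  have "integral ?I (Vtt t) \<le> 0" for t
  proof -
    have h: "((\<lambda>h. Vhh t h) has_integral (Vh t (2 * pi) - Vh t 0)) ?I"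
      by (rule fundamental_theorem_of_calculus)
        (auto intro!: has_field_derivative_at_within Vhh simp flip: has_real_derivative_iff_has_vector_derivative)
    then have "((\<lambda>h. - Vhh t h) has_integral 0) ?I"
      using has_integral_neg[OF h] per by simp
    moreover have "Vtt t h \<le> - Vhh t h" for h using super[of t h] by simp
    ultimately show ?thesis
      using has_integral_le[OF integrable_integral[OF integrable_continuous_interval[OF slice[OF cont(3)]]]]
      by blast
  qed
  then have M1_anti: "M1 b \<le> M1 a" if "a \<le> b" for a b
    using DERIV_nonpos_imp_nonincreasing[OF that, of M1] dM1 by blast
  \<comment> \<open>A positive slope at \<open>t0\<close> would persist to the left by concavity and
    drive the mean to minus infinity, against the limit \<open>l\<close>.\<close>
  have "M1 t0 \<le> 0" for t0
  proof (rule ccontr)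
    assume "\<not> M1 t0 \<le> 0"
    then have pos: "0 < M1 t0" by simp
    have "M t \<le> M t0 - M1 t0 * (t0 - t)" if "t \<le> t0" for t
    proof -
      have "((\<lambda>t. M1 t0 * t - M t)) t0 \<le> (\<lambda>t. M1 t0 * t - M t) t"
        by (rule DERIV_nonpos_imp_nonincreasing[OF that])
          (auto intro!: exI derivative_eq_intros dM M1_anti)
      then show ?thesis by (simp add: algebra_simps)
    qed
    then have le: "eventually (\<lambda>t. M t \<le> M t0 - M1 t0 * (t0 - t)) at_bot"
      by (auto intro: eventually_mono[OF eventually_le_at_bot[of t0]])
    have "filterlim (\<lambda>t. M t0 - M1 t0 * t0 + M1 t0 * t) at_bot at_bot"
      unfolding filterlim_tendsto_add_at_bot_iff[OF tendsto_const]
      by (rule filterlim_tendsto_pos_mult_at_bot[OF tendsto_const pos filterlim_ident])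
    then have "filterlim M at_bot at_bot"
      by (rule filterlim_at_bot_mono) (use le in \<open>simp add: algebra_simps\<close>)
    moreover have "(M \<longlongrightarrow> l) at_bot" using lim by (simp add: M_def[abs_def])
    ultimately show False using not_tendsto_and_filterlim_at_infinity[of at_bot M l]
      by (auto dest: filterlim_at_bot_imp_at_infinity)
  qed
  then have "M 0 \<le> M t" if "t \<le> 0" for t
    by (intro DERIV_nonpos_imp_nonincreasing[OF that]) (use dM in auto)
  then have "eventually (\<lambda>t. M 0 \<le> M t) at_bot"
    by (auto intro: eventually_mono[OF eventually_le_at_bot[of 0]])
  with lim have "M 0 \<le> l"
    by (intro tendsto_lowerbound[of M l at_bot]) (auto simp: M_def[abs_def])
  then show ?thesis by (simp add: M_def)
qed

section \<open>The Bellman function and its Laplacian\<close>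

definition bellman :: "real \<Rightarrow> real \<Rightarrow> real \<Rightarrow> real \<Rightarrow> real \<Rightarrow> real" where
  "bellman m K L w u = u powr m - K * w * u powr (m - 1) - L * w powr m"

definition bellman1 :: "real \<Rightarrow> real \<Rightarrow> real \<Rightarrow> real \<Rightarrow> real \<Rightarrow> real \<Rightarrow> real \<Rightarrow> real" where
  "bellman1 m K L w u w1 u1 = m * u powr (m - 1) * u1 - K * w1 * u powr (m - 1)
     - K * w * ((m - 1) * u powr (m - 2) * u1) - L * m * w powr (m - 1) * w1"

text \<open>In \<open>bellman2\<close> the products \<open>ww\<close>, \<open>wu\<close>, \<open>uu\<close> of first derivatives are separate arguments: the expression is
  linear in them and in \<open>w2\<close>, \<open>u2\<close>, so the values for two directions can be added.\<close>

definition bellman2 :: "real \<Rightarrow> real \<Rightarrow> real \<Rightarrow> real \<Rightarrow> real \<Rightarrow> real \<Rightarrow> real \<Rightarrow> real \<Rightarrow> real \<Rightarrow> real \<Rightarrow> real" where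
  "bellman2 m K L w u ww wu uu w2 u2 =
     m * ((m - 1) * u powr (m - 2) * uu) + m * u powr (m - 1) * u2
     - K * w2 * u powr (m - 1) - 2 * K * (m - 1) * u powr (m - 2) * wu
     - K * w * ((m - 1) * (m - 2) * u powr (m - 3) * uu) - K * w * ((m - 1) * u powr (m - 2) * u2)
     - L * m * ((m - 1) * w powr (m - 2) * ww) - L * m * w powr (m - 1) * w2"

lemma DERIV_powr_const:
  assumes "(f has_real_derivative f1) (at x)" "0 < f x"
  shows "((\<lambda>x. f x powr a) has_real_derivative a * f x powr (a - 1) * f1) (at x)"
  using DERIV_powr[OF assms(1) assms(2) DERIV_const[of a]] assms(2)
  by (simp add: powr_diff divide_simps mult_ac)

lemma bellman_derivs:
  assumes w: "(w has_real_derivative w1 x) (at x)" and u: "(u has_real_derivative u1 x) (at x)"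
    and w1: "(w1 has_real_derivative w2) (at x)" and u1: "(u1 has_real_derivative u2) (at x)"
    and pos: "0 < w x" "0 < u x"
  shows "((\<lambda>x. bellman m K L (w x) (u x)) has_real_derivative bellman1 m K L (w x) (u x) (w1 x) (u1 x)) (at x)"
    and "((\<lambda>x. bellman1 m K L (w x) (u x) (w1 x) (u1 x)) has_real_derivative
      bellman2 m K L (w x) (u x) ((w1 x)\<^sup>2) (w1 x * u1 x) ((u1 x)\<^sup>2) w2 u2) (at x)"
proof -
  note d = DERIV_powr_const[OF w pos(1)] DERIV_powr_const[OF u pos(2)] w u w1 u1
  show "((\<lambda>x. bellman m K L (w x) (u x)) has_real_derivative bellman1 m K L (w x) (u x) (w1 x) (u1 x)) (at x)"
    unfolding bellman_def bellman1_def
    by (rule derivative_eq_intros d refl)+ (simp add: algebra_simps)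
  show "((\<lambda>x. bellman1 m K L (w x) (u x) (w1 x) (u1 x)) has_real_derivative
      bellman2 m K L (w x) (u x) ((w1 x)\<^sup>2) (w1 x * u1 x) ((u1 x)\<^sup>2) w2 u2) (at x)"
    unfolding bellman1_def bellman2_def
    by (rule derivative_eq_intros d refl)+ (simp add: algebra_simps power2_eq_square)
qed

text \<open>The inequality is the superharmonicity of the function along \<open>(f + z, g \<plusminus> z)\<close>, divided by
  \<open>u\<^bsup>m-1\<^esup>\<close>: there \<open>t = w / u\<close>, \<open>x = |f|\<^sup>2 / w\<close>, \<open>y = |f \<plusminus> g|\<^sup>2 / u\<close> and \<open>c\<close> is the inner product of \<open>f\<close> and
  \<open>f \<plusminus> g\<close> divided by \<open>u\<close>.\<close>

lemma bellman_constants: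
  fixes m :: real
  assumes m: "0 < m"
  obtains K L :: real where "0 \<le> K" "2 powr m \<le> L"
    "\<And>t x y c. \<lbrakk>0 < t; t \<le> 1; 0 \<le> y; y \<le> 2; \<bar>c\<bar> \<le> 2 * sqrt t; 0 \<le> x; x \<le> 1\<rbrakk> \<Longrightarrow>
       m * (m - 1) * y + 2 * m - K - 2 * K * (m - 1) * c - K * (m - 1) * (m - 2) * t * y
         - 2 * K * (m - 1) * t - L * m * t powr (m - 1) * (1 + (m - 1) * x) \<le> 0"
proof -
  \<comment> \<open>The contribution of \<open>u powr m\<close> is at most \<open>a\<close>. The
    middle term contributes \<open>- K\<close> up to an error \<open>K * b * sqrt t\<close>, so
    \<open>K = 2 * a\<close> suffices for small \<open>t\<close>. For the other \<open>t\<close> the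
    factor \<open>t powr (m - 1)\<close> is at least \<open>c0\<close>, and \<open>L\<close> is
    chosen so that the last term dominates. If \<open>b = 0\<close>, that is \<open>m = 1\<close>,
    this second range is empty and the value 1 of \<open>c0\<close> only keeps the denominator
    positive.\<close>
  define a where "a = 2 * m + 2 * m * \<bar>m - 1\<bar>"
  define b where "b = 6 * \<bar>m - 1\<bar> + 2 * \<bar>m - 1\<bar> * \<bar>m - 2\<bar>"
  define K where "K = 2 * a"
  define d where "d = (1 / (4 * b\<^sup>2)) powr (m - 1)"
  define c0 where "c0 = (if b = 0 then 1 else min 1 d)"
  define L where "L = max (2 powr m) ((a + K * b) / (m * min 1 m * c0))"
  have a0: "0 < a" and b0: "0 \<le> b" and K0: "0 < K" using m by (auto simp: a_def b_def K_def intro: add_pos_nonneg)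
  have c0: "0 < c0" using b0 by (auto simp: c0_def d_def)
  show thesis
  proof (rule that[of K L])
    show "0 \<le> K" "2 powr m \<le> L" using K0 by (auto simp: L_def)
    fix t x y c :: real
    assume t: "0 < t" "t \<le> 1" and y: "0 \<le> y" "y \<le> 2" and c: "\<bar>c\<bar> \<le> 2 * sqrt t" and x: "0 \<le> x" "x \<le> 1"
    have ts: "t \<le> sqrt t" using t by (simp add: real_le_rsqrt power2_eq_square mult_left_le)
    have 1: "m * (m - 1) * y \<le> 2 * m * \<bar>m - 1\<bar>"
    proof -
      have "m * (m - 1) * y \<le> m * \<bar>m - 1\<bar> * y" using m y by (intro mult_right_mono mult_left_mono) auto
      also have "\<dots> \<le> m * \<bar>m - 1\<bar> * 2" using m y by (intro mult_left_mono) auto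
      finally show ?thesis by simp
    qed
    have 2: "- ((m - 1) * c) \<le> 2 * \<bar>m - 1\<bar> * sqrt t"
    proof -
      have "- ((m - 1) * c) \<le> \<bar>m - 1\<bar> * \<bar>c\<bar>" by (metis abs_ge_minus_self abs_mult)
      also have "\<dots> \<le> \<bar>m - 1\<bar> * (2 * sqrt t)" by (intro mult_left_mono c) auto
      finally show ?thesis by simp
    qed
    have 3: "- ((m - 1) * (m - 2) * t * y) \<le> 2 * \<bar>m - 1\<bar> * \<bar>m - 2\<bar> * sqrt t"
    proof -
      have "- ((m - 1) * (m - 2) * t * y) \<le> \<bar>(m - 1) * (m - 2) * (t * y)\<bar>" by (simp add: mult.assoc)
      also have "\<dots> = \<bar>m - 1\<bar> * \<bar>m - 2\<bar> * (t * y)" using t y by (simp add: abs_mult)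
      also have "\<dots> \<le> \<bar>m - 1\<bar> * \<bar>m - 2\<bar> * (sqrt t * 2)" using t y ts by (intro mult_left_mono mult_mono) auto
      finally show ?thesis by simp
    qed
    have 4: "- ((m - 1) * t) \<le> \<bar>m - 1\<bar> * sqrt t"
    proof -
      have "- ((m - 1) * t) \<le> \<bar>m - 1\<bar> * t" using t by (metis abs_ge_minus_self abs_mult abs_of_pos)
      also have "\<dots> \<le> \<bar>m - 1\<bar> * sqrt t" by (intro mult_left_mono ts) auto
      finally show ?thesis .
    qed
    have 5: "min 1 m \<le> 1 + (m - 1) * x"
    proof (cases "1 \<le> m")
      case False
      then have "(m - 1) * 1 \<le> (m - 1) * x" using x by (intro mult_left_mono_neg) auto
      then show ?thesis by simp
    qed (use x in auto)
    have L0: "0 < L" by (simp add: L_def less_max_iff_disj)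
    have tm: "0 < t powr (m - 1)" using t by simp
    have 6: "L * m * t powr (m - 1) * min 1 m \<le> L * m * t powr (m - 1) * (1 + (m - 1) * x)"
      using L0 m tm by (intro mult_left_mono 5) auto
    have "K * (- 2 * ((m - 1) * c) - (m - 1) * (m - 2) * t * y - 2 * ((m - 1) * t))
        \<le> K * (b * sqrt t)"
      using K0 2 3 4 by (intro mult_left_mono) (auto simp: b_def algebra_simps)
    then have "m * (m - 1) * y + 2 * m - K - 2 * K * (m - 1) * c - K * (m - 1) * (m - 2) * t * y
         - 2 * K * (m - 1) * t - L * m * t powr (m - 1) * (1 + (m - 1) * x)
       \<le> a - K + K * (b * sqrt t) - L * m * t powr (m - 1) * min 1 m" (is "?l \<le> ?r")
      using 1 6 by (simp add: a_def algebra_simps)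
    also have "?r \<le> 0"
    proof (cases "b * sqrt t \<le> 1 / 2")
      case True
      then have "K * (b * sqrt t) \<le> K * (1 / 2)" using K0 by (intro mult_left_mono) auto
      moreover have "0 \<le> L * m * t powr (m - 1) * min 1 m" using L0 m tm by auto
      ultimately show ?thesis by (simp add: K_def)
    next
      case False
      then have b: "b \<noteq> 0" by auto
      then have bp: "0 < b" using b0 by simp
      from False have "(1 / 2)\<^sup>2 \<le> (b * sqrt t)\<^sup>2" using bp t by (intro power_mono) auto
      then have lt: "1 / (4 * b\<^sup>2) \<le> t"
        using bp t by (simp add: power_mult_distrib field_simps)
      have "c0 \<le> t powr (m - 1)"
      proof (cases "1 \<le> m")
        case True
        then have "d \<le> t powr (m - 1)" unfolding d_def using lt bp by (intro powr_mono2) auto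
        then show ?thesis using b by (simp add: c0_def)
      next
        case False
        then have "1 \<le> t powr (m - 1)" using t using powr_mono2'[of "m - 1" t 1] by simp
        then show ?thesis using b by (simp add: c0_def)
      qed
      then have "(a + K * b) \<le> (a + K * b) / (m * min 1 m * c0) * (m * min 1 m * t powr (m - 1))"
      proof -
        have "(a + K * b) * (m * min 1 m) * c0 \<le> (a + K * b) * (m * min 1 m) * t powr (m - 1)"
          using \<open>c0 \<le> _\<close> a0 K0 bp m by (intro mult_left_mono) auto
        then show ?thesis using m c0 by (simp add: field_simps)
      qed
      also have "\<dots> \<le> L * (m * min 1 m * t powr (m - 1))"
        using m tm by (intro mult_right_mono) (auto simp: L_def)
      finally have "a + K * b \<le> L * m * t powr (m - 1) * min 1 m" by (simp add: mult_ac)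
      moreover have "b * sqrt t \<le> b" using b0 t by (auto simp: mult_left_le)
      then have "K * (b * sqrt t) \<le> K * b" using K0 by (intro mult_left_mono) auto
      ultimately show ?thesis using K0 by linarith
    qed
    finally show "?l \<le> 0" .
  qed
qed

definition bellman_admissible :: "real \<Rightarrow> real \<Rightarrow> real \<Rightarrow> bool" where
  "bellman_admissible m K L \<longleftrightarrow> (\<forall>t x y c. 0 < t \<and> t \<le> 1 \<and> 0 \<le> y \<and> y \<le> 2 \<and> \<bar>c\<bar> \<le> 2 * sqrt t \<and> 0 \<le> x \<and> x \<le> 1 \<longrightarrow>
       m * (m - 1) * y + 2 * m - K - 2 * K * (m - 1) * c - K * (m - 1) * (m - 2) * t * y
         - 2 * K * (m - 1) * t - L * m * t powr (m - 1) * (1 + (m - 1) * x) \<le> 0)"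

lemma bellman2_add:
  "bellman2 m K L w u a b c d e + bellman2 m K L w u a' b' c' d' e'
     = bellman2 m K L w u (a + a') (b + b') (c + c') (d + d') (e + e')"
  by (simp add: bellman2_def algebra_simps)

text \<open>By homogeneity the expression is \<open>q * u powr (m - 1)\<close> times the normalised
  one in \<open>bellman_admissible\<close>. In the application \<open>q\<close> and
  \<open>2 * q\<close> are the Laplacians of \<open>w\<close> and \<open>u\<close>, while
  \<open>q * X\<close>, \<open>q * C\<close> and \<open>q * Y\<close> are products of first
  derivatives summed over the two real directions.\<close>

lemma bellman2_nonpos:
  assumes adm: "bellman_admissible m K L" and w: "0 < w" "w \<le> u" and q: "0 \<le> q"
    and X: "0 \<le> X" "X \<le> w" and Y: "0 \<le> Y" "Y \<le> 2 * u" and C: "\<bar>C\<bar> \<le> 2 * sqrt (w * u)"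
  shows "bellman2 m K L w u (q * X) (q * C) (q * Y) q (2 * q) \<le> 0"
proof -
  have u: "0 < u" using w by simp
  define t x y c where "t = w / u" and "x = X / w" and "y = Y / u" and "c = C / u"
  have XY: "X = w * x" "Y = u * y" "C = u * c" and wt: "w = u * t"
    using u w by (auto simp: t_def x_def y_def c_def)
  have "sqrt (w * u) = u * sqrt t" 
    using u by (simp add: wt real_sqrt_mult)
  then have c: "\<bar>c\<bar> \<le> 2 * sqrt t" using C u by (simp add: c_def field_simps abs_mult)
  \<comment> \<open>In terms of \<open>A\<close> and \<open>B\<close> the powers become monomials,
    and the factorisation is plain algebra.\<close>
  define A B where "A = u powr (m - 3)" and "B = w powr (m - 2)"
  have uA: "u powr (m - 1) = u * u * A" "u powr (m - 2) = u * A"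
    using u powr_add[of u 2 "m - 3"] powr_add[of u 1 "m - 3"] by (simp_all add: A_def power2_eq_square)
  have wB: "w powr (m - 1) = w * B"
    using w powr_add[of w 1 "m - 2"] by (simp add: B_def)
  have t0: "0 < t" "t \<le> 1" using u w by (auto simp: t_def)
  have wBA: "w * B = u * u * A * t powr (m - 1)"
  proof -
    have "w powr (m - 1) = u powr (m - 1) * t powr (m - 1)" unfolding wt using u t0 by (simp add: powr_mult)
    then show ?thesis using wB uA by simp
  qed
  have "bellman2 m K L w u (q * X) (q * C) (q * Y) q (2 * q) = m * ((m - 1) * (u * A) * (q * (u * y)))
       + m * (u * u * A) * (2 * q) - K * q * (u * u * A) - 2 * K * (m - 1) * (u * A) * (q * (u * c))
       - K * w * ((m - 1) * (m - 2) * A * (q * (u * y))) - K * w * ((m - 1) * (u * A) * (2 * q))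
       - L * m * ((m - 1) * q * x) * (w * B) - L * m * q * (w * B)"
    unfolding bellman2_def uA wB A_def[symmetric] B_def[symmetric] XY by (simp add: mult_ac)
  also have "\<dots> = q * u powr (m - 1) *
     (m * (m - 1) * y + 2 * m - K - 2 * K * (m - 1) * c - K * (m - 1) * (m - 2) * t * y
         - 2 * K * (m - 1) * t - L * m * t powr (m - 1) * (1 + (m - 1) * x))"
    unfolding wBA uA by (simp add: wt algebra_simps)
  also have "\<dots> \<le> 0"
  proof (rule mult_nonneg_nonpos)
    show "0 \<le> q * u powr (m - 1)" using q by simp
    show "m * (m - 1) * y + 2 * m - K - 2 * K * (m - 1) * c - K * (m - 1) * (m - 2) * t * y
         - 2 * K * (m - 1) * t - L * m * t powr (m - 1) * (1 + (m - 1) * x) \<le> 0"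
    proof -
      have "0 \<le> x" "x \<le> 1" "0 \<le> y" "y \<le> 2" using X Y w u by (auto simp: x_def y_def divide_simps)
      then show ?thesis using adm t0 c unfolding bellman_admissible_def by blast
    qed
  qed
  finally show ?thesis .
qed

text \<open>The shift \<open>e\<close> keeps both arguments of \<open>bellman\<close> positive, away
  from the singularities of the powers with exponents \<open>m - 1\<close>, \<open>m - 2\<close> and
  \<open>m - 3\<close> at 0.\<close>

definition bell :: "real \<Rightarrow> real \<Rightarrow> real \<Rightarrow> real \<Rightarrow> complex \<Rightarrow> complex \<Rightarrow> real" where
  "bell m K L e f g = bellman m K L ((cmod f)\<^sup>2 + e) ((cmod f)\<^sup>2 + e + (cmod g)\<^sup>2)"

lemma has_real_derivative_inner:
  fixes f g :: "real \<Rightarrow> complex"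
  assumes "(f has_vector_derivative f1) (at x)" "(g has_vector_derivative g1) (at x)"
  shows "((\<lambda>x. f x \<bullet> g x) has_real_derivative f x \<bullet> g1 + f1 \<bullet> g x) (at x)"
  unfolding has_real_derivative_iff_has_vector_derivative
  by (rule bounded_bilinear.has_vector_derivative[OF bounded_bilinear_inner assms])

text \<open>\<open>h\<close> and \<open>\<i> * h\<close> are orthogonal and of equal length, so this
  is Parseval's identity in the plane. It adds up the contributions of the two real directions of a
  complex variable.\<close>

lemma inner_rotate_sum:
  fixes a b h :: complex
  shows "(a \<bullet> h) * (b \<bullet> h) + (a \<bullet> (\<i> * h)) * (b \<bullet> (\<i> * h)) = (a \<bullet> b) * (cmod h)\<^sup>2"
  unfolding cmod_power2 by (simp add: inner_complex_def algebra_simps power2_eq_square)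

lemma continuous_on_bellman:
  assumes "continuous_on S w" "continuous_on S u" "\<And>x. x \<in> S \<Longrightarrow> 0 < w x" "\<And>x. x \<in> S \<Longrightarrow> 0 < u x"
  shows "continuous_on S (\<lambda>x. bellman m K L (w x) (u x))"
  unfolding bellman_def using assms(3,4)
  by (intro continuous_intros assms(1,2)) (metis less_irrefl)+

lemma continuous_on_bellman1:
  assumes "continuous_on S w" "continuous_on S u" "\<And>x. x \<in> S \<Longrightarrow> 0 < w x" "\<And>x. x \<in> S \<Longrightarrow> 0 < u x"
    "continuous_on S a" "continuous_on S b"
  shows "continuous_on S (\<lambda>x. bellman1 m K L (w x) (u x) (a x) (b x))"
  unfolding bellman1_def using assms(3,4)
  by (intro continuous_intros assms(1,2,5-)) (metis less_irrefl)+

lemma continuous_on_bellman2: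
  assumes "continuous_on S w" "continuous_on S u" "\<And>x. x \<in> S \<Longrightarrow> 0 < w x" "\<And>x. x \<in> S \<Longrightarrow> 0 < u x"
    "continuous_on S a" "continuous_on S b" "continuous_on S c" "continuous_on S d" "continuous_on S e"
  shows "continuous_on S (\<lambda>x. bellman2 m K L (w x) (u x) (a x) (b x) (c x) (d x) (e x))"
  unfolding bellman2_def using assms(3,4)
  by (intro continuous_intros assms(1,2,5-)) (metis less_irrefl)+

lemma bell_poly_mean:
  fixes p :: "complex poly" and s :: real
  assumes adm: "bellman_admissible m K L" and e: "0 < e" and s: "s = 1 \<or> s = - 1"
  shows "integral {0..2 * pi} (\<lambda>h. bell m K L e (x + poly p (cis h)) (y + of_real s * poly p (cis h)))
    \<le> 2 * pi * bell m K L e (x + poly p 0) (y + of_real s * poly p 0)"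
proof -
  \<comment> \<open>In the logarithmic coordinate \<open>t + \<i> h\<close> the circle of radius
    \<open>exp t\<close> becomes a vertical segment, and \<open>t\<close> tending to minus infinity
    corresponds to the centre of the disc.\<close>
  define H where "H z = poly p (exp z)" for z
  define H1 where "H1 z = poly (pderiv p) (exp z) * exp z" for z
  define H2 where "H2 z = poly (pderiv (pderiv p)) (exp z) * exp z * exp z + poly (pderiv p) (exp z) * exp z" for z
  have dH: "(H has_field_derivative H1 z) (at z)" and dH1: "(H1 has_field_derivative H2 z) (at z)" for z
    unfolding H_def[abs_def] H1_def[abs_def] H2_def
    by (auto intro!: derivative_eq_intros poly_DERIV[THEN DERIV_chain2] simp: algebra_simps)
  have cH: "continuous_on UNIV H" "continuous_on UNIV H1" "continuous_on UNIV H2"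
    unfolding H_def H1_def H2_def by (auto intro!: continuous_intros)
  define F where "F z = x + H z" for z
  define G where "G z = y + of_real s * H z" for z
  \<comment> \<open>When \<open>F\<close> moves by \<open>d\<close> and \<open>G\<close> by
    \<open>s * d\<close>, the function \<open>u\<close> changes at the rate
    \<open>2 * (S \<bullet> d)\<close>; this is why \<open>S\<close> appears in all derivatives of
    \<open>u\<close>.\<close>
  define S where "S z = F z + of_real s * G z" for z
  have ss: "of_real s * of_real s = (1 :: complex)" "s * s = 1" using s by auto
  have dt: "((\<lambda>t. Complex t h) has_vector_derivative 1) (at t)" for t h
    unfolding Complex_eq by (auto intro!: derivative_eq_intros)
  have dh: "((\<lambda>h. Complex t h) has_vector_derivative \<i>) (at h)" for t h
    unfolding Complex_eq by (auto intro!: derivative_eq_intros)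
  have chain: "((\<lambda>x. g (c x)) has_vector_derivative c1 * g1) (at x)"
    if "(c has_vector_derivative c1) (at x)" "(g has_field_derivative g1) (at (c x))" for g c c1 g1 and x :: real
    using field_vector_diff_chain_at[OF that] by (simp add: o_def)
  have dF: "(F has_field_derivative H1 z) (at z)" and dG: "(G has_field_derivative of_real s * H1 z) (at z)" for z
    unfolding F_def[abs_def] G_def[abs_def] by (auto intro!: derivative_eq_intros dH)
  have dS: "(S has_field_derivative 2 * H1 z) (at z)" for z
    unfolding S_def[abs_def] using ss by (auto intro!: derivative_eq_intros dF dG simp flip: mult.assoc)
  define w where "w z = (cmod (F z))\<^sup>2 + e" for z
  define u where "u z = w z + (cmod (G z))\<^sup>2" for z
  have w_pos: "0 < w z" and wu: "w z \<le> u z" for z using e by (auto simp: w_def u_def add_nonneg_pos)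
  have u_pos: "0 < u z" for z using w_pos[of z] wu[of z] by simp
  have w1: "((\<lambda>x. w (c x)) has_real_derivative 2 * (F (c x) \<bullet> (c1 * H1 (c x)))) (at x)"
    and u1: "((\<lambda>x. u (c x)) has_real_derivative 2 * (S (c x) \<bullet> (c1 * H1 (c x)))) (at x)"
    if c: "(c has_vector_derivative c1) (at x)" for c c1 and x :: real
  proof -
    note f = chain[OF c dF] and g = chain[OF c dG]
    show w: "((\<lambda>x. w (c x)) has_real_derivative 2 * (F (c x) \<bullet> (c1 * H1 (c x)))) (at x)"
      unfolding w_def power2_norm_eq_inner
      by (rule derivative_eq_intros has_real_derivative_inner[OF f f] refl)+ (simp add: inner_commute)
    show "((\<lambda>x. u (c x)) has_real_derivative 2 * (S (c x) \<bullet> (c1 * H1 (c x)))) (at x)"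
      unfolding u_def power2_norm_eq_inner
      by (rule derivative_eq_intros w has_real_derivative_inner[OF g g] refl)+
        (simp add: S_def inner_complex_def algebra_simps)
  qed
  have w2: "((\<lambda>x. 2 * (F (c x) \<bullet> (c1 * H1 (c x)))) has_real_derivative
        2 * (cmod (c1 * H1 (c x)))\<^sup>2 + 2 * (F (c x) \<bullet> (c1 * c1 * H2 (c x)))) (at x)"
    and u2: "((\<lambda>x. 2 * (S (c x) \<bullet> (c1 * H1 (c x)))) has_real_derivative
        4 * (cmod (c1 * H1 (c x)))\<^sup>2 + 2 * (S (c x) \<bullet> (c1 * c1 * H2 (c x)))) (at x)"
    if c: "(c has_vector_derivative c1) (at x)" for c c1 and x :: real
  proof -
    note f = chain[OF c dF] and g = chain[OF c dS]
    have h: "((\<lambda>x. c1 * H1 (c x)) has_vector_derivative c1 * (c1 * H2 (c x))) (at x)"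
      by (rule has_vector_derivative_mult_right[OF chain[OF c dH1]])
    show "((\<lambda>x. 2 * (F (c x) \<bullet> (c1 * H1 (c x)))) has_real_derivative
        2 * (cmod (c1 * H1 (c x)))\<^sup>2 + 2 * (F (c x) \<bullet> (c1 * c1 * H2 (c x)))) (at x)"
      unfolding power2_norm_eq_inner
      by (rule derivative_eq_intros has_real_derivative_inner[OF f h] refl)+ (simp add: mult.assoc)
    show "((\<lambda>x. 2 * (S (c x) \<bullet> (c1 * H1 (c x)))) has_real_derivative
        4 * (cmod (c1 * H1 (c x)))\<^sup>2 + 2 * (S (c x) \<bullet> (c1 * c1 * H2 (c x)))) (at x)"
      unfolding power2_norm_eq_inner
      by (rule derivative_eq_intros has_real_derivative_inner[OF g h] refl)+
        (simp add: mult.assoc inner_complex_def algebra_simps)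
  qed
  define V where "V t h = bellman m K L (w (Complex t h)) (u (Complex t h))" for t h
  define D1 where "D1 c z = bellman1 m K L (w z) (u z) (2 * (F z \<bullet> (c * H1 z))) (2 * (S z \<bullet> (c * H1 z)))" for c z
  define D2 where "D2 c z = bellman2 m K L (w z) (u z) ((2 * (F z \<bullet> (c * H1 z)))\<^sup>2)
      (2 * (F z \<bullet> (c * H1 z)) * (2 * (S z \<bullet> (c * H1 z)))) ((2 * (S z \<bullet> (c * H1 z)))\<^sup>2)
      (2 * (cmod (c * H1 z))\<^sup>2 + 2 * (F z \<bullet> (c * c * H2 z)))
      (4 * (cmod (c * H1 z))\<^sup>2 + 2 * (S z \<bullet> (c * c * H2 z)))" for c z
  \<comment> \<open>The formulas hold along any path of constant velocity \<open>c1\<close>; the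
    velocities 1 and \<open>\<i>\<close> give the two partial derivatives.\<close>
  have D: "((\<lambda>x. bellman m K L (w (c x)) (u (c x))) has_real_derivative D1 c1 (c x)) (at x)"
    "((\<lambda>x. D1 c1 (c x)) has_real_derivative D2 c1 (c x)) (at x)"
    if c: "(c has_vector_derivative c1) (at x)" for c c1 and x :: real
    unfolding D1_def[abs_def] D2_def
    by (rule bellman_derivs[OF w1[OF c] u1[OF c] w2[OF c] u2[OF c] w_pos u_pos])+
  have cont_Complex: "continuous_on UNIV (\<lambda>z. Complex (fst z) (snd z))"
    unfolding Complex_eq by (intro continuous_intros)
  have cwu: "continuous_on UNIV w" "continuous_on UNIV u" "continuous_on UNIV F" "continuous_on UNIV S"
    unfolding w_def u_def S_def F_def G_def by (intro continuous_intros cH)+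
  have cV: "continuous_on UNIV (\<lambda>z. bellman m K L (w z) (u z))" "continuous_on UNIV (D1 c)" "continuous_on UNIV (D2 c)" for c
    unfolding D1_def[abs_def] D2_def[abs_def]
    by (intro continuous_on_bellman continuous_on_bellman1 continuous_on_bellman2 cwu w_pos u_pos
        continuous_intros cH)+
  have comp: "continuous_on UNIV (\<lambda>(t, h). g (Complex t h))" if "continuous_on UNIV g" for g :: "complex \<Rightarrow> real"
    using continuous_on_compose2[OF that cont_Complex] by (simp add: split_beta')
  have "integral {0..2 * pi} (V 0) \<le> 2 * pi * bell m K L e (x + poly p 0) (y + of_real s * poly p 0)"
  proof (rule superharmonic_circle_mean)
    show "((\<lambda>t. V t h) has_real_derivative D1 1 (Complex t h)) (at t)"
      "((\<lambda>t. D1 1 (Complex t h)) has_real_derivative D2 1 (Complex t h)) (at t)" for t h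
      using D[OF dt] by (simp_all add: V_def[abs_def])
    show "((\<lambda>h. D1 \<i> (Complex t h)) has_real_derivative D2 \<i> (Complex t h)) (at h)" for t h
      using D(2)[OF dh] by simp
    show "D1 \<i> (Complex t (2 * pi)) = D1 \<i> (Complex t 0)" for t
      by (simp add: D1_def w_def u_def F_def S_def G_def H_def H1_def exp_eq_polar)
    show "continuous_on UNIV (\<lambda>(t, h). V t h)" "continuous_on UNIV (\<lambda>(t, h). D1 1 (Complex t h))"
      "continuous_on UNIV (\<lambda>(t, h). D2 1 (Complex t h))"
      unfolding V_def by (rule comp[OF cV(1)] comp[OF cV(2)] comp[OF cV(3)])+
    show "D2 1 (Complex t h) + D2 \<i> (Complex t h) \<le> 0" for t h
    proof -
      define z where "z = Complex t h"
      define q where "q = 4 * (cmod (H1 z))\<^sup>2"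
      have sum: "(2 * (a \<bullet> (1 * H1 z))) * (2 * (b \<bullet> (1 * H1 z))) + (2 * (a \<bullet> (\<i> * H1 z))) * (2 * (b \<bullet> (\<i> * H1 z)))
          = q * (a \<bullet> b)" for a b
        using inner_rotate_sum[of a "H1 z" b] by (simp add: q_def algebra_simps)
      \<comment> \<open>The terms with \<open>H2\<close> cancel because the squares of 1 and
        \<open>\<i>\<close> add up to 0: this is where holomorphy enters.\<close>
      have "D2 1 z + D2 \<i> z = bellman2 m K L (w z) (u z) (q * (F z \<bullet> F z)) (q * (F z \<bullet> S z)) (q * (S z \<bullet> S z)) q (2 * q)"
        unfolding D2_def bellman2_add power2_eq_square[of "2 * _"] sum
        by (simp add: q_def norm_mult)
      also have "\<dots> \<le> 0"
      proof (rule bellman2_nonpos[OF adm w_pos wu])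
        have S2: "(cmod (S z))\<^sup>2 \<le> 2 * u z"
        proof -
          have "cmod (S z) \<le> cmod (F z) + cmod (G z)"
            unfolding S_def using s by (auto intro: norm_triangle_ineq4 norm_triangle_ineq)
          then have "(cmod (S z))\<^sup>2 \<le> (cmod (F z) + cmod (G z))\<^sup>2" by (intro power_mono) auto
          also have "\<dots> \<le> 2 * ((cmod (F z))\<^sup>2 + (cmod (G z))\<^sup>2)"
            using sum_squares_bound[of "cmod (F z)" "cmod (G z)"] by (simp add: power2_sum)
          finally show ?thesis using e by (simp add: u_def w_def)
        qed
        show "0 \<le> q" "0 \<le> F z \<bullet> F z" "0 \<le> S z \<bullet> S z" by (auto simp: q_def)
        show "F z \<bullet> F z \<le> w z" using e by (simp add: w_def flip: power2_norm_eq_inner)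
        show "S z \<bullet> S z \<le> 2 * u z" using S2 by (simp flip: power2_norm_eq_inner)
        have "\<bar>F z \<bullet> S z\<bar> \<le> cmod (F z) * cmod (S z)" by (rule Cauchy_Schwarz_ineq2)
        also have "\<dots> \<le> sqrt (w z) * sqrt (2 * u z)"
          using S2 e by (intro mult_mono) (auto simp: w_def intro!: real_le_rsqrt)
        also have "\<dots> = sqrt 2 * sqrt (w z * u z)" by (simp add: real_sqrt_mult)
        also have "\<dots> \<le> 2 * sqrt (w z * u z)"
          using w_pos[of z] u_pos[of z] by (intro mult_right_mono) (auto simp: real_le_lsqrt)
        finally show "\<bar>F z \<bullet> S z\<bar> \<le> 2 * sqrt (w z * u z)" .
      qed
      finally show ?thesis by (simp add: z_def)
    qed
    \<comment> \<open>The limit is taken in the radius \<open>r = exp t\<close>: the mean is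
      continuous in \<open>r\<close> down to \<open>r = 0\<close>, where the integrand is
      constant.\<close>
    define I where "I r = integral (cbox 0 (2 * pi)) (\<lambda>h. bell m K L e (x + poly p (of_real r * cis h)) (y + of_real s * poly p (of_real r * cis h)))" for r
    have cI: "continuous_on UNIV I"
      unfolding I_def
    proof (rule integral_continuous_on_param)
      have "continuous_on UNIV (\<lambda>z. bell m K L e (x + poly p (of_real (fst z) * cis (snd z)))
          (y + of_real s * poly p (of_real (fst z) * cis (snd z))))"
        unfolding bell_def using e
        by (intro continuous_on_bellman continuous_intros) (smt (verit, best) zero_le_power2)+
      then show "continuous_on (UNIV \<times> cbox 0 (2 * pi)) (\<lambda>(r, h). bell m K L e (x + poly p (of_real r * cis h))
          (y + of_real s * poly p (of_real r * cis h)))"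
        using continuous_on_subset[OF _ subset_UNIV] by (simp add: split_beta')
    qed
    then have "(I \<longlongrightarrow> I 0) (at 0)" by (simp add: continuous_on_def)
    then have "(I \<longlongrightarrow> I 0) (nhds 0)" by (simp add: tendsto_nhds_iff)
    then have "((\<lambda>t. I (exp t)) \<longlongrightarrow> I 0) at_bot"
      by (rule filterlim_compose) (rule exp_at_bot)
    moreover have "I (exp t) = integral {0..2 * pi} (V t)" for t
    proof -
      have "exp (Complex t h) = of_real (exp t) * cis h" for h by (simp add: exp_eq_polar)
      then show ?thesis by (simp add: I_def V_def[abs_def] bell_def w_def u_def F_def G_def H_def)
    qed
    moreover have "I 0 = 2 * pi * bell m K L e (x + poly p 0) (y + of_real s * poly p 0)"
      by (simp add: I_def)
    ultimately show "((\<lambda>t. integral {0..2 * pi} (V t)) \<longlongrightarrow> 2 * pi * bell m K L e (x + poly p 0) (y + of_real s * poly p 0)) at_bot"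
      by simp
  qed
  moreover have "V 0 h = bell m K L e (x + poly p (cis h)) (y + of_real s * poly p (cis h))" for h
    by (simp add: V_def bell_def w_def u_def F_def G_def H_def exp_eq_polar)
  ultimately show ?thesis by (simp add: V_def[abs_def])
qed

section \<open>Fejer means on the circle\<close>

lemma integral_circ:
  fixes f :: "complex \<Rightarrow> 'b :: {banach, second_countable_topology}"
  assumes [measurable]: "f \<in> borel_measurable circ"
  shows "(\<integral>t. f t \<partial>circ) = (\<integral>\<theta>. indicator {0..2 * pi} \<theta> *\<^sub>R f (cis \<theta>) \<partial>lborel) /\<^sub>R (2 * pi)"
proof -
  have m: "(\<lambda>\<theta>. f (cis \<theta>)) \<in> borel_measurable borel"
    using measurable_compose[OF measurable_cis_restrict, of f borel] assms
    by (simp add: measurable_cong_sets[OF sets_circ refl])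
  have u: "uniform_measure lborel {0..2 * pi} = density lborel (\<lambda>\<theta>. ennreal (indicator {0..2 * pi} \<theta> / (2 * pi)))"
    unfolding uniform_measure_def
    by (intro density_cong) (auto simp: indicator_def divide_ennreal[symmetric] divide_ennreal_def inverse_ennreal split: if_splits)
  have "(\<integral>t. f t \<partial>circ) = (\<integral>\<theta>. f (cis \<theta>) \<partial>uniform_measure lborel {0..2 * pi})"
    unfolding circ_def
    by (rule integral_distr) (use assms in \<open>simp_all add: measurable_cong_sets[OF sets_circ refl]\<close>)
  also have "\<dots> = (\<integral>\<theta>. (indicator {0..2 * pi} \<theta> / (2 * pi)) *\<^sub>R f (cis \<theta>) \<partial>lborel)"
    unfolding u using m by (intro integral_density) auto
  also have "\<dots> = (\<integral>\<theta>. (1 / (2 * pi)) *\<^sub>R (indicator {0..2 * pi} \<theta> *\<^sub>R f (cis \<theta>)) \<partial>lborel)"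
    by (intro Bochner_Integration.integral_cong) auto
  also have "\<dots> = (\<integral>\<theta>. indicator {0..2 * pi} \<theta> *\<^sub>R f (cis \<theta>) \<partial>lborel) /\<^sub>R (2 * pi)"
    by (simp only: integral_scaleR_right inverse_eq_divide)
  finally show ?thesis .
qed

lemma integral_circ_continuous:
  fixes f :: "complex \<Rightarrow> 'b :: euclidean_space"
  assumes "continuous_on (sphere 0 1) f"
  shows "(\<integral>t. f t \<partial>circ) = integral {0..2 * pi} (\<lambda>\<theta>. f (cis \<theta>)) /\<^sub>R (2 * pi)"
proof -
  have "continuous_on {0..2 * pi} (\<lambda>\<theta>. f (cis \<theta>))"
    by (rule continuous_on_compose2[OF assms]) (auto intro!: continuous_intros)
  then have "set_integrable lborel {0..2 * pi} (\<lambda>\<theta>. f (cis \<theta>))"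
    by (rule borel_integrable_atLeastAtMost')
  from set_borel_integral_eq_integral(2)[OF this] show ?thesis
    by (simp add: integral_circ continuous_borel_circ[OF assms] set_lebesgue_integral_def)
qed

lemma integrable_circ_continuous:
  fixes f :: "complex \<Rightarrow> 'b :: {banach, second_countable_topology}"
  assumes "continuous_on (sphere 0 1) f"
  shows "integrable circ f"
proof -
  have "compact (f ` sphere 0 1)" by (rule compact_continuous_image[OF assms]) simp
  then obtain B where "\<forall>x\<in>f ` sphere 0 1. norm x \<le> B" using compact_imp_bounded bounded_iff by blast
  then show ?thesis
    by (intro circ.integrable_const_bound[of _ B]) (auto simp: continuous_borel_circ[OF assms] intro!: AE_I2)
qed

lemma powi_sphere: "cmod t = 1 \<Longrightarrow> t powi (int l - int j) = t ^ l * cnj t ^ j"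
proof -
  assume t: "cmod t = 1"
  then have "t * cnj t = 1" using complex_norm_square[of t] by simp
  then have "cnj t = inverse t" by (rule inverse_unique[symmetric])
  moreover have "t \<noteq> 0" using t by auto
  ultimately show ?thesis by (simp add: power_int_diff power_inverse divide_inverse)
qed

lemma integral_circ_powi: "(\<integral>t. t powi k \<partial>circ) = (if k = 0 then 1 else 0)"
proof -
  have c: "continuous_on (sphere 0 1) (\<lambda>t :: complex. t powi k)"
    by (intro continuous_intros) auto
  show ?thesis
  proof (cases "k = 0")
    case False
    have e: "cis \<theta> powi k = exp (\<i> * of_int k * of_real \<theta>)" for \<theta>
      by (subst cis_power_int) (simp add: cis_conv_exp mult_ac)
    have "((\<lambda>\<theta>. exp (\<i> * of_int k * of_real \<theta>)) has_integral
        (exp (\<i> * of_int k * of_real (2 * pi)) / (\<i> * of_int k) - exp (\<i> * of_int k * of_real 0) / (\<i> * of_int k))) {0..2 * pi}"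
      by (rule fundamental_theorem_of_calculus)
        (use False in \<open>auto intro!: derivative_eq_intros has_vector_derivative_real_field\<close>)
    moreover have "exp (\<i> * of_int k * of_real (2 * pi)) = 1"
      using exp_integer_2pi[of "of_int k"] by (simp add: mult_ac)
    ultimately have "integral {0..2 * pi} (\<lambda>\<theta>. cis \<theta> powi k) = 0"
      by (simp add: e integral_unique)
    with False show ?thesis by (simp add: integral_circ_continuous[OF c])
  qed (simp add: circ.prob_space[simplified])
qed

lemma fourier_coeff_powi: "fourier_coeff (\<lambda>t. t powi j) k = (if k = j then 1 else 0)"
proof -
  have "fourier_coeff (\<lambda>t. t powi j) k = (\<integral>t. t powi (j - k) \<partial>circ)"
    unfolding fourier_coeff_def
  proof (intro Bochner_Integration.integral_cong refl)
    fix t assume "t \<in> space circ"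
    then have "t \<noteq> 0" by auto
    then show "t powi j * t powi - k = t powi (j - k)"
      by (simp add: power_int_diff power_int_minus divide_inverse)
  qed
  then show ?thesis by (simp add: integral_circ_powi)
qed

text \<open>The Fejer kernel, in the form that makes positivity evident; for
  \<open>n \<ge> 1\<close> its Fourier coefficients on the circle are \<open>1 - |k| / n\<close> for
  \<open>|k| < n\<close> and 0 otherwise.\<close>

definition fejer :: "nat \<Rightarrow> complex \<Rightarrow> real" where
  "fejer n z = (cmod (\<Sum>j<n. z ^ j))\<^sup>2 / n"

text \<open>On the circle \<open>z * cnj t\<close> is the quotient of \<open>z\<close> and
  \<open>t\<close>, so this is convolution with the Fejer kernel, the Cesaro mean of the partial
  Fourier sums.\<close>

definition cesaro :: "nat \<Rightarrow> (complex \<Rightarrow> complex) \<Rightarrow> complex \<Rightarrow> complex" where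
  "cesaro n h z = (\<integral>t. of_real (fejer n (z * cnj t)) * h t \<partial>circ)"

lemma fejer_nonneg: "0 \<le> fejer n z"
  by (simp add: fejer_def)

lemma fejer_cnj: "fejer n (cnj z) = fejer n z"
proof -
  have "(\<Sum>j<n. cnj z ^ j) = cnj (\<Sum>j<n. z ^ j)" by simp
  then show ?thesis by (simp only: fejer_def complex_mod_cnj)
qed

lemma fejer_bound: "cmod z = 1 \<Longrightarrow> z \<noteq> 1 \<Longrightarrow> fejer n z \<le> 4 / (n * (cmod (1 - z))\<^sup>2)"
proof -
  assume z: "cmod z = 1" "z \<noteq> 1"
  have "cmod (z ^ n - 1) \<le> 2" using norm_triangle_ineq4[of "z ^ n" 1] z by (simp add: norm_power)
  then have "(cmod (z ^ n - 1))\<^sup>2 \<le> 2\<^sup>2" by (intro power_mono) auto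
  moreover have "(\<Sum>j<n. z ^ j) = (z ^ n - 1) / (z - 1)" using z by (simp add: geometric_sum)
  ultimately show ?thesis
    by (simp add: fejer_def norm_divide power_divide norm_minus_commute[of z] divide_right_mono field_simps)
qed

lemma fejer_le: "cmod z = 1 \<Longrightarrow> fejer n z \<le> n"
proof -
  assume z: "cmod z = 1"
  have "cmod (\<Sum>j<n. z ^ j) \<le> n" using norm_sum[of "\<lambda>j. z ^ j" "{..<n}"] z by (simp add: norm_power)
  then have "(cmod (\<Sum>j<n. z ^ j))\<^sup>2 \<le> (real n)\<^sup>2" by (intro power_mono) auto
  then show ?thesis by (cases "n = 0") (simp_all add: fejer_def field_simps power2_eq_square)
qed

lemma continuous_on_fejer [continuous_intros]:
  "continuous_on S f \<Longrightarrow> continuous_on S (\<lambda>x. fejer n (f x))"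
  unfolding fejer_def divide_inverse by (intro continuous_intros)

lemma fejer_expand:
  assumes "cmod t = 1"
  shows "of_real (fejer n (z * cnj t)) = (\<Sum>j<n. \<Sum>l<n. z ^ j * cnj z ^ l * t powi (int l - int j)) / n"
proof -
  have "of_real ((cmod (\<Sum>j<n. (z * cnj t) ^ j))\<^sup>2) = (\<Sum>j<n. (z * cnj t) ^ j) * cnj (\<Sum>j<n. (z * cnj t) ^ j)"
    by (rule complex_norm_square)
  also have "\<dots> = (\<Sum>j<n. \<Sum>l<n. z ^ j * cnj z ^ l * t powi (int l - int j))"
    unfolding cnj_sum sum_product
    using assms by (intro sum.cong refl) (simp add: power_mult_distrib powi_sphere mult_ac)
  finally show ?thesis by (simp add: fejer_def)
qed

lemma integrable_powi_mult:
  assumes h: "integrable circ h" shows "integrable circ (\<lambda>t. t powi k * h t)"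
proof (rule Bochner_Integration.integrable_bound[OF h])
  have "(\<lambda>t. t powi k) \<in> borel_measurable circ" 
    by (intro continuous_borel_circ continuous_intros) auto
  then show "(\<lambda>t. t powi k * h t) \<in> borel_measurable circ" using h by auto
qed (auto simp: norm_mult norm_power_int intro!: AE_I2)

lemma cesaro_sum:
  assumes h: "integrable circ h"
  shows "cesaro n h z = (\<Sum>j<n. \<Sum>l<n. z ^ j * cnj z ^ l * fourier_coeff h (int j - int l)) / n"
proof -
  have "cesaro n h z = (\<integral>t. (\<Sum>j<n. \<Sum>l<n. z ^ j * cnj z ^ l * (t powi (int l - int j) * h t)) / n \<partial>circ)"
    unfolding cesaro_def
    by (intro Bochner_Integration.integral_cong refl)
      (simp add: fejer_expand sum_distrib_right mult.assoc)
  also have "\<dots> = (\<Sum>j<n. \<Sum>l<n. z ^ j * cnj z ^ l * (\<integral>t. t powi (int l - int j) * h t \<partial>circ)) / n"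
    by (simp add: integrable_powi_mult[OF h] Bochner_Integration.integral_sum)
  finally show ?thesis by (simp add: fourier_coeff_def mult.commute)
qed

lemma integral_fejer:
  assumes "1 \<le> n" "cmod z = 1"
  shows "(\<integral>t. fejer n (z * cnj t) \<partial>circ) = 1"
proof -
  have z: "z ^ j * cnj z ^ j = 1" for j
    using assms(2) by (metis complex_norm_square mult.commute of_real_1 one_power2 power_mult_distrib power_one)
  have c0: "fourier_coeff (\<lambda>_. 1) k = (if k = 0 then 1 else 0)" for k
    using fourier_coeff_powi[of 0 k] by simp
  have "(\<Sum>l<n. z ^ j * cnj z ^ l * fourier_coeff (\<lambda>_. 1) (int j - int l)) = 1" if "j < n" for j
  proof -
    have "(\<Sum>l<n. z ^ j * cnj z ^ l * fourier_coeff (\<lambda>_. 1) (int j - int l))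
        = (\<Sum>l<n. if l = j then z ^ j * cnj z ^ j else 0)"
      unfolding c0 by (intro sum.cong) auto
    then show ?thesis using that z by simp
  qed
  then have "cesaro n (\<lambda>_. 1) z = 1" using assms(1) by (simp add: cesaro_sum)
  moreover have "cesaro n (\<lambda>_. 1) z = of_real (\<integral>t. fejer n (z * cnj t) \<partial>circ)"
    unfolding cesaro_def by (simp only: mult_1_right integral_complex_of_real)
  ultimately show ?thesis by (simp only: of_real_eq_1_iff)
qed

lemma integral_fejer':
  assumes "1 \<le> n" "cmod t = 1"
  shows "(\<integral>z. fejer n (z * cnj t) \<partial>circ) = 1"
proof -
  have "fejer n (z * cnj t) = fejer n (t * cnj z)" for z
    using fejer_cnj[of n "z * cnj t"] by (simp add: mult.commute)
  then show ?thesis using integral_fejer[OF assms] by simp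
qed

text \<open>In \<open>cesaro_sum\<close> the pair \<open>j\<close>, \<open>l\<close> carries the
  frequency \<open>j - l\<close>. Analyticity removes the pairs with \<open>j < l\<close>, and the
  \<open>n\<close> diagonal pairs produce the constant term, so the value at the centre is exactly
  the mean of \<open>h\<close>.\<close>

lemma cesaro_poly:
  assumes h: "integrable circ h" and an: "\<And>k. k < 0 \<Longrightarrow> fourier_coeff h k = 0" and n: "1 \<le> n"
  obtains p where "\<And>z. cmod z = 1 \<Longrightarrow> cesaro n h z = poly p z" "poly p 0 = fourier_coeff h 0"
proof
  let ?p = "smult (1 / of_nat n) (\<Sum>j<n. \<Sum>l<n. if l \<le> j then monom (fourier_coeff h (int (j - l))) (j - l) else 0)"
  show "cesaro n h z = poly ?p z" if z: "cmod z = 1" for z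
  proof -
    have zz: "z ^ j * cnj z ^ l = z ^ (j - l)" if "l \<le> j" for j l
      using powi_sphere[OF z, of j l] that by (simp add: power_int_def nat_diff_distrib)
    have "z ^ j * cnj z ^ l * fourier_coeff h (int j - int l)
       = poly (if l \<le> j then monom (fourier_coeff h (int (j - l))) (j - l) else 0) z" for j l
      using an[of "int j - int l"] zz[of l j] by (simp add: poly_monom of_nat_diff)
    then show ?thesis by (simp add: cesaro_sum[OF h] poly_sum)
  qed
  have "(\<Sum>l<n. poly (if l \<le> j then monom (fourier_coeff h (int (j - l))) (j - l) else 0) 0) = fourier_coeff h 0"
    if "j < n" for j
  proof -
    have "(\<Sum>l<n. poly (if l \<le> j then monom (fourier_coeff h (int (j - l))) (j - l) else 0) 0)
       = (\<Sum>l<n. if l = j then fourier_coeff h 0 else 0)"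
      by (intro sum.cong) (auto simp: poly_monom)
    then show ?thesis using that by simp
  qed
  then show "poly ?p 0 = fourier_coeff h 0" using n by (simp add: poly_sum)
qed

section \<open>Density of the continuous functions in L1 of the circle\<close>

definition L1_approximable :: "(complex \<Rightarrow> complex) \<Rightarrow> bool" where
  "L1_approximable f \<longleftrightarrow>
    (\<forall>e>0. \<exists>g. continuous_on (sphere 0 1) g \<and> (\<integral>t. cmod (f t - g t) \<partial>circ) < e)"

lemma L1_approximable_continuous: "continuous_on (sphere 0 1) f \<Longrightarrow> L1_approximable f"
  unfolding L1_approximable_def by (auto intro!: exI[of _ f])

lemma L1_approximable_add:
  assumes f: "integrable circ f" "L1_approximable f" and g: "integrable circ g" "L1_approximable g"
  shows "L1_approximable (\<lambda>t. f t + g t)"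
  unfolding L1_approximable_def
proof (intro allI impI)
  fix e :: real assume "0 < e"
  then have e: "0 < e / 2" by simp
  obtain f' where f': "continuous_on (sphere 0 1) f'" "(\<integral>t. cmod (f t - f' t) \<partial>circ) < e / 2"
    using f(2) e unfolding L1_approximable_def by blast
  obtain g' where g': "continuous_on (sphere 0 1) g'" "(\<integral>t. cmod (g t - g' t) \<partial>circ) < e / 2"
    using g(2) e unfolding L1_approximable_def by blast
  note i = integrable_circ_continuous[OF f'(1)] integrable_circ_continuous[OF g'(1)]
  have "(\<integral>t. cmod (f t + g t - (f' t + g' t)) \<partial>circ) \<le> (\<integral>t. cmod (f t - f' t) + cmod (g t - g' t) \<partial>circ)"
    using f(1) g(1) i by (intro integral_mono) (auto intro: norm_diff_triangle_ineq)
  also have "\<dots> = (\<integral>t. cmod (f t - f' t) \<partial>circ) + (\<integral>t. cmod (g t - g' t) \<partial>circ)"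
    using f(1) g(1) i by (intro Bochner_Integration.integral_add) auto
  also have "\<dots> < e" using f'(2) g'(2) by simp
  finally show "\<exists>h. continuous_on (sphere 0 1) h \<and> (\<integral>t. cmod (f t + g t - h t) \<partial>circ) < e"
    by (intro exI[of _ "\<lambda>t. f' t + g' t"] conjI continuous_on_add f' g')
qed

lemma L1_approximable_lim:
  assumes s: "\<And>i. integrable circ (s i)" "\<And>i. L1_approximable (s i)"
    and lim: "\<And>t. t \<in> sphere 0 1 \<Longrightarrow> (\<lambda>i. s i t) \<longlonglongrightarrow> f t"
    and w: "integrable circ w" "\<And>i t. t \<in> sphere 0 1 \<Longrightarrow> cmod (s i t) \<le> w t"
  shows "L1_approximable f"
proof -
  have f: "integrable circ f" 
    by (rule integrable_dominated_convergence[of f circ s w])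
      (use s lim w in \<open>auto intro!: AE_I2 borel_measurable_LIMSEQ_metric[of s circ f]\<close>)
  have fw: "cmod (f t) \<le> w t" if "t \<in> sphere 0 1" for t
    by (rule tendsto_upperbound[OF tendsto_norm[OF lim[OF that]]]) (use w(2)[OF that] in auto)
  have "(\<lambda>i. \<integral>t. cmod (f t - s i t) \<partial>circ) \<longlonglongrightarrow> (\<integral>t. 0 \<partial>circ)"
  proof (rule integral_dominated_convergence[where w = "\<lambda>t. 2 * w t"])
    show "AE t in circ. (\<lambda>i. cmod (f t - s i t)) \<longlonglongrightarrow> 0"
    proof (rule AE_I2)
      fix t assume "t \<in> space circ"
      then have "(\<lambda>i. cmod (f t - s i t)) \<longlonglongrightarrow> cmod (f t - f t)"
        by (intro tendsto_intros lim) simp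
      then show "(\<lambda>i. cmod (f t - s i t)) \<longlonglongrightarrow> 0" by simp
    qed
    show "AE t in circ. norm (cmod (f t - s i t)) \<le> 2 * w t" for i
    proof (rule AE_I2)
      fix t assume "t \<in> space circ"
      then have "cmod (f t) \<le> w t" "cmod (s i t) \<le> w t" using fw w(2) by auto
      then show "norm (cmod (f t - s i t)) \<le> 2 * w t" using norm_triangle_ineq4[of "f t" "s i t"] by simp
    qed
  qed (use f s w in auto)
  then have lim0: "(\<lambda>i. \<integral>t. cmod (f t - s i t) \<partial>circ) \<longlonglongrightarrow> 0" by simp
  show ?thesis
    unfolding L1_approximable_def
  proof (intro allI impI)
    fix e :: real assume "0 < e"
    then have e: "0 < e / 2" by simp
    obtain i where i: "(\<integral>t. cmod (f t - s i t) \<partial>circ) < e / 2"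
      using order_tendstoD(2)[OF lim0 e] by (auto simp: eventually_sequentially)
    obtain g where g: "continuous_on (sphere 0 1) g" "(\<integral>t. cmod (s i t - g t) \<partial>circ) < e / 2"
      using s(2)[of i] e unfolding L1_approximable_def by blast
    note ig = integrable_circ_continuous[OF g(1)]
    have "(\<integral>t. cmod (f t - g t) \<partial>circ) \<le> (\<integral>t. cmod (f t - s i t) + cmod (s i t - g t) \<partial>circ)"
      using f s(1) ig by (intro integral_mono) (auto intro: norm_diff_triangle_le)
    also have "\<dots> = (\<integral>t. cmod (f t - s i t) \<partial>circ) + (\<integral>t. cmod (s i t - g t) \<partial>circ)"
      using f s(1) ig by (intro Bochner_Integration.integral_add) auto
    also have "\<dots> < e" using i g(2) by simp
    finally show "\<exists>g. continuous_on (sphere 0 1) g \<and> (\<integral>t. cmod (f t - g t) \<partial>circ) < e"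
      using g(1) by blast
  qed
qed

lemma integrable_circ_bounded:
  fixes f :: "complex \<Rightarrow> 'b :: {banach, second_countable_topology}"
  shows "f \<in> borel_measurable circ \<Longrightarrow> (\<And>t. t \<in> sphere 0 1 \<Longrightarrow> norm (f t) \<le> B) \<Longrightarrow> integrable circ f"
  by (intro circ.integrable_const_bound[of _ B]) (auto intro!: AE_I2)

lemma measurable_circ_indicator:
  assumes "A \<in> sets borel" shows "(indicator A :: complex \<Rightarrow> complex) \<in> borel_measurable circ"
  by (rule measurable_compose[OF id_borel_circ]) (use assms in auto)

lemma integrable_circ_indicator: "A \<in> sets borel \<Longrightarrow> integrable circ (indicator A :: complex \<Rightarrow> complex)"
  by (rule integrable_circ_bounded[of _ 1]) (auto simp: measurable_circ_indicator indicator_def)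

lemma L1_approximable_open:
  assumes U: "open U" shows "L1_approximable (indicator U)"
proof (cases "U = UNIV")
  case False
  then have ne: "- U \<noteq> {}" by auto
  \<comment> \<open>Truncated multiples of the distance to the complement increase to the indicator.
    The whole plane is a separate case because the distance to the empty set is 0 by
    convention.\<close>
  define s where "s k t = complex_of_real (min 1 (real k * infdist t (- U)))" for k t
  have cont: "continuous_on (sphere 0 1) (s k)" for k
    unfolding s_def by (intro continuous_intros)
  show ?thesis
  proof (rule L1_approximable_lim[of s "indicator U" "\<lambda>_. 1"])
    show "integrable circ (s i)" "L1_approximable (s i)" for i
      using integrable_circ_continuous[OF cont] L1_approximable_continuous[OF cont] by auto
    show "integrable circ (\<lambda>_. 1 :: real)" by simp
    show "cmod (s i t) \<le> 1" for i t by (auto simp: s_def infdist_nonneg)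
    fix t :: complex
    show "(\<lambda>k. s k t) \<longlonglongrightarrow> indicator U t"
    proof (cases "t \<in> U")
      case True
      then have d: "0 < infdist t (- U)" using infdist_pos_not_in_closed[of "- U" t] U ne by auto
      obtain n :: nat where "1 / infdist t (- U) < n" using reals_Archimedean2 by blast
      then have n: "1 < n * infdist t (- U)" using d by (simp add: field_simps)
      have "s k t = 1" if "n \<le> k" for k
      proof -
        have "n * infdist t (- U) \<le> k * infdist t (- U)" using that d by (intro mult_right_mono) auto
        then show ?thesis using n by (simp add: s_def)
      qed
      then have "(\<lambda>k. s k t) \<longlonglongrightarrow> 1"
        by (intro tendsto_eventually) (auto simp: eventually_sequentially)
      then show ?thesis using True by simp
    next
      case False
      then show ?thesis by (simp add: s_def)
    qed
  qed
qed (auto intro: L1_approximable_continuous)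

text \<open>Open sets are stable under intersection and generate the Borel sets, and the sets with
  approximable indicator are closed under complements and countable disjoint unions; Dynkin's
  theorem concludes.\<close>

lemma L1_approximable_borel:
  assumes "A \<in> sets borel" shows "L1_approximable (indicator A)"
proof -
  have "Int_stable {S :: complex set. open S}" "{S :: complex set. open S} \<subseteq> Pow UNIV"
    by (auto simp: Int_stable_def)
  moreover have "A \<in> sigma_sets UNIV {S. open S}" using assms by (simp add: sets_borel)
  ultimately show ?thesis
  proof (induction rule: sigma_sets_induct_disjoint)
    case (basic A)
    then show ?case by (simp add: L1_approximable_open)
  next
    case empty
    show ?case by (rule L1_approximable_continuous) (simp add: indicator_def)
  next
    case (compl A)
    show ?case unfolding L1_approximable_def
    proof (intro allI impI)
      fix e :: real assume "0 < e"
      then obtain g where g: "continuous_on (sphere 0 1) g" "(\<integral>t. cmod (indicator A t - g t) \<partial>circ) < e"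
        using compl(2) unfolding L1_approximable_def by blast
      have "cmod (indicator (UNIV - A) t - (1 - g t)) = cmod (indicator A t - g t)" for t
        by (auto simp: indicator_def norm_minus_commute)
      with g show "\<exists>g. continuous_on (sphere 0 1) g \<and> (\<integral>t. cmod (indicator (UNIV - A) t - g t) \<partial>circ) < e"
        by (intro exI[of _ "\<lambda>t. 1 - g t"]) (auto intro!: continuous_intros)
    qed
  next
    case (union A)
    have A: "A i \<in> sets borel" for i using union(2) by (auto simp: sets_borel)
    show ?case
    proof (rule L1_approximable_lim[of "\<lambda>k t. indicator (\<Union>i<k. A i) t" "indicator (\<Union>i. A i)" "\<lambda>_. 1"])
      fix k
      show "integrable circ (\<lambda>t. indicator (\<Union>i<k. A i) t :: complex)"
        by (rule integrable_circ_indicator) (use A in auto)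
      show "L1_approximable (\<lambda>t. indicator (\<Union>i<k. A i) t)"
      proof (induction k)
        case 0
        show ?case by (rule L1_approximable_continuous) simp
      next
        case (Suc k)
        have "disjoint_family_on A {..<Suc k}" "disjoint_family_on A {..<k}"
          using union(1) by (auto simp: disjoint_family_on_def)
        then have "indicator (\<Union>i<Suc k. A i) t = (indicator (\<Union>i<k. A i) t :: complex) + indicator (A k) t" for t
          by (simp add: indicator_UN_disjoint)
        moreover have "L1_approximable (\<lambda>t. indicator (\<Union>i<k. A i) t + indicator (A k) t)"
          by (intro L1_approximable_add Suc.IH union(3) integrable_circ_indicator) (use A in auto)
        ultimately show ?case by presburger
      qed
      show "cmod (indicator (\<Union>i<k. A i) t) \<le> 1" for t by (simp add: indicator_def)
    qed (simp_all add: LIMSEQ_indicator_UN)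
  qed
qed

lemma L1_approximable:
  assumes "integrable circ f" shows "L1_approximable f"
  using assms
proof (induction f rule: integrable_induct)
  case (base A c)
  have A: "A \<in> sets borel"
    using base(1) by (auto simp: sets_circ sets_restrict_space)
  show ?case unfolding L1_approximable_def
  proof (intro allI impI)
    fix e :: real assume "0 < e"
    then have "0 < e / (cmod c + 1)" by (simp add: add_nonneg_pos)
    then obtain g where g: "continuous_on (sphere 0 1) g" "(\<integral>t. cmod (indicator A t - g t) \<partial>circ) < e / (cmod c + 1)"
      using L1_approximable_borel[OF A] unfolding L1_approximable_def by blast
    have "cmod (indicator A t *\<^sub>R c - g t * c) = cmod (indicator A t - g t) * cmod c" for t
      by (simp add: indicator_def scaleR_conv_of_real left_diff_distrib flip: norm_mult)
    then have "(\<integral>t. cmod (indicator A t *\<^sub>R c - g t * c) \<partial>circ) = (\<integral>t. cmod (indicator A t - g t) \<partial>circ) * cmod c"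
      by simp
    also have "\<dots> \<le> (\<integral>t. cmod (indicator A t - g t) \<partial>circ) * (cmod c + 1)"
      by (intro mult_left_mono) auto
    also have "\<dots> < e" using g(2) by (simp add: pos_less_divide_eq add_nonneg_pos)
    finally show "\<exists>g. continuous_on (sphere 0 1) g \<and> (\<integral>t. cmod (indicator A t *\<^sub>R c - g t) \<partial>circ) < e"
      by (intro exI[of _ "\<lambda>t. g t * c"] conjI) (auto intro!: continuous_intros g(1))
  qed
next
  case (add f g)
  then show ?case by (intro L1_approximable_add)
next
  case (lim f s)
  show ?case
    by (rule L1_approximable_lim[of s f "\<lambda>t. 2 * cmod (f t)"]) (use lim in auto)
qed

section \<open>Contraction and convergence of the Cesaro means\<close>

interpretation cc: pair_prob_space circ circ ..

lemma measurable_fejer_pair: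
  "(\<lambda>x. fejer n (fst x * cnj (snd x))) \<in> borel_measurable (circ \<Otimes>\<^sub>M circ)"
proof -
  have m: "fst \<in> borel_measurable (circ \<Otimes>\<^sub>M circ)" "snd \<in> borel_measurable (circ \<Otimes>\<^sub>M circ)"
    using measurable_compose[OF measurable_fst id_borel_circ]
      measurable_compose[OF measurable_snd id_borel_circ] by simp_all
  have c: "cnj \<in> borel_measurable borel" "fejer n \<in> borel_measurable borel"
    by (auto intro!: borel_measurable_continuous_onI continuous_intros)
  show ?thesis
    by (intro measurable_compose[OF _ c(2)] borel_measurable_times measurable_compose[OF _ c(1)] m)
qed

lemma measurable_fejer [measurable]: "(\<lambda>t. fejer n (z * cnj t)) \<in> borel_measurable circ"
  "(\<lambda>z. fejer n (z * cnj t)) \<in> borel_measurable circ"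
  by (intro continuous_borel_circ continuous_intros)+

lemma nn_integral_fejer:
  assumes "1 \<le> n" "cmod z = 1"
  shows "(\<integral>\<^sup>+t. ennreal (fejer n (z * cnj t)) \<partial>circ) = 1" "(\<integral>\<^sup>+t. ennreal (fejer n (t * cnj z)) \<partial>circ) = 1"
proof -
  have "integrable circ (\<lambda>t. fejer n (z * cnj t))" "integrable circ (\<lambda>t. fejer n (t * cnj z))"
    by (intro integrable_circ_continuous continuous_intros)+
  then show "(\<integral>\<^sup>+t. ennreal (fejer n (z * cnj t)) \<partial>circ) = 1" "(\<integral>\<^sup>+t. ennreal (fejer n (t * cnj z)) \<partial>circ) = 1"
    using assms by (simp_all add: nn_integral_eq_integral fejer_nonneg integral_fejer integral_fejer')
qed

text \<open>Tonelli's theorem, as the kernel also has integral 1 in its first variable.\<close>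

lemma nn_integral_fejer_average:
  assumes n: "1 \<le> n" and w: "w \<in> borel_measurable circ"
  shows "(\<integral>\<^sup>+z. \<integral>\<^sup>+t. ennreal (fejer n (z * cnj t)) * w t \<partial>circ \<partial>circ) = (\<integral>\<^sup>+t. w t \<partial>circ)"
proof -
  have "(\<lambda>x. ennreal (fejer n (fst x * cnj (snd x))) * w (snd x)) \<in> borel_measurable (circ \<Otimes>\<^sub>M circ)"
    using measurable_fejer_pair[of n] measurable_compose[OF measurable_snd w, of circ] by auto
  then have "(\<integral>\<^sup>+z. \<integral>\<^sup>+t. ennreal (fejer n (z * cnj t)) * w t \<partial>circ \<partial>circ)
      = (\<integral>\<^sup>+t. \<integral>\<^sup>+z. ennreal (fejer n (z * cnj t)) * w t \<partial>circ \<partial>circ)"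
    by (rule cc.Fubini'[of "\<lambda>z t. ennreal (fejer n (z * cnj t)) * w t", unfolded split_beta', symmetric])
  also have "\<dots> = (\<integral>\<^sup>+t. w t \<partial>circ)"
    using n by (intro nn_integral_cong) (simp add: nn_integral_multc nn_integral_fejer)
  finally show ?thesis .
qed

lemma integrable_fejer_mult:
  fixes h :: "complex \<Rightarrow> 'b :: {banach, second_countable_topology}"
  assumes h: "integrable circ h" and z: "cmod z = 1"
  shows "integrable circ (\<lambda>t. fejer n (z * cnj t) *\<^sub>R h t)"
proof (rule Bochner_Integration.integrable_bound)
  show "integrable circ (\<lambda>t. real n * norm (h t))" using h by auto
  show "(\<lambda>t. fejer n (z * cnj t) *\<^sub>R h t) \<in> borel_measurable circ" using h by auto
  show "AE t in circ. norm (fejer n (z * cnj t) *\<^sub>R h t) \<le> norm (real n * norm (h t))"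
    using z by (auto intro!: AE_I2 mult_right_mono fejer_le simp: fejer_nonneg norm_mult)
qed

lemma cesaro_norm_le:
  assumes h: "integrable circ h" and z: "cmod z = 1"
  shows "cmod (cesaro n h z) \<le> (\<integral>t. fejer n (z * cnj t) * cmod (h t) \<partial>circ)"
  unfolding cesaro_def
  using integral_norm_bound[of circ "\<lambda>t. of_real (fejer n (z * cnj t)) * h t"]
  by (simp add: norm_mult fejer_nonneg)

text \<open>The kernel is a probability density, so Jensen's inequality bounds the integrand at
  \<open>z\<close> by an average over \<open>t\<close>, and averaging over \<open>z\<close> returns
  the original integral. \<open>B > 0\<close> keeps the argument of the power in the open half-line
  on which convexity is used.\<close>

lemma cesaro_convex_bound:
  assumes n: "1 \<le> n" and s: "1 \<le> s" and B: "0 < B" and h: "integrable circ h"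
    and i: "integrable circ (\<lambda>t. (B + cmod (h t)) powr s)"
  shows "(\<integral>\<^sup>+z. ennreal ((B + cmod (cesaro n h z)) powr s) \<partial>circ) \<le> (\<integral>\<^sup>+t. ennreal ((B + cmod (h t)) powr s) \<partial>circ)"
proof -
  have "ennreal ((B + cmod (cesaro n h z)) powr s) \<le> (\<integral>\<^sup>+t. ennreal (fejer n (z * cnj t)) * ennreal ((B + cmod (h t)) powr s) \<partial>circ)"
    if z: "cmod z = 1" for z
  proof -
    let ?D = "density circ (\<lambda>t. ennreal (fejer n (z * cnj t)))"
    interpret D: prob_space ?D
      by (rule prob_spaceI) (simp add: emeasure_density nn_integral_fejer[OF n z] del: space_circ cong: nn_integral_cong_simp)
    have ih: "integrable circ (\<lambda>t. cmod (h t))" using h by auto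
    have D: "integrable ?D f \<longleftrightarrow> integrable circ (\<lambda>t. fejer n (z * cnj t) *\<^sub>R f t)"
      "integral\<^sup>L ?D f = (\<integral>t. fejer n (z * cnj t) *\<^sub>R f t \<partial>circ)" if "f \<in> borel_measurable circ" for f :: "complex \<Rightarrow> real"
      using that by (simp_all add: integrable_density integral_density fejer_nonneg)
    have I: "integrable ?D (\<lambda>t. cmod (h t))" "integrable ?D (\<lambda>t. (B + cmod (h t)) powr s)"
      using integrable_fejer_mult[OF ih z] integrable_fejer_mult[OF i z] h by (simp_all add: D)
    have "cmod (cesaro n h z) \<le> (\<integral>t. cmod (h t) \<partial>?D)"
      using cesaro_norm_le[OF h z] h by (simp add: D)
    then have "(B + cmod (cesaro n h z)) powr s \<le> (\<integral>t. B + cmod (h t) \<partial>?D) powr s"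
      using B s I(1) D.prob_space by (intro powr_mono2) auto
    also have "\<dots> \<le> (\<integral>t. (B + cmod (h t)) powr s \<partial>?D)"
      by (rule D.jensens_inequality[where I = "{0<..}"])
        (use I B s in \<open>auto intro!: AE_I2 powr_convex add_pos_nonneg\<close>)
    also have "\<dots> = (\<integral>t. fejer n (z * cnj t) * (B + cmod (h t)) powr s \<partial>circ)"
      using h by (simp add: D)
    finally have "ennreal ((B + cmod (cesaro n h z)) powr s) \<le> ennreal (\<integral>t. fejer n (z * cnj t) * (B + cmod (h t)) powr s \<partial>circ)"
      by (rule ennreal_leI)
    also have "\<dots> = (\<integral>\<^sup>+t. ennreal (fejer n (z * cnj t) * (B + cmod (h t)) powr s) \<partial>circ)"
      using integrable_fejer_mult[OF i z] by (intro nn_integral_eq_integral[symmetric]) (auto simp: fejer_nonneg)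
    finally show ?thesis by (simp add: ennreal_mult' fejer_nonneg)
  qed
  then have "(\<integral>\<^sup>+z. ennreal ((B + cmod (cesaro n h z)) powr s) \<partial>circ)
      \<le> (\<integral>\<^sup>+z. \<integral>\<^sup>+t. ennreal (fejer n (z * cnj t)) * ennreal ((B + cmod (h t)) powr s) \<partial>circ \<partial>circ)"
    by (intro nn_integral_mono) simp
  also have "\<dots> = (\<integral>\<^sup>+t. ennreal ((B + cmod (h t)) powr s) \<partial>circ)"
    using h by (intro nn_integral_fejer_average n) auto
  finally show ?thesis .
qed

lemma continuous_cesaro:
  assumes "integrable circ h" shows "continuous_on S (cesaro n h)"
proof -
  have "cesaro n h = (\<lambda>z. (\<Sum>j<n. \<Sum>l<n. z ^ j * cnj z ^ l * fourier_coeff h (int j - int l)) * inverse (of_nat n))"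
    by (simp add: fun_eq_iff cesaro_sum[OF assms] divide_inverse)
  then show ?thesis by (simp only:) (intro continuous_intros)
qed

lemma cesaro_L1_contraction:
  assumes n: "1 \<le> n" and h: "integrable circ h"
  shows "(\<integral>z. cmod (cesaro n h z) \<partial>circ) \<le> (\<integral>t. cmod (h t) \<partial>circ)"
proof -
  have "ennreal (\<integral>z. cmod (cesaro n h z) \<partial>circ) = (\<integral>\<^sup>+z. ennreal (cmod (cesaro n h z)) \<partial>circ)"
    using integrable_circ_continuous[OF continuous_cesaro[OF h]] by (intro nn_integral_eq_integral[symmetric]) auto
  also have "\<dots> \<le> (\<integral>\<^sup>+z. \<integral>\<^sup>+t. ennreal (fejer n (z * cnj t)) * ennreal (cmod (h t)) \<partial>circ \<partial>circ)"
  proof (intro nn_integral_mono)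
    fix z assume "z \<in> space circ"
    then have z: "cmod z = 1" by simp
    have "ennreal (cmod (cesaro n h z)) \<le> ennreal (\<integral>t. fejer n (z * cnj t) * cmod (h t) \<partial>circ)"
      by (rule ennreal_leI[OF cesaro_norm_le[OF h z]])
    also have "\<dots> = (\<integral>\<^sup>+t. ennreal (fejer n (z * cnj t) * cmod (h t)) \<partial>circ)"
      using integrable_fejer_mult[OF integrable_norm[OF h] z]
      by (intro nn_integral_eq_integral[symmetric]) (auto simp: fejer_nonneg)
    finally show "ennreal (cmod (cesaro n h z)) \<le> (\<integral>\<^sup>+t. ennreal (fejer n (z * cnj t)) * ennreal (cmod (h t)) \<partial>circ)"
      by (simp add: ennreal_mult' fejer_nonneg)
  qed
  also have "\<dots> = (\<integral>\<^sup>+t. ennreal (cmod (h t)) \<partial>circ)"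
    using h by (intro nn_integral_fejer_average n) auto
  also have "\<dots> = ennreal (\<integral>t. cmod (h t) \<partial>circ)"
    using h by (intro nn_integral_eq_integral) auto
  finally show ?thesis by (simp add: ennreal_le_iff)
qed

lemma cesaro_diff:
  assumes "integrable circ f" "integrable circ g" "cmod z = 1"
  shows "cesaro n (\<lambda>t. f t - g t) z = cesaro n f z - cesaro n g z"
  using integrable_fejer_mult[OF assms(1,3), of n] integrable_fejer_mult[OF assms(2,3), of n]
  by (simp add: cesaro_def right_diff_distrib scaleR_conv_of_real)

text \<open>Uniform continuity controls the part of the integral near \<open>z\<close>. Away from
  \<open>z\<close>, \<open>fejer_bound\<close> makes the kernel of order
  \<open>1 / n\<close>.\<close>

lemma cesaro_uniform:
  assumes f: "continuous_on (sphere 0 1) f" and e: "0 < e"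
  shows "eventually (\<lambda>n. \<forall>z\<in>sphere 0 1. cmod (cesaro n f z - f z) \<le> e) sequentially"
proof -
  note fi = integrable_circ_continuous[OF f]
  have "compact (f ` sphere 0 1)" by (rule compact_continuous_image[OF f]) simp
  then obtain B where B: "\<And>t. t \<in> sphere 0 1 \<Longrightarrow> cmod (f t) \<le> B" "0 \<le> B"
    using compact_imp_bounded bounded_pos by (metis image_eqI less_imp_le)
  have "uniformly_continuous_on (sphere 0 1) f"
    by (rule compact_uniformly_continuous[OF f]) simp
  then obtain d where d: "0 < d" "\<And>t z. t \<in> sphere 0 1 \<Longrightarrow> z \<in> sphere 0 1 \<Longrightarrow> dist t z < d \<Longrightarrow> dist (f t) (f z) < e / 2"
    using e unfolding uniformly_continuous_on_def by (metis half_gt_zero)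
  \<comment> \<open>For \<open>n\<close> at least 1 and \<open>N\<close>, the far part, a kernel
    bound \<open>4 / (n * d^2)\<close> times the oscillation \<open>2 * B\<close>, is at most
    \<open>e / 2\<close>.\<close>
  obtain N :: nat where N: "16 * B / (d\<^sup>2 * e) < N" using reals_Archimedean2 by blast
  have "cmod (cesaro n f z - f z) \<le> e" if n: "max 1 N \<le> n" and z: "z \<in> sphere 0 1" for n z
  proof -
    have z1: "cmod z = 1" using z by simp
    have n1: "1 \<le> n" using n by simp
    have K: "integrable circ (\<lambda>t. fejer n (z * cnj t))" by (intro integrable_circ_continuous continuous_intros)
    have one: "(\<integral>t. fejer n (z * cnj t) \<partial>circ) = 1" by (rule integral_fejer[OF n1 z1])
    have "cesaro n f z - f z = (\<integral>t. of_real (fejer n (z * cnj t)) * f t \<partial>circ) - (\<integral>t. of_real (fejer n (z * cnj t)) * f z \<partial>circ)"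
      using one by (simp add: cesaro_def)
    also have "\<dots> = (\<integral>t. of_real (fejer n (z * cnj t)) * (f t - f z) \<partial>circ)"
      using integrable_fejer_mult[OF fi z1, of n] K
      by (subst Bochner_Integration.integral_diff[symmetric]) (auto simp: right_diff_distrib scaleR_conv_of_real)
    finally have "cmod (cesaro n f z - f z) \<le> (\<integral>t. cmod (of_real (fejer n (z * cnj t)) * (f t - f z)) \<partial>circ)"
      using integral_norm_bound by metis
    also have "\<dots> \<le> (\<integral>t. fejer n (z * cnj t) * (e / 2) + 8 * B / (n * d\<^sup>2) \<partial>circ)"
    proof (rule integral_mono)
      show "integrable circ (\<lambda>t. cmod (of_real (fejer n (z * cnj t)) * (f t - f z)))"
        by (intro integrable_circ_continuous continuous_intros f)
      show "integrable circ (\<lambda>t. fejer n (z * cnj t) * (e / 2) + 8 * B / (n * d\<^sup>2))" using K by auto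
      fix t assume "t \<in> space circ"
      then have t: "t \<in> sphere 0 1" by simp
      show "cmod (of_real (fejer n (z * cnj t)) * (f t - f z)) \<le> fejer n (z * cnj t) * (e / 2) + 8 * B / (n * d\<^sup>2)"
      proof (cases "dist t z < d")
        case True
        then have "cmod (f t - f z) \<le> e / 2" using d(2)[OF t z] by (simp add: dist_norm)
        then have "fejer n (z * cnj t) * cmod (f t - f z) \<le> fejer n (z * cnj t) * (e / 2)"
          by (intro mult_left_mono fejer_nonneg)
        moreover have "0 \<le> 8 * B / (n * d\<^sup>2)" using B(2) by simp
        ultimately show ?thesis by (simp add: norm_mult fejer_nonneg)
      next
        case False
        have tt: "cnj t * t = 1" using t complex_norm_square[of t] by (simp add: mult.commute)
        have "cmod (1 - z * cnj t) = cmod (t - z)"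
        proof -
          have "(1 - z * cnj t) * t = t - z" using tt by (simp add: algebra_simps)
          then have "cmod (t - z) = cmod (1 - z * cnj t) * cmod t" by (metis norm_mult)
          then show ?thesis using t by simp
        qed
        then have dd: "d \<le> cmod (1 - z * cnj t)" using False by (simp add: dist_norm)
        have "fejer n (z * cnj t) \<le> 4 / (n * (cmod (1 - z * cnj t))\<^sup>2)"
          using t z1 dd d(1) by (intro fejer_bound) (auto simp: norm_mult)
        also have "\<dots> \<le> 4 / (n * d\<^sup>2)"
          using dd d(1) n1 by (intro divide_left_mono mult_left_mono power_mono mult_pos_pos) auto
        finally have 1: "fejer n (z * cnj t) \<le> 4 / (n * d\<^sup>2)" .
        have 2: "cmod (f t - f z) \<le> 2 * B"
          using norm_triangle_ineq4[of "f t" "f z"] B(1)[OF t] B(1)[OF z] by simp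
        have "fejer n (z * cnj t) * cmod (f t - f z) \<le> 4 / (n * d\<^sup>2) * (2 * B)"
          by (intro mult_mono 1 2) auto
        moreover have "0 \<le> fejer n (z * cnj t) * (e / 2)" using e fejer_nonneg by simp
        ultimately show ?thesis by (simp add: norm_mult fejer_nonneg)
      qed
    qed
    also have "\<dots> = e / 2 + 8 * B / (n * d\<^sup>2)"
      using K one circ.prob_space by (simp del: space_circ)
    also have "8 * B / (n * d\<^sup>2) \<le> e / 2"
    proof -
      have "16 * B / (d\<^sup>2 * e) < n" using N n by (simp add: less_le_trans)
      then show ?thesis using d(1) e n1 by (simp add: field_simps)
    qed
    finally show ?thesis by simp
  qed
  then show ?thesis unfolding eventually_sequentially by blast
qed

text \<open>For a continuous approximant the convergence is uniform, and the approximation error is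
  not enlarged because the Cesaro means contract L1.\<close>

lemma cesaro_L1:
  assumes h: "integrable circ h"
  shows "(\<lambda>n. \<integral>z. cmod (cesaro n h z - h z) \<partial>circ) \<longlonglongrightarrow> 0"
proof (rule LIMSEQ_I)
  fix r :: real assume "0 < r"
  then have r: "0 < r / 4" by simp
  obtain g where g: "continuous_on (sphere 0 1) g" "(\<integral>t. cmod (h t - g t) \<partial>circ) < r / 4"
    using L1_approximable[OF h] r unfolding L1_approximable_def by blast
  note gi = integrable_circ_continuous[OF g(1)]
  obtain N where "\<forall>n\<ge>N. \<forall>z\<in>sphere 0 1. cmod (cesaro n g z - g z) \<le> r / 4"
    using cesaro_uniform[OF g(1) r] unfolding eventually_sequentially by blast
  then have N: "cmod (cesaro n g z - g z) \<le> r / 4" if "N \<le> n" "cmod z = 1" for n z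
    using that by simp
  have "norm ((\<integral>z. cmod (cesaro n h z - h z) \<partial>circ) - 0) < r" if n: "max 1 N \<le> n" for n
  proof -
    have n1: "1 \<le> n" using n by simp
    note ic = integrable_circ_continuous[OF continuous_cesaro]
    have "(\<integral>z. cmod (cesaro n h z - h z) \<partial>circ)
       \<le> (\<integral>z. cmod (cesaro n (\<lambda>t. h t - g t) z) + r / 4 + cmod (h z - g z) \<partial>circ)"
    proof (rule integral_mono)
      show "integrable circ (\<lambda>z. cmod (cesaro n h z - h z))" using h ic[OF h] by auto
      have "integrable circ (cesaro n (\<lambda>t. h t - g t))" by (rule ic) (use h gi in auto)
      then show "integrable circ (\<lambda>z. cmod (cesaro n (\<lambda>t. h t - g t) z) + r / 4 + cmod (h z - g z))"
        using h gi by auto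
      fix z assume "z \<in> space circ"
      then have z: "cmod z = 1" by simp
      have "cesaro n h z - h z = cesaro n (\<lambda>t. h t - g t) z + (cesaro n g z - g z) - (h z - g z)"
        by (simp add: cesaro_diff[OF h gi z])
      then have "cmod (cesaro n h z - h z) \<le> cmod (cesaro n (\<lambda>t. h t - g t) z + (cesaro n g z - g z)) + cmod (h z - g z)"
        by (metis norm_triangle_ineq4)
      also have "\<dots> \<le> cmod (cesaro n (\<lambda>t. h t - g t) z) + r / 4 + cmod (h z - g z)"
        using norm_triangle_ineq[of "cesaro n (\<lambda>t. h t - g t) z" "cesaro n g z - g z"] N[of n z] n z by simp
      finally show "cmod (cesaro n h z - h z) \<le> cmod (cesaro n (\<lambda>t. h t - g t) z) + r / 4 + cmod (h z - g z)" .
    qed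
    also have "\<dots> = (\<integral>z. cmod (cesaro n (\<lambda>t. h t - g t) z) \<partial>circ) + r / 4 + (\<integral>z. cmod (h z - g z) \<partial>circ)"
    proof -
      have "integrable circ (cesaro n (\<lambda>t. h t - g t))" by (rule ic) (use h gi in auto)
      then show ?thesis using h gi circ.prob_space by (simp del: space_circ)
    qed
    also have "(\<integral>z. cmod (cesaro n (\<lambda>t. h t - g t) z) \<partial>circ) \<le> (\<integral>z. cmod (h z - g z) \<partial>circ)"
      by (rule cesaro_L1_contraction[OF n1]) (use h gi in auto)
    finally show ?thesis using g(2) \<open>0 < r\<close> by simp
  qed
  then show "\<exists>no. \<forall>n\<ge>no. norm ((\<integral>z. cmod (cesaro n h z - h z) \<partial>circ) - 0) < r" by blast
qed

section \<open>Transforms of scalar Hardy martingales\<close>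

text \<open>Either \<open>K * w \<le> u / 2\<close>, and half of \<open>u powr m\<close> absorbs the
  middle term, or \<open>u < 2 * K * w\<close>, and the middle term is at most a multiple of
  \<open>w powr m\<close>.\<close>

lemma bellman_lower:
  assumes m: "0 < m" and K: "0 \<le> K" and L: "0 \<le> L" and w: "0 < w" "w \<le> u"
  shows "u powr m / 2 \<le> bellman m K L w u + (K * (2 * K) powr m + L) * w powr m"
proof -
  have u: "0 < u" using w by simp
  have um: "u * u powr (m - 1) = u powr m" using u powr_add[of u 1 "m - 1"] by simp
  have "K * w * u powr (m - 1) \<le> u powr m / 2 + K * (2 * K) powr m * w powr m"
  proof (cases "2 * K * w \<le> u")
    case True
    then have "K * w * u powr (m - 1) \<le> u / 2 * u powr (m - 1)" by (intro mult_right_mono) auto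
    then show ?thesis using K um by (simp add: add_increasing2)
  next
    case False
    have "w * u powr (m - 1) \<le> u * u powr (m - 1)" using w by (intro mult_right_mono) auto
    also have "\<dots> \<le> (2 * K * w) powr m" using False u m K w unfolding um by (intro powr_mono2) auto
    also have "\<dots> = (2 * K) powr m * w powr m" using K w by (simp add: powr_mult)
    finally have "K * (w * u powr (m - 1)) \<le> K * ((2 * K) powr m * w powr m)" using K by (intro mult_left_mono)
    then show ?thesis by (simp add: mult.assoc add_increasing)
  qed
  then show ?thesis by (simp add: bellman_def algebra_simps)
qed

lemma bellman_abs_le:
  assumes m: "0 < m" and K: "0 \<le> K" and L: "0 \<le> L" and w: "0 < w" "w \<le> u"
  shows "\<bar>bellman m K L w u\<bar> \<le> (1 + K + L) * u powr m"
proof -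
  have u: "0 < u" using w by simp
  have um: "u * u powr (m - 1) = u powr m" using u powr_add[of u 1 "m - 1"] by simp
  have "w * u powr (m - 1) \<le> u powr m" unfolding um[symmetric] using w by (intro mult_right_mono) auto
  then have 1: "K * w * u powr (m - 1) \<le> K * u powr m" using K by (simp add: mult_left_mono mult.assoc)
  have 2: "L * w powr m \<le> L * u powr m" using L w m by (intro mult_left_mono powr_mono2) auto
  have "0 \<le> K * w * u powr (m - 1)" "0 \<le> L * w powr m" "0 \<le> u powr m" using K L w by auto
  with 1 2 show ?thesis unfolding bellman_def distrib_right mult_1_left abs_le_iff by linarith
qed

lemma powr_add_le:
  fixes a b s :: real
  assumes "0 \<le> a" "0 \<le> b" "0 \<le> s"
  shows "(a + b) powr s \<le> 2 powr s * (a powr s + b powr s)"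
proof -
  have "(a + b) powr s \<le> (2 * max a b) powr s" using assms by (intro powr_mono2) auto
  also have "\<dots> = 2 powr s * (max a b) powr s" using assms by (simp add: powr_mult)
  also have "(max a b) powr s \<le> a powr s + b powr s" by (auto simp: max_def)
  finally show ?thesis by simp
qed

lemma bell_abs_le:
  assumes m: "0 < m" and K: "0 \<le> K" and L: "0 \<le> L" and e: "0 < e"
  shows "\<bar>bell m K L e f g\<bar> \<le> (1 + K + L) * (cmod f + cmod g + sqrt e) powr (2 * m)"
proof -
  let ?w = "(cmod f)\<^sup>2 + e" let ?u = "(cmod f)\<^sup>2 + e + (cmod g)\<^sup>2"
  have "?u \<le> (cmod f + cmod g + sqrt e)\<^sup>2"
    using e by (simp add: power2_sum algebra_simps)
  moreover have u: "0 < ?u" using e by (smt (verit) zero_le_power2)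
  ultimately have "?u powr m \<le> ((cmod f + cmod g + sqrt e)\<^sup>2) powr m" using m by (intro powr_mono2) auto
  also have "\<dots> = (cmod f + cmod g + sqrt e) powr (2 * m)"
    using e by (subst powr_powr[symmetric]) (simp add: powr_numeral)
  finally have "(1 + K + L) * ?u powr m \<le> (1 + K + L) * (cmod f + cmod g + sqrt e) powr (2 * m)"
    using K L by (intro mult_left_mono) auto
  moreover have "\<bar>bell m K L e f g\<bar> \<le> (1 + K + L) * ?u powr m"
    unfolding bell_def using e by (intro bellman_abs_le m K L) (auto intro: add_nonneg_pos)
  ultimately show ?thesis by simp
qed

text \<open>Equal moduli give \<open>u \<le> 2 * w\<close>, so the last term dominates the first.
  This is the origin of the condition \<open>2 powr m \<le> L\<close>.\<close>

lemma bell_initial: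
  assumes m: "0 < m" and K: "0 \<le> K" and L: "2 powr m \<le> L" and e: "0 < e" and g: "cmod g = cmod f"
  shows "bell m K L e f g \<le> 0"
proof -
  let ?w = "(cmod f)\<^sup>2 + e" let ?u = "(cmod f)\<^sup>2 + e + (cmod g)\<^sup>2"
  have w: "0 < ?w" using e by (simp add: add_nonneg_pos)
  have "?u powr m \<le> (2 * ?w) powr m" using m e g w by (intro powr_mono2) auto
  also have "\<dots> = 2 powr m * ?w powr m" using w by (simp only: powr_mult)
  also have "\<dots> \<le> L * ?w powr m" using L by (intro mult_right_mono) auto
  finally have "?u powr m - L * ?w powr m \<le> 0" by simp
  moreover have "0 \<le> K * ?w * ?u powr (m - 1)" using K w by auto
  ultimately show ?thesis by (simp add: bell_def bellman_def)
qed

lemma continuous_on_bell: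
  assumes "continuous_on S f" "continuous_on S g" "0 < e"
  shows "continuous_on S (\<lambda>x. bell m K L e (f x) (g x))"
  unfolding bell_def using assms(3)
  by (intro continuous_on_bellman continuous_intros assms(1,2)) (smt (verit, best) zero_le_power2)+

lemma measurable_bell:
  assumes f: "f \<in> borel_measurable M" and g: "g \<in> borel_measurable M" and e: "0 < e"
  shows "(\<lambda>x. bell m K L e (f x) (g x)) \<in> borel_measurable M"
proof -
  have "(\<lambda>z. bell m K L e (fst z) (snd z)) \<in> borel_measurable borel"
    by (intro borel_measurable_continuous_onI continuous_on_bell continuous_intros e)
  from measurable_compose[OF borel_measurable_Pair[OF f g] this] show ?thesis by simp
qed

text \<open>Jensen's inequality controls a convex majorant of the function along the Cesaro means of \<open>h\<close>, which are
  polynomials, and Fatou's lemma, applied to the sum of the two, passes to the limit.\<close>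

lemma hardy_bell:
  fixes h :: "complex \<Rightarrow> complex" and \<sigma> :: real
  assumes s: "1 \<le> s" and m: "m = s / 2" and adm: "bellman_admissible m K L" and K: "0 \<le> K" and L: "0 \<le> L"
    and e: "0 < e" and \<sigma>: "\<sigma> = 1 \<or> \<sigma> = - 1"
    and h: "h \<in> borel_measurable circ" and hs: "integrable circ (\<lambda>t. cmod (h t) powr s)"
    and an: "\<And>k. k \<le> 0 \<Longrightarrow> fourier_coeff h k = 0"
  shows "(\<integral>t. bell m K L e (x + h t) (y + of_real \<sigma> * h t) \<partial>circ) \<le> bell m K L e x y"
proof -
  have m0: "0 < m" using s m by simp
  define b where "b z = bell m K L e (x + z) (y + of_real \<sigma> * z)" for z
  \<comment> \<open>Chosen so that the three summands in \<open>bell_abs_le\<close> add up to at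
    most \<open>2 * (B + cmod z)\<close>; the power of this factor 2 goes into
    \<open>c\<close>.\<close>
  define B where "B = cmod x + cmod y + sqrt e"
  define c where "c = (1 + K + L) * 2 powr s"
  have B: "0 < B" using e by (simp add: B_def add_nonneg_pos)
  have c0: "0 \<le> c" using K L by (simp add: c_def)
  have b_le: "\<bar>b z\<bar> \<le> c * (B + cmod z) powr s" for z
  proof -
    have "\<bar>b z\<bar> \<le> (1 + K + L) * (cmod (x + z) + cmod (y + of_real \<sigma> * z) + sqrt e) powr (2 * m)"
      unfolding b_def by (rule bell_abs_le[OF m0 K L e])
    also have "\<dots> \<le> (1 + K + L) * (2 * (B + cmod z)) powr (2 * m)"
    proof (intro mult_left_mono powr_mono2)
      have "cmod (of_real \<sigma> * z) = cmod z" using \<sigma> by (auto simp: norm_mult)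
      then show "cmod (x + z) + cmod (y + of_real \<sigma> * z) + sqrt e \<le> 2 * (B + cmod z)"
        using norm_triangle_ineq[of x z] norm_triangle_ineq[of y "of_real \<sigma> * z"] B
        by (simp add: B_def)
    qed (use m0 K L e in auto)
    also have "(2 * (B + cmod z)) powr (2 * m) = 2 powr s * (B + cmod z) powr s"
      using m by (simp only: powr_mult) simp
    also have "(1 + K + L) * (2 powr s * (B + cmod z) powr s) = c * (B + cmod z) powr s" by (simp add: c_def)
    finally show ?thesis .
  qed
  have mb: "b \<in> borel_measurable borel"
    unfolding b_def by (intro borel_measurable_continuous_onI continuous_on_bell continuous_intros e)
  have hi: "integrable circ h"
  proof (rule Bochner_Integration.integrable_bound)
    show "integrable circ (\<lambda>t. 1 + cmod (h t) powr s)" using hs by auto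
    show "AE t in circ. cmod (h t) \<le> norm (1 + cmod (h t) powr s)"
    proof (rule AE_I2)
      fix t
      show "cmod (h t) \<le> norm (1 + cmod (h t) powr s)"
      proof (cases "cmod (h t) \<le> 1")
        case False
        then have "cmod (h t) powr 1 \<le> cmod (h t) powr s" using s by (intro powr_mono) auto
        then show ?thesis using False by simp
      qed (simp add: add_increasing2)
    qed
  qed (rule h)
  have iR: "integrable circ (\<lambda>t. (B + cmod (h t)) powr s)"
  proof (rule Bochner_Integration.integrable_bound)
    show "integrable circ (\<lambda>t. 2 powr s * (B powr s + cmod (h t) powr s))" using hs by auto
    show "AE t in circ. norm ((B + cmod (h t)) powr s) \<le> norm (2 powr s * (B powr s + cmod (h t) powr s))"
      using powr_add_le[of B _ s] B s by (intro AE_I2) (simp add: add_nonneg_nonneg)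
  qed (use h in auto)
  have ib: "integrable circ (\<lambda>t. b (h t))"
    by (rule Bochner_Integration.integrable_bound[OF integrable_mult_right[OF iR, of c]])
      (use b_le c0 h mb in \<open>auto intro!: AE_I2 measurable_compose[OF h mb]\<close>)
  have "(\<lambda>n. \<integral>z. cmod (cesaro n h z - h z) \<partial>circ) \<longlonglongrightarrow> 0" by (rule cesaro_L1[OF hi])
  moreover have "integrable circ (\<lambda>z. cesaro n h z - h z)" for n
    using integrable_circ_continuous[OF continuous_cesaro[OF hi]] hi by auto
  ultimately obtain r :: "nat \<Rightarrow> nat" where r: "strict_mono r"
    "AE z in circ. (\<lambda>n. cesaro (r n) h z - h z) \<longlonglongrightarrow> 0"
    using tendsto_L1_AE_subseq[of circ "\<lambda>n z. cesaro n h z - h z"] by blast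
  \<comment> \<open>The shift to \<open>Suc n\<close> makes all indices at least 1, since the kernel
    of index 0 is zero and not a probability density.\<close>
  define P where "P n = cesaro (r (Suc n)) h" for n
  have r1: "1 \<le> r (Suc n)" for n using strict_mono_imp_increasing[OF r(1), of "Suc n"] by simp
  have P_lim: "AE z in circ. (\<lambda>n. P n z) \<longlonglongrightarrow> h z"
    using r(2)
  proof eventually_elim
    case (elim z)
    from LIMSEQ_Suc[OF elim] have "(\<lambda>n. P n z - h z) \<longlonglongrightarrow> 0" by (simp add: P_def)
    then show ?case by (rule LIM_zero_cancel)
  qed
  have P_cont: "continuous_on S (P n)" for S n unfolding P_def by (rule continuous_cesaro[OF hi])
  have P_mean: "(\<integral>t. b (P n t) \<partial>circ) \<le> b 0" for n
  proof -
    obtain p where p: "\<And>z. cmod z = 1 \<Longrightarrow> cesaro (r (Suc n)) h z = poly p z" "poly p 0 = fourier_coeff h 0"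
      by (rule cesaro_poly[OF hi _ r1[of n]]) (erule an[OF less_imp_le], rule that)
    note p = p[folded P_def]
    have "(\<integral>t. b (P n t) \<partial>circ) = integral {0..2 * pi} (\<lambda>\<theta>. b (P n (cis \<theta>))) / (2 * pi)"
    proof -
      have "continuous_on (sphere 0 1) (\<lambda>t. b (P n t))"
        unfolding b_def by (intro continuous_on_bell continuous_intros P_cont e)
      from integral_circ_continuous[OF this] show ?thesis by (simp only: real_scaleR_def divide_inverse mult.commute)
    qed
    also have "\<dots> = integral {0..2 * pi} (\<lambda>\<theta>. b (poly p (cis \<theta>))) / (2 * pi)" by (simp add: p(1))
    also have "\<dots> \<le> (2 * pi * b (poly p 0)) / (2 * pi)"
      unfolding b_def by (intro divide_right_mono bell_poly_mean adm e \<sigma>) auto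
    also have "poly p 0 = 0" using p(2) an by simp
    finally show ?thesis by simp
  qed
  have P_conv: "(\<integral>t. (B + cmod (P n t)) powr s \<partial>circ) \<le> (\<integral>t. (B + cmod (h t)) powr s \<partial>circ)"
    and iP: "integrable circ (\<lambda>t. (B + cmod (P n t)) powr s)" for n
  proof -
    show iP: "integrable circ (\<lambda>t. (B + cmod (P n t)) powr s)"
      using B by (intro integrable_circ_continuous continuous_intros P_cont) (metis add_pos_nonneg norm_ge_zero less_irrefl)
    have "ennreal (\<integral>t. (B + cmod (P n t)) powr s \<partial>circ) = (\<integral>\<^sup>+t. ennreal ((B + cmod (P n t)) powr s) \<partial>circ)"
      using iP by (intro nn_integral_eq_integral[symmetric]) auto
    also have "\<dots> \<le> (\<integral>\<^sup>+t. ennreal ((B + cmod (h t)) powr s) \<partial>circ)"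
      unfolding P_def by (rule cesaro_convex_bound[OF r1 s B hi iR])
    also have "\<dots> = ennreal (\<integral>t. (B + cmod (h t)) powr s \<partial>circ)"
      using iR by (intro nn_integral_eq_integral) auto
    finally show "(\<integral>t. (B + cmod (P n t)) powr s \<partial>circ) \<le> (\<integral>t. (B + cmod (h t)) powr s \<partial>circ)"
      by (simp add: ennreal_le_iff)
  qed
  define q where "q z = b z + c * (B + cmod z) powr s" for z
  have q0: "0 \<le> q z" for z using b_le[of z] by (simp add: q_def abs_le_iff)
  have q_cont: "continuous_on UNIV q"
    unfolding q_def b_def using B
    by (intro continuous_intros continuous_on_bell e) (metis add_pos_nonneg norm_ge_zero less_irrefl)
  have mq: "q \<in> borel_measurable borel" by (rule borel_measurable_continuous_onI[OF q_cont])
  have mP: "P n \<in> borel_measurable circ" for n by (rule continuous_borel_circ[OF P_cont])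
  let ?I = "\<integral>t. (B + cmod (h t)) powr s \<partial>circ"
  have "ennreal ((\<integral>t. b (h t) \<partial>circ) + c * ?I) = ennreal (\<integral>t. q (h t) \<partial>circ)"
    using ib iR by (simp add: q_def)
  also have "\<dots> = (\<integral>\<^sup>+t. ennreal (q (h t)) \<partial>circ)"
    using ib iR q0 by (intro nn_integral_eq_integral[symmetric]) (auto simp: q_def)
  also have "\<dots> = (\<integral>\<^sup>+t. liminf (\<lambda>n. ennreal (q (P n t))) \<partial>circ)"
  proof (rule nn_integral_cong_AE)
    show "AE t in circ. ennreal (q (h t)) = liminf (\<lambda>n. ennreal (q (P n t)))"
      using P_lim
    proof eventually_elim
      case (elim t)
      have "isCont q (h t)" using q_cont by (simp add: continuous_on_eq_continuous_at)
      then have "(\<lambda>n. q (P n t)) \<longlonglongrightarrow> q (h t)" by (rule isCont_tendsto_compose[OF _ elim])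
      then have "(\<lambda>n. ennreal (q (P n t))) \<longlonglongrightarrow> ennreal (q (h t))" by (rule tendsto_ennrealI)
      from lim_imp_Liminf[OF _ this] show ?case by simp
    qed
  qed
  also have "\<dots> \<le> liminf (\<lambda>n. \<integral>\<^sup>+t. ennreal (q (P n t)) \<partial>circ)"
    by (rule nn_integral_liminf) (intro measurable_compose[OF _ measurable_ennreal] measurable_compose[OF mP mq])
  also have "\<dots> \<le> liminf (\<lambda>n. ennreal (b 0 + c * ?I))"
  proof (rule Liminf_mono, rule always_eventually, rule allI)
    fix n
    have ibP: "integrable circ (\<lambda>t. b (P n t))"
      unfolding b_def by (intro integrable_circ_continuous continuous_on_bell continuous_intros P_cont e)
    have "(\<integral>\<^sup>+t. ennreal (q (P n t)) \<partial>circ) = ennreal (\<integral>t. q (P n t) \<partial>circ)"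
      using ibP iP[of n] q0 by (intro nn_integral_eq_integral) (auto simp: q_def)
    also have "(\<integral>t. q (P n t) \<partial>circ) = (\<integral>t. b (P n t) \<partial>circ) + c * (\<integral>t. (B + cmod (P n t)) powr s \<partial>circ)"
      using ibP iP[of n] by (simp add: q_def)
    also have "ennreal \<dots> \<le> ennreal (b 0 + c * ?I)"
      by (intro ennreal_leI add_mono mult_left_mono P_mean P_conv c0)
    finally show "(\<integral>\<^sup>+t. ennreal (q (P n t)) \<partial>circ) \<le> ennreal (b 0 + c * ?I)" .
  qed
  also have "\<dots> = ennreal (b 0 + c * ?I)" by (rule Liminf_const) simp
  finally have le: "ennreal ((\<integral>t. b (h t) \<partial>circ) + c * ?I) \<le> ennreal (b 0 + c * ?I)" .
  \<comment> \<open>\<open>ennreal\<close> sends negative numbers to 0, so the comparison returns to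
    the reals only after its right-hand side is known to be nonnegative.\<close>
  have "- (c * ?I) \<le> b 0"
  proof -
    have "B powr s \<le> (B + cmod (h t)) powr s" for t using B s by (intro powr_mono2) auto
    then have "(\<integral>t. B powr s \<partial>circ) \<le> ?I" by (intro integral_mono iR) auto
    then have "B powr s \<le> ?I" using circ.prob_space by (simp del: space_circ)
    then have "c * B powr s \<le> c * ?I" by (intro mult_left_mono c0)
    then show ?thesis using b_le[of 0] by (simp add: abs_le_iff)
  qed
  then have "(\<integral>t. b (h t) \<partial>circ) \<le> b 0" using le by (simp add: ennreal_le_iff)
  then show ?thesis by (simp add: b_def)
qed

lemma fun_upd_in_space: "\<omega> \<in> space m_inf \<Longrightarrow> 1 \<le> n \<Longrightarrow> t \<in> sphere 0 1 \<Longrightarrow> fun_upd \<omega> n t \<in> space m_inf"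
  by (auto simp: space_m_inf PiE_def extensional_def)

lemma measurable_upd_slice:
  assumes "1 \<le> n" "\<omega> \<in> space m_inf" shows "(\<lambda>t. fun_upd \<omega> n t) \<in> measurable circ m_inf"
  using measurable_compose[OF measurable_Pair1'[OF assms(2)] measurable_upd[OF assms(1)]] by simp

text \<open>Integrating first over coordinate \<open>Suc n\<close> freezes \<open>f0\<close> and
  \<open>g0\<close>, which depend on earlier coordinates only, and turns \<open>d\<close> into a
  function on the circle without nonpositive frequencies, to which \<open>hardy_bell\<close>
  applies.\<close>

lemma bell_martingale_step:
  fixes f0 g0 d :: "torus \<Rightarrow> complex" and \<sigma> :: real
  assumes s: "1 \<le> s" and m: "m = s / 2" and adm: "bellman_admissible m K L" and K: "0 \<le> K" and L: "0 \<le> L"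
    and e: "0 < e" and \<sigma>: "\<sigma> = 1 \<or> \<sigma> = - 1"
    and f0: "f0 \<in> borel_measurable (filt n)" and g0: "g0 \<in> borel_measurable (filt n)"
    and d: "d \<in> borel_measurable m_inf" "integrable m_inf (\<lambda>\<omega>. cmod (d \<omega>) powr s)"
    and an: "AE \<omega> in m_inf. \<forall>k\<le>0. fourier_coeff (\<lambda>t. d (fun_upd \<omega> (Suc n) t)) k = 0"
    and i0: "integrable m_inf (\<lambda>\<omega>. bell m K L e (f0 \<omega>) (g0 \<omega>))"
    and i1: "integrable m_inf (\<lambda>\<omega>. bell m K L e (f0 \<omega> + d \<omega>) (g0 \<omega> + of_real \<sigma> * d \<omega>))"
  shows "(\<integral>\<omega>. bell m K L e (f0 \<omega> + d \<omega>) (g0 \<omega> + of_real \<sigma> * d \<omega>) \<partial>m_inf) \<le> (\<integral>\<omega>. bell m K L e (f0 \<omega>) (g0 \<omega>) \<partial>m_inf)"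
proof -
  have n: "1 \<le> Suc n" by simp
  have "(\<integral>\<omega>. bell m K L e (f0 \<omega> + d \<omega>) (g0 \<omega> + of_real \<sigma> * d \<omega>) \<partial>m_inf)
     = (\<integral>\<omega>. (\<integral>t. bell m K L e (f0 (fun_upd \<omega> (Suc n) t) + d (fun_upd \<omega> (Suc n) t))
          (g0 (fun_upd \<omega> (Suc n) t) + of_real \<sigma> * d (fun_upd \<omega> (Suc n) t)) \<partial>circ) \<partial>m_inf)"
    using integral_upd(2)[OF n i1] by simp
  also have "\<dots> \<le> (\<integral>\<omega>. bell m K L e (f0 \<omega>) (g0 \<omega>) \<partial>m_inf)"
  proof (rule integral_mono_AE)
    show "integrable m_inf (\<lambda>\<omega>. \<integral>t. bell m K L e (f0 (fun_upd \<omega> (Suc n) t) + d (fun_upd \<omega> (Suc n) t))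
          (g0 (fun_upd \<omega> (Suc n) t) + of_real \<sigma> * d (fun_upd \<omega> (Suc n) t)) \<partial>circ)"
      using integral_upd(1)[OF n i1] by simp
    show "AE \<omega> in m_inf. (\<integral>t. bell m K L e (f0 (fun_upd \<omega> (Suc n) t) + d (fun_upd \<omega> (Suc n) t))
          (g0 (fun_upd \<omega> (Suc n) t) + of_real \<sigma> * d (fun_upd \<omega> (Suc n) t)) \<partial>circ) \<le> bell m K L e (f0 \<omega>) (g0 \<omega>)"
      using an integral_upd(3)[OF n d(2)] AE_space
    proof eventually_elim
      case (elim \<omega>)
      have "f0 (fun_upd \<omega> (Suc n) t) = f0 \<omega>" "g0 (fun_upd \<omega> (Suc n) t) = g0 \<omega>" if "t \<in> sphere 0 1" for t
        using that elim(3) fun_upd_in_space[OF elim(3) n that]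
        by (auto intro!: filt_cong[OF f0] filt_cong[OF g0])
      then have "(\<integral>t. bell m K L e (f0 (fun_upd \<omega> (Suc n) t) + d (fun_upd \<omega> (Suc n) t))
          (g0 (fun_upd \<omega> (Suc n) t) + of_real \<sigma> * d (fun_upd \<omega> (Suc n) t)) \<partial>circ)
        = (\<integral>t. bell m K L e (f0 \<omega> + d (fun_upd \<omega> (Suc n) t)) (g0 \<omega> + of_real \<sigma> * d (fun_upd \<omega> (Suc n) t)) \<partial>circ)"
        by (intro Bochner_Integration.integral_cong) auto
      also have "\<dots> \<le> bell m K L e (f0 \<omega>) (g0 \<omega>)"
        by (rule hardy_bell[OF s m adm K L e \<sigma>])
          (use elim measurable_compose[OF measurable_upd_slice[OF n elim(3)] d(1)] in auto)
      finally show ?case .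
    qed
  qed (rule i0)
  finally show ?thesis .
qed

text \<open>The martingale property is contained in the vanishing of the coefficient with index 0;
  the negative indices express analyticity in the new variable.\<close>

definition scalar_hardy :: "real \<Rightarrow> (nat \<Rightarrow> torus \<Rightarrow> complex) \<Rightarrow> bool" where
  "scalar_hardy s f \<longleftrightarrow> (\<forall>k. f k \<in> borel_measurable (filt k)) \<and> (\<forall>k. integrable m_inf (\<lambda>\<omega>. cmod (f k \<omega>) powr s)) \<and>
    (\<forall>k. AE \<omega> in m_inf. \<forall>j\<le>0. fourier_coeff (\<lambda>t. f (Suc k) (fun_upd \<omega> (Suc k) t) - f k (fun_upd \<omega> (Suc k) t)) j = 0)"

definition transform :: "(nat \<Rightarrow> real) \<Rightarrow> (nat \<Rightarrow> torus \<Rightarrow> complex) \<Rightarrow> nat \<Rightarrow> torus \<Rightarrow> complex" where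
  "transform \<epsilon> f n \<omega> = of_real (\<epsilon> 0) * f 0 \<omega> + (\<Sum>k<n. of_real (\<epsilon> (Suc k)) * (f (Suc k) \<omega> - f k \<omega>))"

text \<open>The expectation of the Bellman function starts at a nonpositive value by
  \<open>bell_initial\<close> and stays nonpositive by \<open>bell_martingale_step\<close>;
  \<open>bellman_lower\<close> turns this into the norm inequality, up to an error that vanishes
  with \<open>e\<close>.\<close>

lemma scalar_transform_bound:
  fixes s :: real
  assumes s: "1 \<le> s"
  shows "\<exists>C\<ge>0. \<forall>f n \<epsilon>. scalar_hardy s f \<longrightarrow>
    (\<forall>k. \<epsilon> k = 1 \<or> \<epsilon> k = - 1) \<longrightarrow>
    integrable m_inf (\<lambda>\<omega>. cmod (transform \<epsilon> f n \<omega>) powr s) \<and>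
    (\<integral>\<omega>. cmod (transform \<epsilon> f n \<omega>) powr s \<partial>m_inf)
      \<le> C * (\<integral>\<omega>. cmod (f n \<omega>) powr s \<partial>m_inf)"
proof -
  define m where "m = s / 2"
  have m0: "0 < m" using s by (simp add: m_def)
  obtain K L where K: "0 \<le> K" and L2: "2 powr m \<le> L" and adm: "bellman_admissible m K L"
    using bellman_constants[OF m0] unfolding bellman_admissible_def by metis
  have L: "0 \<le> L" using L2 by (meson order_trans powr_ge_zero)
  define C0 where "C0 = K * (2 * K) powr m + L"
  have C0: "0 \<le> C0" using K L by (simp add: C0_def)
  define C where "C = 2 * C0 * 2 powr m"
  have Cpos: "0 \<le> C" using C0 by (simp add: C_def)
  have int_add: "integrable m_inf (\<lambda>\<omega>. cmod (a \<omega> + b \<omega>) powr s)"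
    if "a \<in> borel_measurable m_inf" "b \<in> borel_measurable m_inf"
      "integrable m_inf (\<lambda>\<omega>. cmod (a \<omega>) powr s)" "integrable m_inf (\<lambda>\<omega>. cmod (b \<omega>) powr s)" for a b :: "torus \<Rightarrow> complex"
  proof (rule Bochner_Integration.integrable_bound)
    show "integrable m_inf (\<lambda>\<omega>. 2 powr s * (cmod (a \<omega>) powr s + cmod (b \<omega>) powr s))" using that by auto
    have "cmod (x + y) powr s \<le> 2 powr s * (cmod x powr s + cmod y powr s)" for x y
      using powr_mono2[of s "cmod (x + y)" "cmod x + cmod y"] powr_add_le[of "cmod x" "cmod y" s] s norm_triangle_ineq[of x y]
      by simp
    then show "AE \<omega> in m_inf. norm (cmod (a \<omega> + b \<omega>) powr s) \<le> norm (2 powr s * (cmod (a \<omega>) powr s + cmod (b \<omega>) powr s))"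
      by (intro AE_I2) simp
  qed (use that in auto)
  have sgn: "cmod (of_real \<sigma> * z) = cmod z" if "\<sigma> = 1 \<or> \<sigma> = - 1" for \<sigma> z
    using that by (auto simp: norm_mult)
  show ?thesis
  proof (rule exI[of _ C], intro conjI allI impI, rule Cpos)
    fix f :: "nat \<Rightarrow> torus \<Rightarrow> complex" and n and \<epsilon> :: "nat \<Rightarrow> real"
    assume H: "scalar_hardy s f" and \<epsilon>: "\<forall>k. \<epsilon> k = 1 \<or> \<epsilon> k = - 1"
    have f: "\<forall>k. f k \<in> borel_measurable (filt k)" and fs: "\<forall>k. integrable m_inf (\<lambda>\<omega>. cmod (f k \<omega>) powr s)"
      and an: "\<forall>k. AE \<omega> in m_inf. \<forall>j\<le>0. fourier_coeff (\<lambda>t. f (Suc k) (fun_upd \<omega> (Suc k) t) - f k (fun_upd \<omega> (Suc k) t)) j = 0"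
      using H unfolding scalar_hardy_def by blast+
    define d where "d k \<omega> = f (Suc k) \<omega> - f k \<omega>" for k \<omega>
    define g where "g n \<omega> = of_real (\<epsilon> 0) * f 0 \<omega> + (\<Sum>k<n. of_real (\<epsilon> (Suc k)) * d k \<omega>)" for n \<omega>
    have fm: "f k \<in> borel_measurable m_inf" for k using f measurable_filt by blast
    have dm: "d k \<in> borel_measurable m_inf" for k unfolding d_def using fm by auto
    have ds: "integrable m_inf (\<lambda>\<omega>. cmod (d k \<omega>) powr s)" for k
      using int_add[OF fm[of "Suc k"], of "\<lambda>\<omega>. - f k \<omega>"] fm fs by (simp add: d_def)
    have f_mono: "f k \<in> borel_measurable (filt j)" if "k \<le> j" for k j
      using measurable_from_subalg[OF subalgebra_filt_mono[OF that]] f by blast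
    have gm: "g j \<in> borel_measurable (filt j)" for j
      unfolding g_def d_def
      by (intro borel_measurable_add borel_measurable_sum borel_measurable_times borel_measurable_diff
          borel_measurable_const f_mono) auto
    have g_Suc: "g (Suc j) \<omega> = g j \<omega> + of_real (\<epsilon> (Suc j)) * d j \<omega>" for j \<omega> by (simp add: g_def)
    have gs: "integrable m_inf (\<lambda>\<omega>. cmod (g j \<omega>) powr s)" for j
    proof (induction j)
      case 0
      show ?case using fs \<epsilon> by (simp add: g_def sgn)
    next
      case (Suc j)
      show ?case unfolding g_Suc
        by (rule int_add) (use Suc ds dm \<epsilon> measurable_filt[OF gm] in \<open>auto simp: sgn\<close>)
    qed
    have gM: "g j \<in> borel_measurable m_inf" for j using gm measurable_filt by blast
    have bi: "integrable m_inf (\<lambda>\<omega>. bell m K L e (f j \<omega>) (g j \<omega>))" if e: "0 < e" for e j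
    proof (rule Bochner_Integration.integrable_bound)
      show "integrable m_inf (\<lambda>\<omega>. (1 + K + L) * (2 powr s * (2 powr s * (cmod (f j \<omega>) powr s + cmod (g j \<omega>) powr s) + sqrt e powr s)))"
        using fs gs by auto
      show "(\<lambda>\<omega>. bell m K L e (f j \<omega>) (g j \<omega>)) \<in> borel_measurable m_inf"
        by (rule measurable_bell[OF fm gM e])
      have "\<bar>bell m K L e x y\<bar> \<le> (1 + K + L) * (2 powr s * (2 powr s * (cmod x powr s + cmod y powr s) + sqrt e powr s))" for x y
      proof -
        have "\<bar>bell m K L e x y\<bar> \<le> (1 + K + L) * (cmod x + cmod y + sqrt e) powr s"
          using bell_abs_le[OF m0 K L e, of x y] by (simp add: m_def)
        also have "(cmod x + cmod y + sqrt e) powr s \<le> 2 powr s * ((cmod x + cmod y) powr s + sqrt e powr s)"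
          using e s by (intro powr_add_le) auto
        also have "\<dots> \<le> 2 powr s * (2 powr s * (cmod x powr s + cmod y powr s) + sqrt e powr s)"
          using s by (intro mult_left_mono add_mono powr_add_le) auto
        finally show ?thesis using K L by (simp add: mult_left_mono)
      qed
      then show "AE \<omega> in m_inf. norm (bell m K L e (f j \<omega>) (g j \<omega>)) \<le> norm ((1 + K + L) * (2 powr s * (2 powr s * (cmod (f j \<omega>) powr s + cmod (g j \<omega>) powr s) + sqrt e powr s)))"
        by (intro AE_I2) (metis real_norm_def abs_ge_self order_trans)
    qed
    have b0: "(\<integral>\<omega>. bell m K L e (f j \<omega>) (g j \<omega>) \<partial>m_inf) \<le> 0" if e: "0 < e" for e j
    proof (induction j)
      case 0
      have "bell m K L e (f 0 \<omega>) (g 0 \<omega>) \<le> 0" for \<omega>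
        using \<epsilon> by (intro bell_initial m0 K L2 e) (simp add: g_def sgn)
      then have "0 \<le> (\<integral>\<omega>. - bell m K L e (f 0 \<omega>) (g 0 \<omega>) \<partial>m_inf)" by (intro Bochner_Integration.integral_nonneg) simp
      then show ?case by simp
    next
      case (Suc j)
      have fS: "f (Suc j) \<omega> = f j \<omega> + d j \<omega>" for \<omega> by (simp add: d_def)
      have "(\<integral>\<omega>. bell m K L e (f (Suc j) \<omega>) (g (Suc j) \<omega>) \<partial>m_inf) \<le> (\<integral>\<omega>. bell m K L e (f j \<omega>) (g j \<omega>) \<partial>m_inf)"
        unfolding g_Suc fS
      proof (rule bell_martingale_step[OF s m_def adm K L e, where n = j])
        show "\<epsilon> (Suc j) = 1 \<or> \<epsilon> (Suc j) = - 1" "f j \<in> borel_measurable (filt j)" using \<epsilon> f by blast+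
        show "AE \<omega> in m_inf. \<forall>k\<le>0. fourier_coeff (\<lambda>t. d j (fun_upd \<omega> (Suc j) t)) k = 0"
          using an by (simp add: d_def)
        show "integrable m_inf (\<lambda>\<omega>. bell m K L e (f j \<omega> + d j \<omega>) (g j \<omega> + of_real (\<epsilon> (Suc j)) * d j \<omega>))"
          using bi[OF e, of "Suc j"] by (simp only: g_Suc fS)
      qed (rule gm dm ds bi[OF e])+
      then show ?case using Suc by simp
    qed
    let ?F = "\<integral>\<omega>. cmod (f n \<omega>) powr s \<partial>m_inf" and ?G = "\<integral>\<omega>. cmod (g n \<omega>) powr s \<partial>m_inf"
    have key: "?G \<le> C * (?F + e powr m)" if e: "0 < e" for e
    proof -
      have "cmod y powr s \<le> 2 * bell m K L e x y + C * (cmod x powr s + e powr m)" for x y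
      proof -
        let ?w = "(cmod x)\<^sup>2 + e"
        have w: "0 < ?w" using e by (simp add: add_nonneg_pos)
        have sq: "((cmod z)\<^sup>2) powr m = cmod z powr s" for z
          by (cases "z = 0") (simp_all add: m_def powr_powr flip: powr_numeral)
        have "cmod y powr s \<le> (?w + (cmod y)\<^sup>2) powr m"
          unfolding sq[symmetric] using w m0 by (intro powr_mono2) auto
        also have "(?w + (cmod y)\<^sup>2) powr m / 2 \<le> bell m K L e x y + C0 * ?w powr m"
          unfolding bell_def C0_def using w by (intro bellman_lower m0 K L) auto
        then have "(?w + (cmod y)\<^sup>2) powr m \<le> 2 * bell m K L e x y + 2 * C0 * ?w powr m" by simp
        also have "2 * C0 * ?w powr m \<le> 2 * C0 * (2 powr m * (((cmod x)\<^sup>2) powr m + e powr m))"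
          using C0 e m0 by (intro mult_left_mono powr_add_le) auto
        finally show ?thesis by (simp add: C_def sq mult.assoc)
      qed
      then have "?G \<le> (\<integral>\<omega>. 2 * bell m K L e (f n \<omega>) (g n \<omega>) + C * (cmod (f n \<omega>) powr s + e powr m) \<partial>m_inf)"
        using bi[OF e] fs gs by (intro integral_mono) auto
      also have "\<dots> = 2 * (\<integral>\<omega>. bell m K L e (f n \<omega>) (g n \<omega>) \<partial>m_inf) + C * (?F + e powr m)"
        using bi[OF e] fs measure_m_inf_space by simp
      finally show ?thesis using b0[OF e, of n] by simp
    qed
    have "?G \<le> C * ?F"
    proof (rule field_le_epsilon)
      fix \<eta> :: real assume \<eta>: "0 < \<eta>"
      \<comment> \<open>This makes \<open>(C + 1) * e powr m\<close> equal to \<open>\<eta>\<close>;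
        \<open>C\<close> alone could be 0 in the denominator.\<close>
      define e where "e = (\<eta> / (C + 1)) powr (1 / m)"
      have e: "0 < e" using \<eta> Cpos by (simp add: e_def)
      have "e powr m = \<eta> / (C + 1)" using \<eta> Cpos m0 by (simp add: e_def powr_powr)
      then have "(C + 1) * e powr m = \<eta>" using Cpos by (simp add: field_simps)
      moreover have "0 \<le> e powr m" by simp
      ultimately have "C * e powr m \<le> \<eta>" by (simp only: distrib_right mult_1_left)
      with key[OF e] show "?G \<le> C * ?F + \<eta>" by (simp add: algebra_simps)
    qed
    then show "(\<integral>\<omega>. cmod (transform \<epsilon> f n \<omega>) powr s \<partial>m_inf) \<le> C * ?F"
      "integrable m_inf (\<lambda>\<omega>. cmod (transform \<epsilon> f n \<omega>) powr s)"
      using gs[of n] by (simp_all add: g_def d_def transform_def)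
  qed
qed

section \<open>Lattice norms\<close>

text \<open>In place of the norm axioms every vector is required to have a nonnegative weight on the
  moduli that attains its norm and stays below the norm elsewhere. Monotonicity, the triangle
  inequality and the integral inequality each follow from one such weight, and the condition passes
  to \<open>ell2\<close>.\<close>

definition lattice_normed :: "'i coord_space \<Rightarrow> bool" where
  "lattice_normed X \<longleftrightarrow> finite (idx X) \<and>
     (\<forall>x. \<exists>\<phi>. (\<forall>i. 0 \<le> \<phi> i) \<and> nrm X x = (\<Sum>i\<in>idx X. \<phi> i * cmod (x i)) \<and>
        (\<forall>y. (\<Sum>i\<in>idx X. \<phi> i * cmod (y i)) \<le> nrm X y)) \<and>
     (\<forall>i\<in>idx X. nrm X (basis_vec i) = 1)"

context
  fixes X :: "'i coord_space"
  assumes X: "lattice_normed X"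
begin

lemma finite_idx: "finite (idx X)"
  using X by (simp add: lattice_normed_def)

lemma norming_functional:
  obtains \<phi> where "\<And>i. 0 \<le> \<phi> i" "nrm X x = (\<Sum>i\<in>idx X. \<phi> i * cmod (x i))"
    "\<And>y. (\<Sum>i\<in>idx X. \<phi> i * cmod (y i)) \<le> nrm X y"
  using X unfolding lattice_normed_def by metis

lemma nrm_nonneg: "0 \<le> nrm X x"
  by (rule norming_functional[of x]) (auto intro!: sum_nonneg)

lemma nrm_mono:
  assumes "\<And>i. i \<in> idx X \<Longrightarrow> cmod (x i) \<le> cmod (y i)" shows "nrm X x \<le> nrm X y"
proof -
  obtain \<phi> where \<phi>: "\<And>i. 0 \<le> \<phi> i" "nrm X x = (\<Sum>i\<in>idx X. \<phi> i * cmod (x i))"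
    "\<And>y. (\<Sum>i\<in>idx X. \<phi> i * cmod (y i)) \<le> nrm X y" by (rule norming_functional[of x]) blast
  have "nrm X x \<le> (\<Sum>i\<in>idx X. \<phi> i * cmod (y i))"
    unfolding \<phi>(2) by (intro sum_mono mult_left_mono assms \<phi>(1))
  with \<phi>(3)[of y] show ?thesis by simp
qed

lemma nrm_cong: "(\<And>i. i \<in> idx X \<Longrightarrow> cmod (x i) = cmod (y i)) \<Longrightarrow> nrm X x = nrm X y"
  by (intro antisym nrm_mono) auto

lemma nrm_add: "nrm X (\<lambda>i. x i + y i) \<le> nrm X x + nrm X y"
proof -
  obtain \<phi> where \<phi>: "\<And>i. 0 \<le> \<phi> i" "nrm X (\<lambda>i. x i + y i) = (\<Sum>i\<in>idx X. \<phi> i * cmod (x i + y i))"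
    "\<And>y. (\<Sum>i\<in>idx X. \<phi> i * cmod (y i)) \<le> nrm X y" by (rule norming_functional[of "\<lambda>i. x i + y i"]) blast
  have "nrm X (\<lambda>i. x i + y i) \<le> (\<Sum>i\<in>idx X. \<phi> i * (cmod (x i) + cmod (y i)))"
    unfolding \<phi>(2) by (intro sum_mono mult_left_mono norm_triangle_ineq \<phi>(1))
  also have "\<dots> = (\<Sum>i\<in>idx X. \<phi> i * cmod (x i)) + (\<Sum>i\<in>idx X. \<phi> i * cmod (y i))"
    by (simp add: distrib_left sum.distrib)
  finally show ?thesis using \<phi>(3)[of x] \<phi>(3)[of y] by simp
qed

lemma nrm_scale_le: "nrm X (\<lambda>i. c * x i) \<le> cmod c * nrm X x"
proof -
  obtain \<phi> where \<phi>: "\<And>i. 0 \<le> \<phi> i" "nrm X (\<lambda>i. c * x i) = (\<Sum>i\<in>idx X. \<phi> i * cmod (c * x i))"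
    "\<And>y. (\<Sum>i\<in>idx X. \<phi> i * cmod (y i)) \<le> nrm X y" by (rule norming_functional[of "\<lambda>i. c * x i"]) blast
  have "nrm X (\<lambda>i. c * x i) = cmod c * (\<Sum>i\<in>idx X. \<phi> i * cmod (x i))"
    unfolding \<phi>(2) by (simp add: sum_distrib_left norm_mult mult_ac)
  also have "\<dots> \<le> cmod c * nrm X x" by (intro mult_left_mono \<phi>(3)) simp
  finally show ?thesis .
qed

lemma nrm_scale: "nrm X (\<lambda>i. c * x i) = cmod c * nrm X x"
proof (cases "c = 0")
  case True
  then show ?thesis using nrm_scale_le[of 0 x] nrm_nonneg[of "\<lambda>i. 0"] by simp
next
  case False
  have "(\<lambda>i. inverse c * (c * x i)) = x" using False by (simp add: fun_eq_iff flip: mult.assoc)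
  then have "nrm X x = nrm X (\<lambda>i. inverse c * (c * x i))" by simp
  also have "\<dots> \<le> cmod (inverse c) * nrm X (\<lambda>i. c * x i)" by (rule nrm_scale_le)
  finally have "cmod c * nrm X x \<le> nrm X (\<lambda>i. c * x i)" using False by (simp add: norm_inverse norm_divide field_simps)
  then show ?thesis using nrm_scale_le[of c x] by simp
qed

lemma nrm_zero: "nrm X (\<lambda>i. 0) = 0"
  using nrm_scale[of 0 "\<lambda>i. 0"] by simp

lemma nrm_basis: "i \<in> idx X \<Longrightarrow> nrm X (basis_vec i) = 1"
  using X by (simp add: lattice_normed_def)

lemma cmod_le_nrm: assumes i: "i \<in> idx X" shows "cmod (x i) \<le> nrm X x"
proof -
  have "cmod (x i) = nrm X (\<lambda>j. x i * basis_vec i j)" by (simp add: nrm_scale nrm_basis i)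
  also have "\<dots> \<le> nrm X x" by (rule nrm_mono) (simp add: basis_vec_def)
  finally show ?thesis .
qed

lemma nrm_le_sum: "nrm X x \<le> (\<Sum>i\<in>idx X. cmod (x i))"
proof -
  obtain \<phi> where \<phi>: "\<And>i. 0 \<le> \<phi> i" "nrm X x = (\<Sum>i\<in>idx X. \<phi> i * cmod (x i))"
    "\<And>y. (\<Sum>i\<in>idx X. \<phi> i * cmod (y i)) \<le> nrm X y" by (rule norming_functional[of x]) blast
  have "\<phi> i * cmod (x i) \<le> 1 * cmod (x i)" if i: "i \<in> idx X" for i
  proof -
    have "\<phi> i = (\<Sum>j\<in>idx X. \<phi> j * cmod (basis_vec i j))"
      using finite_idx i by (simp add: basis_vec_def if_distrib[of cmod] if_distrib[of "\<lambda>y. _ * y"] cong: if_cong)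
    also have "\<dots> \<le> 1" using \<phi>(3)[of "basis_vec i"] nrm_basis[OF i] by simp
    finally show ?thesis by (intro mult_right_mono) auto
  qed
  then show ?thesis unfolding \<phi>(2) by (intro sum_mono) simp
qed

text \<open>The weight that attains the norm of the integral can be moved under the integral sign,
  where it is bounded by the norm of the integrand.\<close>

lemma nrm_integral_le:
  assumes f: "\<And>i. i \<in> idx X \<Longrightarrow> integrable M (\<lambda>\<omega>. f \<omega> i)"
    and m: "(\<lambda>\<omega>. nrm X (f \<omega>)) \<in> borel_measurable M"
  shows "nrm X (\<lambda>i. \<integral>\<omega>. f \<omega> i \<partial>M) \<le> (\<integral>\<omega>. nrm X (f \<omega>) \<partial>M)"
proof -
  let ?x = "\<lambda>i. \<integral>\<omega>. f \<omega> i \<partial>M"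
  obtain \<phi> where \<phi>: "\<And>i. 0 \<le> \<phi> i" "nrm X ?x = (\<Sum>i\<in>idx X. \<phi> i * cmod (?x i))"
    "\<And>y. (\<Sum>i\<in>idx X. \<phi> i * cmod (y i)) \<le> nrm X y" by (rule norming_functional[of ?x]) blast
  have i: "integrable M (\<lambda>\<omega>. nrm X (f \<omega>))"
    by (rule Bochner_Integration.integrable_bound[of _ "\<lambda>\<omega>. \<Sum>i\<in>idx X. cmod (f \<omega> i)"])
      (use f m nrm_le_sum in \<open>auto simp: nrm_nonneg intro!: AE_I2 sum_nonneg order_trans[OF _ abs_ge_self]\<close>)
  have "nrm X ?x \<le> (\<Sum>i\<in>idx X. \<phi> i * (\<integral>\<omega>. cmod (f \<omega> i) \<partial>M))"
    unfolding \<phi>(2) by (intro sum_mono mult_left_mono integral_norm_bound \<phi>(1))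
  also have "\<dots> = (\<integral>\<omega>. (\<Sum>i\<in>idx X. \<phi> i * cmod (f \<omega> i)) \<partial>M)"
    using f by (subst Bochner_Integration.integral_sum) auto
  also have "\<dots> \<le> (\<integral>\<omega>. nrm X (f \<omega>) \<partial>M)"
    using f i by (intro integral_mono \<phi>(3)) auto
  finally show ?thesis .
qed

end

text \<open>The weights are the extremal ones in Hoelder's inequality for two coordinates.\<close>

lemma ell2_norming:
  fixes a b r :: real
  assumes r: "1 \<le> r" and ab: "0 \<le> a" "0 \<le> b"
  obtains \<alpha> \<beta> where "0 \<le> \<alpha>" "0 \<le> \<beta>" "\<alpha> * a + \<beta> * b = (a powr r + b powr r) powr (1 / r)"
    "\<And>u v. 0 \<le> u \<Longrightarrow> 0 \<le> v \<Longrightarrow> \<alpha> * u + \<beta> * v \<le> (u powr r + v powr r) powr (1 / r)"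
proof (cases "a = 0 \<and> b = 0")
  case True
  then show ?thesis by (intro that[of 0 0]) auto
next
  case False
  define N where "N = (a powr r + b powr r) powr (1 / r)"
  have s0: "0 < a powr r + b powr r" using False ab by (auto intro: add_pos_nonneg add_nonneg_pos)
  have N: "0 < N" "N powr r = a powr r + b powr r" using s0 r by (auto simp: N_def powr_powr)
  define \<alpha> \<beta> where "\<alpha> = (a / N) powr (r - 1)" and "\<beta> = (b / N) powr (r - 1)"
  have pow: "x powr (r - 1) * x = x powr r" if "0 \<le> x" for x :: real
    using that powr_add[of x "r - 1" 1] by (cases "x = 0") auto
  have sum1: "(a / N) powr r + (b / N) powr r = 1"
    using N ab s0 by (simp add: powr_divide flip: add_divide_distrib)
  have N_eq: "\<alpha> * a + \<beta> * b = N"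
  proof -
    have "\<alpha> * a + \<beta> * b = N * ((a / N) powr r + (b / N) powr r)"
      using N ab pow[of "a / N"] pow[of "b / N"] by (simp add: \<alpha>_def \<beta>_def field_simps)
    then show ?thesis using sum1 by simp
  qed
  have le: "\<alpha> * u + \<beta> * v \<le> (u powr r + v powr r) powr (1 / r)" if uv: "0 \<le> u" "0 \<le> v" for u v
  proof (cases "u = 0 \<and> v = 0")
    case False
    define U where "U = (u powr r + v powr r) powr (1 / r)"
    have u0: "0 < u powr r + v powr r" using False uv by (auto intro: add_pos_nonneg add_nonneg_pos)
    then have U: "0 < U" "U powr r = u powr r + v powr r" using r by (auto simp: U_def powr_powr)
    have "\<alpha> * (u / U) + \<beta> * (v / U) \<le> 1"
    proof (cases "r = 1")
      case True
      \<comment> \<open>For \<open>r = 1\<close> there is no finite conjugate exponent. The weights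
        are 1, or 0 at a vanishing coordinate because \<open>0 powr 0 = 0\<close>; only the upper
        bound 1 matters here.\<close>
      then have "\<alpha> \<le> 1" "\<beta> \<le> 1" by (auto simp: \<alpha>_def \<beta>_def)
      then have "\<alpha> * (u / U) + \<beta> * (v / U) \<le> 1 * (u / U) + 1 * (v / U)"
        using uv U by (intro add_mono mult_right_mono) auto
      also have "\<dots> = 1" using U uv True by (simp flip: add_divide_distrib)
      finally show ?thesis .
    next
      case False
      then have r1: "1 < r" using r by simp
      define r' where "r' = r / (r - 1)"
      have r': "1 < r'" "1 / r' + 1 / r = 1" using r1 by (auto simp: r'_def field_simps)
      have rr: "(r - 1) * r' = r" using r1 by (simp add: r'_def)
      have y: "x powr (r - 1) * w \<le> x powr r / r' + w powr r / r" if "0 \<le> x" "0 \<le> w" for x w :: real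
        using Youngs_inequality[OF r'(1) r1 r'(2), of "x powr (r - 1)" w] that by (simp add: powr_powr rr)
      have "\<alpha> * (u / U) + \<beta> * (v / U) \<le> ((a / N) powr r + (b / N) powr r) / r' + ((u / U) powr r + (v / U) powr r) / r"
        using y[of "a / N" "u / U"] y[of "b / N" "v / U"] ab uv N U by (simp add: \<alpha>_def \<beta>_def add_divide_distrib)
      also have "(u / U) powr r + (v / U) powr r = 1"
        using U uv u0 by (simp add: powr_divide flip: add_divide_distrib)
      finally show ?thesis using sum1 r'(2) by simp
    qed
    then show ?thesis using U(1) by (simp add: field_simps flip: U_def)
  qed auto
  show ?thesis
    by (rule that[of \<alpha> \<beta>]) (use N_eq le in \<open>auto simp: \<alpha>_def \<beta>_def N_def\<close>)
qed

lemma idx_ell2: "idx (ell2 r F) = (#) False ` idx F \<union> (#) True ` idx F"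
proof -
  have "x \<in> idx (ell2 r F) \<longleftrightarrow> x \<in> (#) False ` idx F \<union> (#) True ` idx F" for x
  proof -
    have "(\<exists>b w. x = b # w \<and> w \<in> idx F) \<longleftrightarrow> (\<exists>w\<in>idx F. x = False # w) \<or> (\<exists>w\<in>idx F. x = True # w)"
      by (metis (full_types))
    then show ?thesis by (auto simp: ell2_def image_iff)
  qed
  then show ?thesis by blast
qed

lemma sum_idx_ell2:
  "finite (idx F) \<Longrightarrow> (\<Sum>i\<in>idx (ell2 r F). g i) = (\<Sum>w\<in>idx F. g (False # w)) + (\<Sum>w\<in>idx F. g (True # w))"
  unfolding idx_ell2 by (subst sum.union_disjoint) (auto simp: sum.reindex)

lemma nrm_ell2:
  "nrm (ell2 r F) x = (nrm F (\<lambda>w. x (False # w)) powr r + nrm F (\<lambda>w. x (True # w)) powr r) powr (1 / r)"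
  by (simp add: ell2_def)

text \<open>Weights attaining the norms of the two components, scaled by the weights of
  \<open>ell2_norming\<close> for the pair of these norms, combine to a weight for the whole
  vector.\<close>

lemma lattice_normed_ell2:
  assumes r: "1 \<le> r" and F: "lattice_normed F"
  shows "lattice_normed (ell2 r F)"
  unfolding lattice_normed_def
proof (intro conjI allI ballI)
  note fin = finite_idx[OF F]
  show "finite (idx (ell2 r F))" using fin by (simp add: idx_ell2)
  show "nrm (ell2 r F) (basis_vec i) = 1" if i: "i \<in> idx (ell2 r F)" for i
  proof -
    obtain b w where w: "i = b # w" "w \<in> idx F" using i by (auto simp: idx_ell2)
    have "(\<lambda>w'. basis_vec (b # w) (c # w')) = (if c = b then basis_vec w else (\<lambda>_. 0))" for c
      by (auto simp: basis_vec_def fun_eq_iff)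
    then show ?thesis using w by (cases b) (simp_all add: nrm_ell2 nrm_basis[OF F] nrm_zero[OF F])
  qed
  fix x :: "bool list \<Rightarrow> complex"
  let ?a = "nrm F (\<lambda>w. x (False # w))" and ?b = "nrm F (\<lambda>w. x (True # w))"
  obtain \<alpha> \<beta> where ab: "0 \<le> \<alpha>" "0 \<le> \<beta>" "\<alpha> * ?a + \<beta> * ?b = (?a powr r + ?b powr r) powr (1 / r)"
    "\<And>u v. 0 \<le> u \<Longrightarrow> 0 \<le> v \<Longrightarrow> \<alpha> * u + \<beta> * v \<le> (u powr r + v powr r) powr (1 / r)"
    by (rule ell2_norming[OF r nrm_nonneg[OF F, of "\<lambda>w. x (False # w)"] nrm_nonneg[OF F, of "\<lambda>w. x (True # w)"]]) blast
  obtain \<phi> where \<phi>: "\<And>i. 0 \<le> \<phi> i" "?a = (\<Sum>i\<in>idx F. \<phi> i * cmod (x (False # i)))"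
    "\<And>y. (\<Sum>i\<in>idx F. \<phi> i * cmod (y i)) \<le> nrm F y"
    by (rule norming_functional[OF F, of "\<lambda>w. x (False # w)"]) blast
  obtain \<psi> where \<psi>: "\<And>i. 0 \<le> \<psi> i" "?b = (\<Sum>i\<in>idx F. \<psi> i * cmod (x (True # i)))"
    "\<And>y. (\<Sum>i\<in>idx F. \<psi> i * cmod (y i)) \<le> nrm F y"
    by (rule norming_functional[OF F, of "\<lambda>w. x (True # w)"]) blast
  define \<rho> where "\<rho> i = (if i = [] then 0 else if hd i then \<beta> * \<psi> (tl i) else \<alpha> * \<phi> (tl i))" for i
  have sum: "(\<Sum>i\<in>idx (ell2 r F). \<rho> i * cmod (y i)) = \<alpha> * (\<Sum>i\<in>idx F. \<phi> i * cmod (y (False # i))) + \<beta> * (\<Sum>i\<in>idx F. \<psi> i * cmod (y (True # i)))" for y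
    by (simp add: sum_idx_ell2[OF fin] \<rho>_def sum_distrib_left mult.assoc)
  have 1: "0 \<le> \<rho> i" for i using ab \<phi>(1) \<psi>(1) by (auto simp: \<rho>_def)
  have 2: "nrm (ell2 r F) x = (\<Sum>i\<in>idx (ell2 r F). \<rho> i * cmod (x i))"
    unfolding sum \<phi>(2)[symmetric] \<psi>(2)[symmetric] nrm_ell2 ab(3) ..
  have 3: "(\<Sum>i\<in>idx (ell2 r F). \<rho> i * cmod (y i)) \<le> nrm (ell2 r F) y" for y
  proof -
    have "(\<Sum>i\<in>idx (ell2 r F). \<rho> i * cmod (y i)) \<le> \<alpha> * nrm F (\<lambda>w. y (False # w)) + \<beta> * nrm F (\<lambda>w. y (True # w))"
      unfolding sum by (intro add_mono mult_left_mono \<phi>(3) \<psi>(3) ab)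
    also have "\<dots> \<le> nrm (ell2 r F) y" unfolding nrm_ell2 by (intro ab(4) nrm_nonneg F)
    finally show ?thesis .
  qed
  show "\<exists>\<phi>. (\<forall>i. 0 \<le> \<phi> i) \<and> nrm (ell2 r F) x = (\<Sum>i\<in>idx (ell2 r F). \<phi> i * cmod (x i)) \<and>
      (\<forall>y. (\<Sum>i\<in>idx (ell2 r F). \<phi> i * cmod (y i)) \<le> nrm (ell2 r F) y)"
    using 1 2 3 by blast
qed

lemma lattice_normed_scalars: "lattice_normed scalars"
  unfolding lattice_normed_def scalars_def by (auto intro!: exI[of _ "\<lambda>_. 1"] simp: basis_vec_def)

lemma lattice_normed_E_space: "1 \<le> p \<Longrightarrow> 1 \<le> q \<Longrightarrow> lattice_normed (E_space p q n)"
  by (induction n) (auto intro: lattice_normed_ell2 lattice_normed_scalars)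

lemma card_idx_ell2: "finite (idx F) \<Longrightarrow> card (idx (ell2 r F)) = 2 * card (idx F)"
  unfolding idx_ell2 by (subst card_Un_disjoint) (auto simp: card_image)

lemma card_E_space: "finite (idx (E_space p q n)) \<and> card (idx (E_space p q n)) = 4 ^ n"
proof (induction n)
  case 0
  show ?case by (simp add: scalars_def)
next
  case (Suc n)
  have "finite (idx (ell2 q (E_space p q n)))" using Suc by (simp add: idx_ell2)
  then show ?case using Suc by (simp add: card_idx_ell2) (simp add: idx_ell2)
qed

lemma measurable_nrm_E_space:
  assumes "\<And>w. w \<in> idx (E_space p q n) \<Longrightarrow> (\<lambda>\<omega>. f \<omega> w) \<in> borel_measurable M"
  shows "(\<lambda>\<omega>. nrm (E_space p q n) (f \<omega>)) \<in> borel_measurable M"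
  using assms
proof (induction n arbitrary: f)
  case 0
  then show ?case by (simp add: scalars_def)
next
  case (Suc n)
  have "(\<lambda>\<omega>. nrm (E_space p q n) (\<lambda>w. f \<omega> (b # c # w))) \<in> borel_measurable M" for b c
    by (rule Suc.IH) (rule Suc.prems, cases b; cases c, auto simp: idx_ell2)
  then show ?case by (simp add: nrm_ell2)
qed

definition measurable_norm :: "'i coord_space \<Rightarrow> bool" where
  "measurable_norm X \<longleftrightarrow> (\<forall>M (f :: torus \<Rightarrow> 'i \<Rightarrow> complex). (\<forall>i\<in>idx X. (\<lambda>\<omega>. f \<omega> i) \<in> borel_measurable M) \<longrightarrow>
     (\<lambda>\<omega>. nrm X (f \<omega>)) \<in> borel_measurable M)"

lemma measurable_norm_E_space: "measurable_norm (E_space p q n)"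
  unfolding measurable_norm_def using measurable_nrm_E_space by blast

section \<open>The upper bound\<close>

lemma best_constant_le: "0 \<le> C \<Longrightarrow> P (ennreal C) \<Longrightarrow> best_constant P \<le> ennreal C"
  unfolding best_constant_def by (rule Inf_lower) blast

lemma le_best_constant: "(\<And>C. 0 \<le> C \<Longrightarrow> P (ennreal C) \<Longrightarrow> b \<le> ennreal C) \<Longrightarrow> b \<le> best_constant P"
  unfolding best_constant_def by (rule Inf_greatest) blast

lemma Lnorm_real:
  assumes s: "1 \<le> s" and u: "u \<in> borel_measurable M"
  shows "Lnorm (ennreal s) M u < \<infinity> \<longleftrightarrow> integrable M (\<lambda>\<omega>. u \<omega> powr s)"
    and "integrable M (\<lambda>\<omega>. u \<omega> powr s) \<Longrightarrow> Lnorm (ennreal s) M u = ennreal ((\<integral>\<omega>. u \<omega> powr s \<partial>M) powr (1 / s))"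
proof -
  have L: "Lnorm (ennreal s) M u = (if (\<integral>\<^sup>+\<omega>. ennreal (u \<omega> powr s) \<partial>M) = \<infinity> then \<infinity>
      else ennreal (enn2real (\<integral>\<^sup>+\<omega>. ennreal (u \<omega> powr s) \<partial>M) powr (1 / s)))"
    using s by (simp add: Lnorm_def Let_def)
  have i: "integrable M (\<lambda>\<omega>. u \<omega> powr s) \<longleftrightarrow> (\<integral>\<^sup>+\<omega>. ennreal (u \<omega> powr s) \<partial>M) < \<infinity>"
    using u by (simp add: integrable_iff_bounded)
  show "Lnorm (ennreal s) M u < \<infinity> \<longleftrightarrow> integrable M (\<lambda>\<omega>. u \<omega> powr s)"
    unfolding L i by (simp add: less_top)
  assume int: "integrable M (\<lambda>\<omega>. u \<omega> powr s)"
  then show "Lnorm (ennreal s) M u = ennreal ((\<integral>\<omega>. u \<omega> powr s \<partial>M) powr (1 / s))"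
    unfolding L by (subst (1 2) nn_integral_eq_integral) (auto intro!: integral_nonneg_AE)
qed

lemma sum_diffs: "(\<Sum>k\<le>n. diffs f k \<omega> i) = f n \<omega> i"
  by (induction n) (auto simp: diffs_def)

lemma sum_signed_diffs:
  "(\<Sum>k\<le>n. of_real (\<epsilon> k) * diffs f k \<omega> i)
     = transform \<epsilon> (\<lambda>k \<omega>. f k \<omega> i) n \<omega>"
  unfolding lessThan_Suc_atMost[symmetric] sum.lessThan_Suc_shift by (simp add: diffs_def transform_def)

text \<open>The scalar estimate is used in every coordinate, since the norm lies between the largest
  modulus and the sum of the moduli. One factor of the dimension comes from bounding the sum by the
  maximum, the other from adding the \<open>s\<close>-th powers over all coordinates.\<close>

lemma AUMD_constant_finite_dim:
  assumes s: "1 \<le> s"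
  shows "\<exists>c::real. 1 \<le> c \<and> (\<forall>X :: bool list coord_space. lattice_normed X \<longrightarrow>
    measurable_norm X \<longrightarrow>
    1 \<le> card (idx X) \<longrightarrow> AUMD_constant s X \<le> ennreal (c * (card (idx X))\<^sup>2))"
proof -
  obtain C where C: "0 \<le> C" and Cb: "\<And>f n \<epsilon>. scalar_hardy s f \<Longrightarrow> (\<forall>k. \<epsilon> k = 1 \<or> \<epsilon> k = - 1) \<Longrightarrow>
    integrable m_inf (\<lambda>\<omega>. cmod (transform \<epsilon> f n \<omega>) powr s) \<and>
    (\<integral>\<omega>. cmod (transform \<epsilon> f n \<omega>) powr s \<partial>m_inf) \<le> C * (\<integral>\<omega>. cmod (f n \<omega>) powr s \<partial>m_inf)"
    using scalar_transform_bound[OF s] by (elim exE conjE) (rule that, assumption, blast)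
  \<comment> \<open>A constant of at least 1 satisfies \<open>C \<le> c \<le> c powr s\<close>, so
    it can be pulled inside the \<open>s\<close>-th power.\<close>
  define c where "c = max 1 C"
  show ?thesis
  proof (intro exI[of _ c] conjI allI impI)
    show "1 \<le> c" by (simp add: c_def)
    fix X :: "bool list coord_space"
    assume X: "lattice_normed X" and mX: "measurable_norm X"
      and card: "1 \<le> card (idx X)"
    note meas = mX[unfolded measurable_norm_def]
    let ?d = "card (idx X)"
    show "AUMD_constant s X \<le> ennreal (c * (card (idx X))\<^sup>2)"
      unfolding AUMD_constant_def
    proof (rule best_constant_le, goal_cases)
      case 1
      show ?case by (simp add: c_def)
    next
      case 2
      show ?case
      proof (intro allI impI SUP_least)
        fix f :: "nat \<Rightarrow> torus \<Rightarrow> bool list \<Rightarrow> complex" and n and \<epsilon> :: "nat \<Rightarrow> real"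
        assume H: "hardy_martingale (ennreal s) X f" and "\<epsilon> \<in> {\<epsilon>. \<forall>k. \<epsilon> k = 1 \<or> \<epsilon> k = - 1}"
        then have \<epsilon>: "\<forall>k. \<epsilon> k = 1 \<or> \<epsilon> k = - 1" by simp
        have fF: "(\<lambda>\<omega>. f k \<omega> i) \<in> borel_measurable (filt k)" if "i \<in> idx X" for k i
          using H that by (simp add: hardy_martingale_def)
        have fm: "(\<lambda>\<omega>. f k \<omega> i) \<in> borel_measurable m_inf" if "i \<in> idx X" for k i
          using measurable_filt[OF fF[OF that]] .
        have nm: "(\<lambda>\<omega>. nrm X (f k \<omega>)) \<in> borel_measurable m_inf" for k
          using meas fm by blast
        have ni: "integrable m_inf (\<lambda>\<omega>. nrm X (f k \<omega>) powr s)" for k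
        proof -
          have "Lnorm (ennreal s) m_inf (\<lambda>\<omega>. nrm X (f k \<omega>)) \<le> (SUP n. Lnorm (ennreal s) m_inf (\<lambda>\<omega>. nrm X (f n \<omega>)))"
            by (rule SUP_upper) simp
          also have "\<dots> < \<infinity>" using H by (simp add: hardy_martingale_def)
          finally show ?thesis by (simp only: Lnorm_real(1)[OF s nm])
        qed
        have fi: "integrable m_inf (\<lambda>\<omega>. cmod (f k \<omega> i) powr s)" if i: "i \<in> idx X" for k i
          by (rule Bochner_Integration.integrable_bound[OF ni[of k]])
            (use fm[OF i] cmod_le_nrm[OF X i] s in \<open>auto intro!: AE_I2 powr_mono2\<close>)
        define g where "g i \<omega> = (\<Sum>k\<le>n. of_real (\<epsilon> k) * diffs f k \<omega> i)" for i \<omega>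
        have G: "integrable m_inf (\<lambda>\<omega>. cmod (g i \<omega>) powr s)"
            "(\<integral>\<omega>. cmod (g i \<omega>) powr s \<partial>m_inf) \<le> C * (\<integral>\<omega>. cmod (f n \<omega> i) powr s \<partial>m_inf)" if i: "i \<in> idx X" for i
        proof -
          have "\<forall>k. AE \<omega> in m_inf. \<forall>j\<le>0. fourier_coeff (\<lambda>t. f (Suc k) (fun_upd \<omega> (Suc k) t) i - f k (fun_upd \<omega> (Suc k) t) i) j = 0"
          proof
            fix k
            have "analytic_in_last X (Suc k) (diffs f (Suc k))" using H by (simp add: hardy_martingale_def)
            then obtain \<phi> where "AE \<omega> in m_inf. \<forall>j. fourier_coeff (\<lambda>t. diffs f (Suc k) (fun_upd \<omega> (Suc k) t) i) j = (if j \<ge> 1 then \<phi> j \<omega> i else 0)"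
              using i unfolding analytic_in_last_def by blast
            then show "AE \<omega> in m_inf. \<forall>j\<le>0. fourier_coeff (\<lambda>t. f (Suc k) (fun_upd \<omega> (Suc k) t) i - f k (fun_upd \<omega> (Suc k) t) i) j = 0"
              by eventually_elim (auto simp: diffs_def)
          qed
          then have "scalar_hardy s (\<lambda>k \<omega>. f k \<omega> i)"
            using fF[OF i] fi[OF i] by (simp add: scalar_hardy_def)
          from Cb[OF this \<epsilon>, of n]
          show "integrable m_inf (\<lambda>\<omega>. cmod (g i \<omega>) powr s)"
            "(\<integral>\<omega>. cmod (g i \<omega>) powr s \<partial>m_inf) \<le> C * (\<integral>\<omega>. cmod (f n \<omega> i) powr s \<partial>m_inf)"
            unfolding g_def sum_signed_diffs by blast+
        qed
        have gm: "g i \<in> borel_measurable m_inf" if i: "i \<in> idx X" for i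
          unfolding g_def sum_signed_diffs transform_def
          by (intro borel_measurable_add borel_measurable_sum borel_measurable_times borel_measurable_diff
              borel_measurable_const fm i)
        have gnm: "(\<lambda>\<omega>. nrm X (\<lambda>i. g i \<omega>)) \<in> borel_measurable m_inf"
          by (rule meas[rule_format, of "\<lambda>\<omega> i. g i \<omega>"]) (rule gm)
        let ?F = "\<integral>\<omega>. nrm X (f n \<omega>) powr s \<partial>m_inf"
        have le: "nrm X (\<lambda>i. g i \<omega>) powr s \<le> real ?d powr s * (\<Sum>i\<in>idx X. cmod (g i \<omega>) powr s)" for \<omega>
        proof -
          have fin: "finite (idx X)" and ne: "idx X \<noteq> {}" using finite_idx[OF X] card by auto
          obtain j where j: "j \<in> idx X" "\<And>i. i \<in> idx X \<Longrightarrow> cmod (g i \<omega>) \<le> cmod (g j \<omega>)"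
            using finite_ne_induct Max_in[of "(\<lambda>i. cmod (g i \<omega>)) ` idx X"] Max_ge[of "(\<lambda>i. cmod (g i \<omega>)) ` idx X"] fin ne
            by (smt (verit) finite_imageI image_iff image_is_empty imageI)
          have "nrm X (\<lambda>i. g i \<omega>) \<le> (\<Sum>i\<in>idx X. cmod (g i \<omega>))" by (rule nrm_le_sum[OF X])
          also have "\<dots> \<le> real ?d * cmod (g j \<omega>)" using sum_bounded_above[of "idx X" "\<lambda>i. cmod (g i \<omega>)"] j by simp
          finally have "nrm X (\<lambda>i. g i \<omega>) powr s \<le> (real ?d * cmod (g j \<omega>)) powr s"
            using s by (intro powr_mono2 nrm_nonneg[OF X]) auto
          also have "\<dots> = real ?d powr s * cmod (g j \<omega>) powr s" by (rule powr_mult)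
          also have "cmod (g j \<omega>) powr s \<le> (\<Sum>i\<in>idx X. cmod (g i \<omega>) powr s)"
            by (rule member_le_sum[OF j(1)]) (use fin in auto)
          finally show ?thesis by (simp add: mult_left_mono)
        qed
        have iR: "integrable m_inf (\<lambda>\<omega>. real ?d powr s * (\<Sum>i\<in>idx X. cmod (g i \<omega>) powr s))"
          using G(1) by auto
        have iG: "integrable m_inf (\<lambda>\<omega>. nrm X (\<lambda>i. g i \<omega>) powr s)"
          by (rule Bochner_Integration.integrable_bound[OF iR])
            (use gnm le in \<open>auto intro!: AE_I2 order_trans[OF le abs_ge_self]\<close>)
        have "(\<integral>\<omega>. nrm X (\<lambda>i. g i \<omega>) powr s \<partial>m_inf) \<le> (\<integral>\<omega>. real ?d powr s * (\<Sum>i\<in>idx X. cmod (g i \<omega>) powr s) \<partial>m_inf)"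
          by (rule integral_mono[OF iG iR le])
        also have "\<dots> = real ?d powr s * (\<Sum>i\<in>idx X. (\<integral>\<omega>. cmod (g i \<omega>) powr s \<partial>m_inf))"
          using G(1) by (simp add: Bochner_Integration.integral_sum)
        also have "\<dots> \<le> real ?d powr s * (\<Sum>i\<in>idx X. C * ?F)"
        proof (intro mult_left_mono sum_mono)
          fix i assume i: "i \<in> idx X"
          have "(\<integral>\<omega>. cmod (f n \<omega> i) powr s \<partial>m_inf) \<le> ?F"
            by (rule integral_mono[OF fi[OF i] ni]) (use cmod_le_nrm[OF X i] s in \<open>auto intro: powr_mono2\<close>)
          then show "(\<integral>\<omega>. cmod (g i \<omega>) powr s \<partial>m_inf) \<le> C * ?F" using G(2)[OF i] C by (meson mult_left_mono order_trans)
        qed simp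
        also have "\<dots> \<le> (c * real ?d ^ 2) powr s * ?F"
        proof -
          have F0: "0 \<le> ?F" by (intro Bochner_Integration.integral_nonneg) simp
          have c1: "1 \<le> c" "C \<le> c" by (auto simp: c_def)
          have "real ?d * C \<le> real ?d powr s * c powr s"
          proof (intro mult_mono)
            show "real ?d \<le> real ?d powr s" using powr_mono[of 1 s "real ?d"] s card by simp
            show "C \<le> c powr s" using powr_mono[of 1 s c] s c1 by simp
          qed (use C in auto)
          then have "real ?d powr s * (real ?d * C) * ?F \<le> real ?d powr s * (real ?d powr s * c powr s) * ?F"
            by (intro mult_right_mono mult_left_mono F0) auto
          also have "real ?d powr s * (real ?d powr s * c powr s) = (c * real ?d ^ 2) powr s"
            unfolding power2_eq_square powr_mult by (simp add: mult_ac)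
          finally show ?thesis by (simp add: mult_ac)
        qed
        finally have main: "(\<integral>\<omega>. nrm X (\<lambda>i. g i \<omega>) powr s \<partial>m_inf) \<le> (c * real ?d ^ 2) powr s * ?F" .
        have F0: "0 \<le> ?F" "0 \<le> (\<integral>\<omega>. nrm X (\<lambda>i. g i \<omega>) powr s \<partial>m_inf)"
          by (intro Bochner_Integration.integral_nonneg; simp)+
        have cn: "0 \<le> c" by (simp add: c_def)
        then have c0: "0 \<le> c * real ?d ^ 2" by simp
        have "Lnorm (ennreal s) m_inf (\<lambda>\<omega>. nrm X (\<lambda>i. g i \<omega>)) = ennreal ((\<integral>\<omega>. nrm X (\<lambda>i. g i \<omega>) powr s \<partial>m_inf) powr (1 / s))"
          by (rule Lnorm_real(2)[OF s gnm iG])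
        also have "\<dots> \<le> ennreal (((c * real ?d ^ 2) powr s * ?F) powr (1 / s))"
          using s F0 main by (intro ennreal_leI powr_mono2) auto
        also have "((c * real ?d ^ 2) powr s * ?F) powr (1 / s) = c * real ?d ^ 2 * ?F powr (1 / s)"
          unfolding powr_mult using s c0 cn by (simp add: powr_powr)
        also have "ennreal \<dots> = ennreal (c * real ?d ^ 2) * Lnorm (ennreal s) m_inf (\<lambda>\<omega>. nrm X (f n \<omega>))"
          using c0 by (simp add: Lnorm_real(2)[OF s nm ni] ennreal_mult)
        finally show "Lnorm (ennreal s) m_inf (\<lambda>\<omega>. nrm X (\<lambda>i. \<Sum>k\<le>n. of_real (\<epsilon> k) * diffs f k \<omega> i))
           \<le> ennreal (c * ?d\<^sup>2) * Lnorm (ennreal s) m_inf (\<lambda>\<omega>. nrm X (\<lambda>i. \<Sum>k\<le>n. diffs f k \<omega> i))"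
          unfolding sum_diffs g_def of_nat_power .
      qed
    qed
  qed
qed

text \<open>The dimension is \<open>4 ^ n\<close>, its square is \<open>16 ^ n\<close>, and since
  \<open>c \<ge> 1\<close> the single factor \<open>c\<close> is at most \<open>c ^ n\<close>. The
  constant \<open>c\<close> comes from \<open>s\<close> alone.\<close>

lemma AUMD_constant_E_space_le:
  assumes pq: "1 \<le> p" "1 \<le> q" and s: "1 \<le> s"
  shows "\<exists>\<kappa>::real. \<forall>n\<ge>1. AUMD_constant s (E_space p q n) \<le> ennreal \<kappa> ^ n"
proof -
  obtain c :: real where c: "1 \<le> c" and b: "\<And>X :: bool list coord_space. lattice_normed X \<Longrightarrow>
    measurable_norm X \<Longrightarrow>
    1 \<le> card (idx X) \<Longrightarrow> AUMD_constant s X \<le> ennreal (c * (card (idx X))\<^sup>2)"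
    using AUMD_constant_finite_dim[OF s] by blast
  show ?thesis
  proof (intro exI[of _ "16 * c"] allI impI)
    fix n :: nat assume n: "1 \<le> n"
    have "AUMD_constant s (E_space p q n) \<le> ennreal (c * (card (idx (E_space p q n)))\<^sup>2)"
      by (rule b[OF lattice_normed_E_space[OF pq]])
        (simp_all add: measurable_norm_E_space card_E_space)
    also have "c * (card (idx (E_space p q n)))\<^sup>2 = c * 16 ^ n"
      by (simp add: card_E_space power_mult[symmetric] mult.commute[of n] power_mult)
    also have "c * 16 ^ n \<le> (16 * c) ^ n"
    proof -
      have "c ^ 1 \<le> c ^ n" using c n by (intro power_increasing) auto
      then show ?thesis by (simp add: power_mult_distrib)
    qed
    finally show "AUMD_constant s (E_space p q n) \<le> ennreal (16 * c) ^ n"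
      using c by (simp add: ennreal_power ennreal_leI)
  qed
qed

section \<open>The AUMD constant bounds the constant S\<close>

lemma measurable_evens_filt: "evens \<in> measurable (filt n) (filt (n div 2))"
proof (rule measurable_into_filt)
  show "evens x \<in> space m_inf" if "x \<in> space (filt n)" for x
    using measurable_space[OF measurable_evens] that by simp
  fix i :: nat assume "1 \<le> i" "i \<le> n div 2"
  then have "(\<lambda>x. x (2 * i)) \<in> measurable (filt n) circ" by (intro component_filt) auto
  then show "(\<lambda>x. evens x i) \<in> measurable (filt n) circ" using \<open>1 \<le> i\<close> by (simp add: evens_def)
qed

lemma evens_in_space: "\<omega> \<in> space m_inf \<Longrightarrow> evens \<omega> \<in> space m_inf"
  using measurable_space[OF measurable_evens] .

lemma evens_mix: "evens (mix {1..m} \<omega> \<omega>') = mix {1..m div 2} (evens \<omega>) (evens \<omega>')"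
  by (auto simp: fun_eq_iff evens_def mix_def)

lemma evens_upd_odd: "evens (fun_upd \<omega> (Suc (2 * j)) t) = evens \<omega>"
  by (auto simp: fun_eq_iff evens_def double_not_eq_Suc_double)

lemma evens_upd_even: "1 \<le> k \<Longrightarrow> evens (fun_upd \<omega> (2 * k) t) = fun_upd (evens \<omega>) k t"
  by (auto simp: fun_eq_iff evens_def)

lemma fourier_coeff_cmult: "fourier_coeff (\<lambda>t. c * g t) k = c * fourier_coeff g k"
  unfolding fourier_coeff_def by (simp add: mult.assoc)

lemma integral_circ_id: "(\<integral>t. t \<partial>circ) = 0"
  using integral_circ_powi[of 1] by simp

lemma measurable_upd_filt:
  assumes "1 \<le> n"
  shows "(\<lambda>(\<omega>, t). fun_upd \<omega> n t) \<in> measurable (filt (n - 1) \<Otimes>\<^sub>M circ) (filt n)"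
proof (rule measurable_into_filt)
  fix x assume "x \<in> space (filt (n - 1) \<Otimes>\<^sub>M circ)"
  then show "(case x of (\<omega>, t) \<Rightarrow> fun_upd \<omega> n t) \<in> space m_inf"
    using fun_upd_in_space assms by (auto simp: space_pair_measure)
next
  fix i :: nat assume i: "1 \<le> i" "i \<le> n"
  show "(\<lambda>x. (case x of (\<omega>, t) \<Rightarrow> fun_upd \<omega> n t) i) \<in> measurable (filt (n - 1) \<Otimes>\<^sub>M circ) circ"
  proof (cases "i = n")
    case False
    then have "(\<lambda>\<omega>. \<omega> i) \<in> measurable (filt (n - 1)) circ" using i by (intro component_filt) auto
    from measurable_compose[OF measurable_fst this] False show ?thesis by (simp add: split_beta')
  qed (simp add: split_beta')
qed

text \<open>The coefficient functions demanded by the definition are the Fourier coefficients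
  themselves. They are measurable in the earlier variables by Fubini, so only the vanishing at
  nonpositive indices has to be supplied.\<close>

lemma analytic_in_lastI:
  assumes n: "1 \<le> n" and d: "\<And>i. i \<in> idx X \<Longrightarrow> (\<lambda>\<omega>. d \<omega> i) \<in> borel_measurable (filt n)"
    and an: "\<And>i. i \<in> idx X \<Longrightarrow> AE \<omega> in m_inf. \<forall>k\<le>0. fourier_coeff (\<lambda>t. d (fun_upd \<omega> n t) i) k = 0"
  shows "analytic_in_last X n d"
  unfolding analytic_in_last_def
proof (intro exI[of _ "\<lambda>k \<omega> i. fourier_coeff (\<lambda>t. d (fun_upd \<omega> n t) i) k"] conjI allI impI ballI)
  fix k :: int and i assume i: "i \<in> idx X"
  have "(\<lambda>x. d (case x of (\<omega>, t) \<Rightarrow> fun_upd \<omega> n t) i) \<in> borel_measurable (filt (n - 1) \<Otimes>\<^sub>M circ)"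
    by (rule measurable_compose[OF measurable_upd_filt[OF n] d[OF i]])
  moreover have "(\<lambda>t. t powi - k) \<in> borel_measurable circ"
    by (intro continuous_borel_circ continuous_intros) auto
  then have "(\<lambda>x. snd x powi - k) \<in> borel_measurable (filt (n - 1) \<Otimes>\<^sub>M circ)"
    by (rule measurable_compose[OF measurable_snd])
  ultimately have "(\<lambda>x. d (case x of (\<omega>, t) \<Rightarrow> fun_upd \<omega> n t) i * snd x powi - k) \<in> borel_measurable (filt (n - 1) \<Otimes>\<^sub>M circ)"
    by (rule borel_measurable_times)
  then show "(\<lambda>\<omega>. fourier_coeff (\<lambda>t. d (fun_upd \<omega> n t) i) k) \<in> borel_measurable (filt (n - 1))"
    unfolding fourier_coeff_def
    by (intro circ.borel_measurable_lebesgue_integral) (simp add: split_beta')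
next
  fix i assume "i \<in> idx X"
  from an[OF this] show "AE \<omega> in m_inf. \<forall>k. fourier_coeff (\<lambda>t. d (fun_upd \<omega> n t) i) k
      = (if k \<ge> 1 then fourier_coeff (\<lambda>t. d (fun_upd \<omega> n t) i) k else 0)"
    by eventually_elim auto
qed

lemma hardy_space_infinity:
  assumes "\<theta> \<in> hardy_space \<infinity>"
  obtains B where "0 \<le> B" "\<theta> \<in> borel_measurable m_inf" "AE \<omega> in m_inf. cmod (\<theta> \<omega>) \<le> B"
    "\<And>m n. m \<le> n \<Longrightarrow> AE \<omega> in m_inf. cexp m (cexp n \<theta>) \<omega> = cexp m \<theta> \<omega>"
    "\<And>n. 1 \<le> n \<Longrightarrow> AE \<omega> in m_inf. \<forall>k\<le>0. fourier_coeff (\<lambda>t. cexp n \<theta> (fun_upd \<omega> n t) - cexp (n - 1) \<theta> (fun_upd \<omega> n t)) k = 0"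
proof -
  have m: "\<theta> \<in> borel_measurable m_inf" and L: "Lnorm \<infinity> m_inf (\<lambda>\<omega>. cmod (\<theta> \<omega>)) < \<infinity>"
    and H: "hardy_martingale \<infinity> scalars (\<lambda>n \<omega> _. cexp n \<theta> \<omega>)"
    using assms by (auto simp: hardy_space_def)
  let ?E = "esssup m_inf (\<lambda>\<omega>. ennreal (cmod (\<theta> \<omega>)))"
  have E: "?E < \<infinity>" using L by (simp add: Lnorm_def)
  have "AE \<omega> in m_inf. ennreal (cmod (\<theta> \<omega>)) \<le> ?E" by (rule esssup_AE)
  then have bound: "AE \<omega> in m_inf. cmod (\<theta> \<omega>) \<le> enn2real ?E"
  proof eventually_elim
    case (elim \<omega>)
    then have "ennreal (cmod (\<theta> \<omega>)) \<le> ennreal (enn2real ?E)" using E by (simp add: ennreal_enn2real_if)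
    then show ?case by (subst (asm) ennreal_le_iff) auto
  qed
  show thesis
  proof (rule that[OF _ m bound])
    show "0 \<le> enn2real ?E" by simp
    show "AE \<omega> in m_inf. cexp m (cexp n \<theta>) \<omega> = cexp m \<theta> \<omega>" if "m \<le> n" for m n
      using H that by (simp add: hardy_martingale_def scalars_def)
    show "AE \<omega> in m_inf. \<forall>k\<le>0. fourier_coeff (\<lambda>t. cexp n \<theta> (fun_upd \<omega> n t) - cexp (n - 1) \<theta> (fun_upd \<omega> n t)) k = 0"
      if n: "1 \<le> n" for n
    proof -
      have idx0: "[] \<in> idx scalars" by (simp add: scalars_def)
      have "analytic_in_last scalars n (diffs (\<lambda>n \<omega> _. cexp n \<theta> \<omega>) n)"
        using H n by (simp add: hardy_martingale_def)
      then obtain \<phi> where "AE \<omega> in m_inf. \<forall>j. fourier_coeff (\<lambda>t. diffs (\<lambda>n \<omega> _. cexp n \<theta> \<omega>) n (fun_upd \<omega> n t) ([] :: bool list)) j = (if j \<ge> 1 then \<phi> j \<omega> ([] :: bool list) else 0)"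
        unfolding analytic_in_last_def using idx0 by blast
      then show ?thesis by eventually_elim (use n in \<open>auto simp: diffs_def\<close>)
    qed
  qed
qed

lemma integrable_m_inf_bounded:
  fixes f :: "torus \<Rightarrow> 'b :: {banach, second_countable_topology}"
  assumes "f \<in> borel_measurable m_inf" "AE \<omega> in m_inf. norm (f \<omega>) \<le> B"
  shows "integrable m_inf f"
  using assms by (intro finite_measure.integrable_const_bound[OF prob_space.finite_measure[OF prob_space_m_inf]])

lemma measurable_mix_slice:
  assumes "\<omega> \<in> space m_inf" shows "mix S \<omega> \<in> measurable m_inf m_inf"
  using measurable_compose[OF measurable_Pair1'[OF assms] measurable_mix] by simp

lemma AE_norm_cexp_le:
  assumes "f \<in> borel_measurable m_inf" and b: "AE \<omega> in m_inf. cmod (f \<omega>) \<le> B"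
  shows "AE \<omega> in m_inf. cmod (cexp n f \<omega>) \<le> B"
proof -
  have f: "integrable m_inf f" by (rule integrable_m_inf_bounded[OF assms])
  from cexp_filt[OF f, of n] AE_mix[OF b, of "{1..n}"] integral_mix(3)[OF f, of "{1..n}"] show ?thesis
  proof eventually_elim
    case (elim \<omega>)
    have "cmod (cexp n f \<omega>) \<le> (\<integral>\<omega>'. cmod (f (mix {1..n} \<omega> \<omega>')) \<partial>m_inf)"
      unfolding elim(1) by (rule integral_norm_bound)
    also have "\<dots> \<le> (\<integral>\<omega>'. B \<partial>m_inf)"
      using elim by (intro integral_mono_AE) auto
    finally show ?case using measure_m_inf_space by simp
  qed
qed

text \<open>The martingale of \<open>w_j * \<theta>(z)\<close>, where coordinate
  \<open>2 * j + 1\<close> is the rotation \<open>w_j\<close> and coordinate \<open>2 * i\<close> is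
  \<open>z_i\<close>. Before \<open>w_j\<close> is revealed the conditional mean is 0; at time
  \<open>n\<close> the variables \<open>z_i\<close> with \<open>i \<le> n div 2\<close> are
  known.\<close>

definition interleave :: "(torus \<Rightarrow> complex) \<Rightarrow> nat \<Rightarrow> nat \<Rightarrow> torus \<Rightarrow> complex" where
  "interleave \<theta> j n \<omega> = (if Suc (2 * j) \<le> n then \<omega> (Suc (2 * j)) * cexp (n div 2) \<theta> (evens \<omega>) else 0)"

lemma measurable_interleave: "interleave \<theta> j n \<in> borel_measurable (filt n)"
proof (cases "Suc (2 * j) \<le> n")
  case True
  have "(\<lambda>\<omega>. \<omega> (Suc (2 * j))) \<in> borel_measurable (filt n)"
    using measurable_compose[OF component_filt id_borel_circ] True by simp
  then have "(\<lambda>\<omega>. \<omega> (Suc (2 * j)) * cexp (n div 2) \<theta> (evens \<omega>)) \<in> borel_measurable (filt n)"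
    by (intro borel_measurable_times measurable_compose[OF measurable_evens_filt measurable_cexp])
  with True show ?thesis by (simp add: interleave_def[abs_def])
qed (simp add: interleave_def[abs_def])

lemma cmod_component: "\<omega> \<in> space m_inf \<Longrightarrow> 1 \<le> i \<Longrightarrow> cmod (\<omega> i) = 1"
  by (auto simp: space_m_inf PiE_def)

lemma AE_interleave_le:
  assumes "\<theta> \<in> borel_measurable m_inf" "AE \<omega> in m_inf. cmod (\<theta> \<omega>) \<le> B" "0 \<le> B"
  shows "AE \<omega> in m_inf. cmod (interleave \<theta> j n \<omega>) \<le> B"
  using AE_evens[OF AE_norm_cexp_le[OF assms(1,2), of "n div 2"]] AE_space
  by eventually_elim (simp add: interleave_def norm_mult cmod_component assms(3))

text \<open>At time \<open>2 * l + 1\<close> the only new variable is the rotation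
  \<open>w_l\<close>, and \<open>n div 2\<close> keeps the value \<open>l\<close>; hence the only
  nonzero odd difference is the jump from 0 when \<open>w_j\<close> appears.\<close>

lemma interleave_odd_diff:
  "interleave \<theta> j (Suc (2 * l)) \<omega> - interleave \<theta> j (2 * l) \<omega>
    = (if l = j then \<omega> (Suc (2 * j)) * cexp j \<theta> (evens \<omega>) else 0)"
  by (auto simp: interleave_def)

lemma interleave_martingale:
  assumes \<theta>: "\<theta> \<in> hardy_space \<infinity>" and mn: "m \<le> n"
  shows "AE \<omega> in m_inf. cexp m (interleave \<theta> j n) \<omega> = interleave \<theta> j m \<omega>"
proof -
  obtain B where B: "0 \<le> B" "\<theta> \<in> borel_measurable m_inf" "AE \<omega> in m_inf. cmod (\<theta> \<omega>) \<le> B"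
    "\<And>m n. m \<le> n \<Longrightarrow> AE \<omega> in m_inf. cexp m (cexp n \<theta>) \<omega> = cexp m \<theta> \<omega>"
    by (rule hardy_space_infinity[OF \<theta>]) (rule that)
  have F: "interleave \<theta> j n \<in> borel_measurable m_inf" by (rule measurable_filt[OF measurable_interleave])
  have iF: "integrable m_inf (interleave \<theta> j n)"
    by (rule integrable_m_inf_bounded[OF F AE_interleave_le[OF B(2,3,1)]])
  have cm: "cexp (n div 2) \<theta> \<in> borel_measurable m_inf" by (rule measurable_filt[OF measurable_cexp])
  have ic: "integrable m_inf (cexp (n div 2) \<theta>)"
    by (rule integrable_m_inf_bounded[OF cm AE_norm_cexp_le[OF B(2,3)]])
  have tower: "AE \<omega> in m_inf. (\<integral>\<omega>'. cexp (n div 2) \<theta> (mix {1..m div 2} \<omega> \<omega>') \<partial>m_inf) = cexp (m div 2) \<theta> \<omega>"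
    using cexp_filt[OF ic, of "m div 2"] B(4)[of "m div 2" "n div 2"] mn
    by (auto simp: div_le_mono elim!: eventually_mono[OF eventually_conj])
  show ?thesis
    using cexp_filt[OF iF, of m] integral_mix(3)[OF iF, of "{1..m}"] AE_evens[OF tower] AE_space
  proof eventually_elim
    case (elim \<omega>)
    note es = evens_in_space[OF elim(4)]
    have sl: "(\<lambda>\<zeta>. cexp (n div 2) \<theta> (mix {1..m div 2} (evens \<omega>) \<zeta>)) \<in> borel_measurable m_inf"
      by (rule measurable_compose[OF measurable_mix_slice[OF es] cm])
    consider "Suc (2 * j) \<le> m" | "m < Suc (2 * j)" "Suc (2 * j) \<le> n" | "n < Suc (2 * j)" by linarith
    then have "(\<integral>\<omega>'. interleave \<theta> j n (mix {1..m} \<omega> \<omega>') \<partial>m_inf) = interleave \<theta> j m \<omega>"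
    proof cases
      case 1
      have "(\<integral>\<omega>'. interleave \<theta> j n (mix {1..m} \<omega> \<omega>') \<partial>m_inf)
          = (\<integral>\<omega>'. \<omega> (Suc (2 * j)) * cexp (n div 2) \<theta> (mix {1..m div 2} (evens \<omega>) (evens \<omega>')) \<partial>m_inf)"
      proof -
        have "mix {1..m} \<omega> \<omega>' (Suc (2 * j)) = \<omega> (Suc (2 * j))" for \<omega>' using 1 by (simp add: mix_def)
        then show ?thesis using 1 mn by (simp only: interleave_def evens_mix) simp
      qed
      also have "\<dots> = \<omega> (Suc (2 * j)) * (\<integral>\<omega>'. cexp (n div 2) \<theta> (mix {1..m div 2} (evens \<omega>) (evens \<omega>')) \<partial>m_inf)"
        by (rule integral_mult_right_zero)
      also have "(\<integral>\<omega>'. cexp (n div 2) \<theta> (mix {1..m div 2} (evens \<omega>) (evens \<omega>')) \<partial>m_inf)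
         = (\<integral>\<zeta>. cexp (n div 2) \<theta> (mix {1..m div 2} (evens \<omega>) \<zeta>) \<partial>m_inf)"
        by (rule integral_evens[OF sl])
      finally show ?thesis using 1 elim(3) by (simp add: interleave_def)
    next
      case 2
      have eq: "interleave \<theta> j n (mix {1..m} \<omega> \<omega>')
          = \<omega>' (Suc (2 * j)) * cexp (n div 2) \<theta> (mix {1..m div 2} (evens \<omega>) (evens \<omega>'))" for \<omega>'
      proof -
        have "mix {1..m} \<omega> \<omega>' (Suc (2 * j)) = \<omega>' (Suc (2 * j))" using 2 by (simp add: mix_def)
        then show ?thesis using 2 by (simp only: interleave_def evens_mix) simp
      qed
      \<comment> \<open>The rotation is still averaged out: integrating first over coordinate
        \<open>2 * j + 1\<close>, which \<open>evens\<close> ignores, gives 0.\<close>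
      have 3: "1 \<le> Suc (2 * j)" by simp
      have "(\<integral>\<omega>'. interleave \<theta> j n (mix {1..m} \<omega> \<omega>') \<partial>m_inf)
        = (\<integral>\<omega>'. (\<integral>t. interleave \<theta> j n (mix {1..m} \<omega> (fun_upd \<omega>' (Suc (2 * j)) t)) \<partial>circ) \<partial>m_inf)"
        by (rule integral_upd(2)[OF 3 elim(2), symmetric])
      also have "\<dots> = 0"
        unfolding eq evens_upd_odd by (simp add: integral_circ_id)
      finally show ?thesis using 2 by (simp add: interleave_def)
    next
      case 3
      then show ?thesis using mn by (simp add: interleave_def)
    qed
    with elim(1) show ?case by simp
  qed
qed

text \<open>At odd times the difference is a multiple of the new variable. At even times it is a
  difference of the martingale of \<open>\<theta>\<close>, multiplied by a rotation that is already
  known or by 0.\<close>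

lemma interleave_analytic:
  assumes \<theta>: "\<theta> \<in> hardy_space \<infinity>" and n: "1 \<le> n"
  shows "AE \<omega> in m_inf. \<forall>k\<le>0. fourier_coeff (\<lambda>t. interleave \<theta> j n (fun_upd \<omega> n t) - interleave \<theta> j (n - 1) (fun_upd \<omega> n t)) k = 0"
proof (cases "odd n")
  case True
  then obtain l where l: "n = Suc (2 * l)" by (auto elim: oddE)
  have "interleave \<theta> j n (fun_upd \<omega> n t) - interleave \<theta> j (n - 1) (fun_upd \<omega> n t)
      = (if l = j then cexp j \<theta> (evens \<omega>) else 0) * t powi 1" for \<omega> t
    unfolding l diff_Suc_1 interleave_odd_diff by (auto simp: evens_upd_odd)
  then show ?thesis by (simp only: fourier_coeff_cmult fourier_coeff_powi) simp
next
  case False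
  then obtain l where l: "n = 2 * l" by (auto elim: evenE)
  then have l1: "1 \<le> l" using n by simp
  obtain B where B: "\<And>n. 1 \<le> n \<Longrightarrow> AE \<omega> in m_inf. \<forall>k\<le>0. fourier_coeff (\<lambda>t. cexp n \<theta> (fun_upd \<omega> n t) - cexp (n - 1) \<theta> (fun_upd \<omega> n t)) k = 0"
    by (rule hardy_space_infinity[OF \<theta>]) (rule that)
  have "interleave \<theta> j n (fun_upd \<omega> n t) - interleave \<theta> j (n - 1) (fun_upd \<omega> n t)
      = (if j < l then \<omega> (Suc (2 * j)) else 0) * (cexp l \<theta> (fun_upd (evens \<omega>) l t) - cexp (l - 1) \<theta> (fun_upd (evens \<omega>) l t))" for \<omega> t
  proof -
    have d: "(2 * l - 1) div 2 = l - 1" using l1 by (cases l) auto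
    have "Suc (2 * j) \<le> 2 * l \<longleftrightarrow> j < l" "Suc (2 * j) \<le> 2 * l - 1 \<longleftrightarrow> j < l" by linarith+
    moreover have "fun_upd \<omega> (2 * l) t (Suc (2 * j)) = \<omega> (Suc (2 * j))"
      using double_not_eq_Suc_double[of l j] by auto
    ultimately show ?thesis
      unfolding l interleave_def d evens_upd_even[OF l1] by (simp add: right_diff_distrib)
  qed
  then show ?thesis using AE_evens[OF B[OF l1]] by (simp only: fourier_coeff_cmult) (auto elim: eventually_mono)
qed

section \<open>Comparison of the L1, \<open>L_s\<close> and supremum norms\<close>

lemma scaled_powr_bound:
  fixes x s :: real
  assumes "0 \<le> x" "1 \<le> s"
  shows "x \<le> x powr s / s + (1 - 1 / s)"
proof (cases "s = 1")
  case False
  then have s: "1 < s" using assms by simp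
  define r where "r = s / (s - 1)"
  have r: "1 < r" "1 / s + 1 / r = 1" using s by (auto simp: r_def field_simps)
  have "x * 1 \<le> x powr s / s + 1 powr r / r"
    by (rule Youngs_inequality[OF s r(1) r(2)]) (use assms in auto)
  then show ?thesis using r(2) by simp
qed (use assms in simp)

text \<open>Young's inequality for \<open>u / M\<close> bounds the mean of \<open>u\<close> by
  \<open>M\<close> for every \<open>M\<close> above the \<open>L_s\<close> norm; taking
  \<open>M\<close> strictly larger avoids division by a vanishing norm.\<close>

lemma integral_le_powr_norm:
  fixes s :: real and u :: "torus \<Rightarrow> real"
  assumes s: "1 \<le> s" and u: "u \<in> borel_measurable m_inf" "\<And>\<omega>. 0 \<le> u \<omega>"
    and i: "integrable m_inf (\<lambda>\<omega>. u \<omega> powr s)"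
  shows "integrable m_inf u" "(\<integral>\<omega>. u \<omega> \<partial>m_inf) \<le> (\<integral>\<omega>. u \<omega> powr s \<partial>m_inf) powr (1 / s)"
proof -
  let ?I = "\<integral>\<omega>. u \<omega> powr s \<partial>m_inf"
  have I0: "0 \<le> ?I" by (intro Bochner_Integration.integral_nonneg) simp
  show iu: "integrable m_inf u"
  proof (rule Bochner_Integration.integrable_bound)
    show "integrable m_inf (\<lambda>\<omega>. u \<omega> powr s / s + (1 - 1 / s))"
      using i prob_space_m_inf by (auto intro!: finite_measure.integrable_const prob_space.finite_measure)
    show "AE \<omega> in m_inf. norm (u \<omega>) \<le> norm (u \<omega> powr s / s + (1 - 1 / s))"
      using scaled_powr_bound[OF u(2) s] u(2) by (intro AE_I2) (metis abs_ge_self abs_of_nonneg order_trans real_norm_def)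
  qed (rule u(1))
  have le: "(\<integral>\<omega>. u \<omega> \<partial>m_inf) \<le> M" if M: "?I powr (1 / s) < M" for M
  proof -
    have M0: "0 < M" using M by (meson less_le_trans not_less powr_ge_zero)
    have "?I = (?I powr (1 / s)) powr s" using s I0 by (simp add: powr_powr)
    also have "\<dots> \<le> M powr s" using M s by (intro powr_mono2) auto
    finally have IM: "?I \<le> M powr s" .
    have "(\<integral>\<omega>. u \<omega> / M \<partial>m_inf) \<le> (\<integral>\<omega>. u \<omega> powr s / (s * M powr s) + (1 - 1 / s) \<partial>m_inf)"
    proof (rule integral_mono)
      show "integrable m_inf (\<lambda>\<omega>. u \<omega> / M)" using iu by simp
      show "integrable m_inf (\<lambda>\<omega>. u \<omega> powr s / (s * M powr s) + (1 - 1 / s))"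
        using i prob_space_m_inf by (auto intro!: finite_measure.integrable_const prob_space.finite_measure)
      show "u \<omega> / M \<le> u \<omega> powr s / (s * M powr s) + (1 - 1 / s)" for \<omega>
        using scaled_powr_bound[of "u \<omega> / M" s] u(2)[of \<omega>] M0 s by (simp add: powr_divide mult.commute)
    qed
    also have "\<dots> = ?I / (s * M powr s) + (1 - 1 / s)"
      using i measure_m_inf_space by simp
    also have "\<dots> \<le> 1 / s + (1 - 1 / s)"
      using IM M0 s by (simp add: field_simps)
    finally show ?thesis using M0 by simp
  qed
  show "(\<integral>\<omega>. u \<omega> \<partial>m_inf) \<le> ?I powr (1 / s)"
    by (rule dense_ge) (rule le)
qed

lemma powr_norm_le_bound:
  fixes s :: real and u :: "torus \<Rightarrow> real"
  assumes s: "1 \<le> s" and u: "u \<in> borel_measurable m_inf" "\<And>\<omega>. 0 \<le> u \<omega>" and M: "AE \<omega> in m_inf. u \<omega> \<le> M"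
  shows "integrable m_inf (\<lambda>\<omega>. u \<omega> powr s)" "(\<integral>\<omega>. u \<omega> powr s \<partial>m_inf) powr (1 / s) \<le> M"
proof -
  have "AE \<omega> in m_inf. 0 \<le> M" using M by eventually_elim (rule order_trans[OF u(2)])
  then have M0: "0 \<le> M" using prob_space.AE_const[OF prob_space_m_inf] by simp
  have b: "AE \<omega> in m_inf. norm (u \<omega> powr s) \<le> M powr s"
    using M by eventually_elim (use u(2) s in \<open>simp add: powr_mono2\<close>)
  show i: "integrable m_inf (\<lambda>\<omega>. u \<omega> powr s)"
    by (rule integrable_m_inf_bounded[OF _ b]) (use u in auto)
  have "(\<integral>\<omega>. u \<omega> powr s \<partial>m_inf) \<le> (\<integral>\<omega>. M powr s \<partial>m_inf)"
    using b i prob_space_m_inf by (intro integral_mono_AE) (auto intro!: finite_measure.integrable_const prob_space.finite_measure)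
  then have "(\<integral>\<omega>. u \<omega> powr s \<partial>m_inf) \<le> M powr s"
    using measure_m_inf_space by simp
  then have "(\<integral>\<omega>. u \<omega> powr s \<partial>m_inf) powr (1 / s) \<le> (M powr s) powr (1 / s)"
    using s by (intro powr_mono2) auto
  then show "(\<integral>\<omega>. u \<omega> powr s \<partial>m_inf) powr (1 / s) \<le> M" using s M0 by (simp add: powr_powr)
qed

text \<open>With sign plus at odd and minus at even times, adding the unsigned sum doubles the odd
  differences and cancels the even ones.\<close>

lemma interleave_signed_sum:
  "(\<Sum>k\<le>Suc (2 * M). of_real (if odd k then 1 else - 1) * diffs f k \<omega> i) + (\<Sum>k\<le>Suc (2 * M). diffs f k \<omega> i)
    = 2 * (\<Sum>l\<le>M. f (Suc (2 * l)) \<omega> i - f (2 * l) \<omega> i)"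
proof (induction M)
  case 0
  show ?case by (simp add: diffs_def)
next
  case (Suc M)
  have s: "(\<Sum>k\<le>Suc (2 * Suc M). g k) = (\<Sum>k\<le>Suc (2 * M). g k) + g (Suc (Suc (2 * M))) + g (Suc (Suc (Suc (2 * M))))" for g :: "nat \<Rightarrow> complex"
    by (simp add: add.assoc)
  show ?case unfolding s using Suc.IH
    by (simp add: diffs_def algebra_simps)
qed

lemma S_le_AUMD:
  fixes X :: "bool list coord_space"
  assumes X: "lattice_normed X"
    and mX: "measurable_norm X"
    and s: "1 \<le> s"
  shows "S_constant X (idx X) basis_vec \<le> AUMD_constant s X"
  unfolding AUMD_constant_def
proof (rule le_best_constant)
  note meas = mX[unfolded measurable_norm_def, rule_format]
  fix C :: real
  assume C: "0 \<le> C" and AUMD: "\<forall>f n. hardy_martingale (ennreal s) X f \<longrightarrow>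
      (SUP \<epsilon>\<in>{\<epsilon> :: nat \<Rightarrow> real. \<forall>k. \<epsilon> k = 1 \<or> \<epsilon> k = - 1}.
         Lnorm (ennreal s) m_inf (\<lambda>\<omega>. nrm X (\<lambda>i. \<Sum>k\<le>n. of_real (\<epsilon> k) * diffs f k \<omega> i)))
      \<le> ennreal C * Lnorm (ennreal s) m_inf (\<lambda>\<omega>. nrm X (\<lambda>i. \<Sum>k\<le>n. diffs f k \<omega> i))"
  show "S_constant X (idx X) basis_vec \<le> ennreal C"
    unfolding S_constant_def
  proof (rule best_constant_le[OF C], intro allI impI, elim conjE)
    fix N :: nat and \<iota> :: "nat \<Rightarrow> bool list" and \<theta> :: "nat \<Rightarrow> torus \<Rightarrow> complex"
    assume inj: "inj_on \<iota> {..N}" and \<iota>: "\<iota> ` {..N} \<subseteq> idx X" and \<theta>: "\<forall>k\<le>N. \<theta> k \<in> hardy_space \<infinity>"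
    \<comment> \<open>Distinct indices mean that each coordinate receives at most one of the
      functions; \<open>J\<close> finds it, and \<open>sel\<close> describes the sum
      coordinatewise.\<close>
    define J where "J i = inv_into {..N} \<iota> i" for i
    have J: "J i \<le> N" "\<iota> (J i) = i" if "i \<in> \<iota> ` {..N}" for i
      using that inv_into_into[of i \<iota> "{..N}"] f_inv_into_f[of i \<iota> "{..N}"] by (auto simp: J_def)
    have J_\<iota>: "J (\<iota> k) = k" if "k \<le> N" for k using that inj by (simp add: J_def)
    define sel where "sel g i = (if i \<in> \<iota> ` {..N} then g (J i) else (0 :: complex))" for g :: "nat \<Rightarrow> complex" and i
    have sel_sum: "(\<Sum>k\<le>N. g k * basis_vec (\<iota> k) i) = sel g i" for g i
    proof (cases "i \<in> \<iota> ` {..N}")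
      case True
      have "(\<Sum>k\<le>N. g k * basis_vec (\<iota> k) i) = (\<Sum>k\<le>N. if k = J i then g k else 0)"
        using J[OF True] J_\<iota> by (intro sum.cong) (auto simp: basis_vec_def)
      then show ?thesis using J[OF True] True by (simp add: sel_def)
    next
      case False
      then show ?thesis by (auto simp: sel_def basis_vec_def intro!: sum.neutral)
    qed
    define P where "P k B \<longleftrightarrow> 0 \<le> B \<and> \<theta> k \<in> borel_measurable m_inf \<and> (AE \<omega> in m_inf. cmod (\<theta> k \<omega>) \<le> B)" for k B
    have "\<exists>B. P k B" if "k \<in> {..N}" for k
    proof -
      have "\<theta> k \<in> hardy_space \<infinity>" using \<theta> that by simp
      then show ?thesis by (rule hardy_space_infinity) (unfold P_def, blast)
    qed
    then obtain B where "\<forall>k\<in>{..N}. P k (B k)" using bchoice[of "{..N}" P] by blast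
    then have B: "\<And>k. k \<le> N \<Longrightarrow> 0 \<le> B k" "\<And>k. k \<le> N \<Longrightarrow> \<theta> k \<in> borel_measurable m_inf"
      "\<And>k. k \<le> N \<Longrightarrow> AE \<omega> in m_inf. cmod (\<theta> k \<omega>) \<le> B k"
      by (simp_all add: P_def)
    define b where "b = (\<Sum>k\<le>N. B k)"
    have Bb: "B k \<le> b" if "k \<le> N" for k
      unfolding b_def using that B(1) by (intro member_le_sum) auto
    have b0: "0 \<le> b" unfolding b_def by (intro sum_nonneg) (simp add: B(1))
    let ?d = "real (card (idx X))"
    have sel_le: "nrm X (\<lambda>i. sel g i) \<le> ?d * b" if "\<And>k. k \<le> N \<Longrightarrow> cmod (g k) \<le> b" for g
    proof -
      have "nrm X (\<lambda>i. sel g i) \<le> (\<Sum>i\<in>idx X. cmod (sel g i))" by (rule nrm_le_sum[OF X])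
      also have "\<dots> \<le> ?d * b"
        using sum_bounded_above[of "idx X" "\<lambda>i. cmod (sel g i)" b] that J b0 by (auto simp: sel_def)
      finally show ?thesis .
    qed
    have AE_sel: "AE \<omega> in m_inf. nrm X (\<lambda>i. sel (\<lambda>k. g k \<omega>) i) \<le> ?d * b"
      if "\<And>k. k \<le> N \<Longrightarrow> AE \<omega> in m_inf. cmod (g k \<omega>) \<le> B k" for g :: "nat \<Rightarrow> torus \<Rightarrow> complex"
    proof -
      have "AE \<omega> in m_inf. \<forall>k\<in>{..N}. cmod (g k \<omega>) \<le> B k"
        using that by (intro AE_finite_allI) auto
      then show ?thesis
      proof eventually_elim
        case (elim \<omega>)
        have "cmod (g k \<omega>) \<le> b" if "k \<le> N" for k
          using bspec[OF elim, of k] that Bb[OF that] by simp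
        then show ?case by (rule sel_le)
      qed
    qed
    have sel_meas: "(\<lambda>\<omega>. nrm X (\<lambda>i. sel (\<lambda>k. g k \<omega>) i)) \<in> borel_measurable m_inf"
      if "\<And>k. k \<le> N \<Longrightarrow> g k \<in> borel_measurable m_inf" for g :: "nat \<Rightarrow> torus \<Rightarrow> complex"
    proof (rule meas)
      fix i show "(\<lambda>\<omega>. sel (\<lambda>k. g k \<omega>) i) \<in> borel_measurable m_inf"
        using that[OF J(1)[of i]] by (cases "i \<in> \<iota> ` {..N}") (simp_all add: sel_def)
    qed
    define f where "f n \<omega> i = sel (\<lambda>j. interleave (\<theta> j) j n \<omega>) i" for n \<omega> i
    have H: "hardy_martingale (ennreal s) X f"
      unfolding hardy_martingale_def
    proof (intro conjI allI impI ballI)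
      show fm: "(\<lambda>\<omega>. f n \<omega> i) \<in> borel_measurable (filt n)" for n i
        by (cases "i \<in> \<iota> ` {..N}") (simp_all add: f_def sel_def measurable_interleave)
      show "AE \<omega> in m_inf. cexp m (\<lambda>\<omega>. f n \<omega> i) \<omega> = f m \<omega> i" if "m \<le> n" for m n i
      proof (cases "i \<in> \<iota> ` {..N}")
        case True
        have "\<theta> (J i) \<in> hardy_space \<infinity>" using \<theta> J[OF True] by blast
        from interleave_martingale[OF this that, of "J i"] True show ?thesis by (simp add: f_def sel_def)
      next
        case False
        have "integrable m_inf (\<lambda>_ :: torus. 0 :: complex)" by simp
        from cexp_filt[OF this, of m] False show ?thesis by (simp add: f_def sel_def)
      qed
      have "Lnorm (ennreal s) m_inf (\<lambda>\<omega>. nrm X (f n \<omega>)) \<le> ennreal (?d * b)" for n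
      proof -
        have m: "(\<lambda>\<omega>. nrm X (f n \<omega>)) \<in> borel_measurable m_inf"
          unfolding f_def[abs_def] by (rule sel_meas) (rule measurable_filt[OF measurable_interleave])
        have "AE \<omega> in m_inf. nrm X (f n \<omega>) \<le> ?d * b"
          unfolding f_def by (rule AE_sel) (rule AE_interleave_le[OF B(2,3,1)])
        note * = powr_norm_le_bound[OF s m nrm_nonneg[OF X] this]
        then show ?thesis by (simp add: Lnorm_real(2)[OF s m *(1)] ennreal_leI)
      qed
      then have "(SUP n. Lnorm (ennreal s) m_inf (\<lambda>\<omega>. nrm X (f n \<omega>))) \<le> ennreal (?d * b)"
        by (rule SUP_least)
      then show "(SUP n. Lnorm (ennreal s) m_inf (\<lambda>\<omega>. nrm X (f n \<omega>))) < \<infinity>"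
        by (rule le_less_trans) simp
      fix n :: nat assume n: "1 \<le> n"
      show "analytic_in_last X n (diffs f n)"
      proof (rule analytic_in_lastI[OF n])
        fix i
        have dn: "diffs f n \<omega> i = f n \<omega> i - f (n - 1) \<omega> i" for \<omega> using n by (simp add: diffs_def)
        have "(\<lambda>\<omega>. f (n - 1) \<omega> i) \<in> borel_measurable (filt n)"
          by (rule measurable_from_subalg[OF subalgebra_filt_mono fm]) simp
        then show "(\<lambda>\<omega>. diffs f n \<omega> i) \<in> borel_measurable (filt n)"
          unfolding dn by (intro borel_measurable_diff fm)
        show "AE \<omega> in m_inf. \<forall>k\<le>0. fourier_coeff (\<lambda>t. diffs f n (fun_upd \<omega> n t) i) k = 0"
        proof (cases "i \<in> \<iota> ` {..N}")
          case True
          have "\<theta> (J i) \<in> hardy_space \<infinity>" using \<theta> J[OF True] by blast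
          from interleave_analytic[OF this n, of "J i"] True show ?thesis by (simp add: dn f_def sel_def)
        next
          case False
          then show ?thesis by (simp add: dn f_def sel_def fourier_coeff_def)
        qed
      qed
    qed
    \<comment> \<open>The time at which all rotations \<open>w_0, ..., w_N\<close> have been
      revealed.\<close>
    let ?n = "Suc (2 * N)"
    define \<epsilon> :: "nat \<Rightarrow> real" where "\<epsilon> k = (if odd k then 1 else - 1)" for k
    define g where "g \<omega> i = (\<Sum>k\<le>?n. of_real (\<epsilon> k) * diffs f k \<omega> i)" for \<omega> i
    define F where "F = (\<integral>\<omega>. nrm X (f ?n \<omega>) powr s \<partial>m_inf) powr (1 / s)"
    have F0: "0 \<le> F" by (simp add: F_def)
    let ?V = "\<lambda>\<omega>. nrm X (\<lambda>i. sel (\<lambda>k. cexp k (\<theta> k) \<omega>) i)"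
    let ?Y = "\<lambda>\<omega>. nrm X (\<lambda>i. sel (\<lambda>k. \<theta> k \<omega>) i)"
    have fmi: "(\<lambda>\<omega>. nrm X (f n \<omega>)) \<in> borel_measurable m_inf" for n
      unfolding f_def[abs_def] by (rule sel_meas) (rule measurable_filt[OF measurable_interleave])
    have AE_f: "AE \<omega> in m_inf. nrm X (f n \<omega>) \<le> ?d * b" for n
      unfolding f_def by (rule AE_sel) (rule AE_interleave_le[OF B(2,3,1)])
    note fi = powr_norm_le_bound(1)[OF s fmi nrm_nonneg[OF X] AE_f]
    have LF: "Lnorm (ennreal s) m_inf (\<lambda>\<omega>. nrm X (f ?n \<omega>)) = ennreal F"
      unfolding F_def by (rule Lnorm_real(2)[OF s fmi fi])
    have bound: "Lnorm (ennreal s) m_inf (\<lambda>\<omega>. nrm X (\<lambda>i. \<Sum>k\<le>?n. of_real (\<delta> k) * diffs f k \<omega> i)) \<le> ennreal (C * F)"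
      if "\<forall>k. \<delta> k = 1 \<or> \<delta> k = - 1" for \<delta> :: "nat \<Rightarrow> real"
    proof -
      have "Lnorm (ennreal s) m_inf (\<lambda>\<omega>. nrm X (\<lambda>i. \<Sum>k\<le>?n. of_real (\<delta> k) * diffs f k \<omega> i))
         \<le> (SUP \<epsilon>\<in>{\<epsilon> :: nat \<Rightarrow> real. \<forall>k. \<epsilon> k = 1 \<or> \<epsilon> k = - 1}.
         Lnorm (ennreal s) m_inf (\<lambda>\<omega>. nrm X (\<lambda>i. \<Sum>k\<le>?n. of_real (\<epsilon> k) * diffs f k \<omega> i)))"
        by (rule SUP_upper) (use that in simp)
      also have "\<dots> \<le> ennreal C * Lnorm (ennreal s) m_inf (\<lambda>\<omega>. nrm X (\<lambda>i. \<Sum>k\<le>?n. diffs f k \<omega> i))"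
        using AUMD H by blast
      also have "\<dots> = ennreal (C * F)" unfolding sum_diffs LF using C F0 by (simp add: ennreal_mult)
      finally show ?thesis .
    qed
    have gm: "(\<lambda>\<omega>. nrm X (g \<omega>)) \<in> borel_measurable m_inf"
    proof (rule meas)
      fix i
      have "(\<lambda>\<omega>. f n \<omega> i) \<in> borel_measurable m_inf" for n
        by (cases "i \<in> \<iota> ` {..N}") (simp_all add: f_def sel_def measurable_filt[OF measurable_interleave])
      then show "(\<lambda>\<omega>. g \<omega> i) \<in> borel_measurable m_inf"
        unfolding g_def sum_signed_diffs transform_def
        by (intro borel_measurable_add borel_measurable_sum borel_measurable_times borel_measurable_diff borel_measurable_const)
    qed
    have Lg: "Lnorm (ennreal s) m_inf (\<lambda>\<omega>. nrm X (g \<omega>)) \<le> ennreal (C * F)"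
      using bound[of \<epsilon>] by (simp add: g_def[abs_def] \<epsilon>_def)
    then have "Lnorm (ennreal s) m_inf (\<lambda>\<omega>. nrm X (g \<omega>)) < \<infinity>" by (rule le_less_trans) simp
    then have gi: "integrable m_inf (\<lambda>\<omega>. nrm X (g \<omega>) powr s)" by (simp only: Lnorm_real(1)[OF s gm])
    have g_le: "(\<integral>\<omega>. nrm X (g \<omega>) powr s \<partial>m_inf) powr (1 / s) \<le> C * F"
      using Lg C F0 by (simp add: Lnorm_real(2)[OF s gm gi] ennreal_le_iff)
    \<comment> \<open>All signs equal to 1 give this. It takes the place of
      \<open>C \<ge> 1\<close>, which does not follow when \<open>F = 0\<close>, and absorbs the
      unsigned sum added in \<open>pointwise\<close>.\<close>
    have F_le: "F \<le> C * F"
    proof -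
      have "Lnorm (ennreal s) m_inf (\<lambda>\<omega>. nrm X (\<lambda>i. \<Sum>k\<le>?n. of_real 1 * diffs f k \<omega> i)) \<le> ennreal (C * F)"
        by (rule bound) simp
      then have "ennreal F \<le> ennreal (C * F)" unfolding of_real_1 mult_1_left sum_diffs LF .
      then show ?thesis using C F0 by (simp add: ennreal_le_iff)
    qed
    have Vm: "?V \<in> borel_measurable m_inf" by (rule sel_meas) (rule measurable_filt[OF measurable_cexp])
    have pointwise: "2 * ?V (evens \<omega>) \<le> nrm X (g \<omega>) + nrm X (f ?n \<omega>)" if \<omega>: "\<omega> \<in> space m_inf" for \<omega>
    proof -
      have "g \<omega> i + f ?n \<omega> i = 2 * sel (\<lambda>j. \<omega> (Suc (2 * j)) * cexp j (\<theta> j) (evens \<omega>)) i" for i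
      proof -
        have "g \<omega> i + f ?n \<omega> i = 2 * (\<Sum>l\<le>N. f (Suc (2 * l)) \<omega> i - f (2 * l) \<omega> i)"
          using interleave_signed_sum[where M = N and f = f and \<omega> = \<omega> and i = i] unfolding sum_diffs g_def \<epsilon>_def .
        also have "(\<Sum>l\<le>N. f (Suc (2 * l)) \<omega> i - f (2 * l) \<omega> i)
           = (if i \<in> \<iota> ` {..N} then (\<Sum>l\<le>N. if l = J i then \<omega> (Suc (2 * J i)) * cexp (J i) (\<theta> (J i)) (evens \<omega>) else 0) else 0)"
          by (simp add: f_def sel_def interleave_odd_diff)
        also have "\<dots> = sel (\<lambda>j. \<omega> (Suc (2 * j)) * cexp j (\<theta> j) (evens \<omega>)) i"
          using J(1)[of i] by (simp add: sel_def)
        finally show ?thesis .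
      qed
      then have "2 * nrm X (\<lambda>i. sel (\<lambda>j. \<omega> (Suc (2 * j)) * cexp j (\<theta> j) (evens \<omega>)) i) = nrm X (\<lambda>i. g \<omega> i + f ?n \<omega> i)"
        using nrm_scale[OF X, of 2] by simp
      also have "\<dots> \<le> nrm X (g \<omega>) + nrm X (f ?n \<omega>)" by (rule nrm_add[OF X])
      also have "nrm X (\<lambda>i. sel (\<lambda>j. \<omega> (Suc (2 * j)) * cexp j (\<theta> j) (evens \<omega>)) i) = ?V (evens \<omega>)"
        by (rule nrm_cong[OF X]) (simp add: sel_def norm_mult cmod_component[OF \<omega>])
      finally show ?thesis .
    qed
    have AE_V: "AE \<omega> in m_inf. ?V \<omega> \<le> ?d * b"
      by (rule AE_sel) (rule AE_norm_cexp_le[OF B(2,3)])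
    have iV: "integrable m_inf ?V"
      by (rule integrable_m_inf_bounded[OF Vm]) (use AE_V in \<open>simp add: nrm_nonneg[OF X]\<close>)
    have L1: "(\<integral>\<omega>. ?V \<omega> \<partial>m_inf) \<le> C * F"
    proof -
      have ie: "integrable m_inf (\<lambda>\<omega>. ?V (evens \<omega>))"
        by (rule integrable_m_inf_bounded[OF measurable_compose[OF measurable_evens Vm]])
          (use AE_evens[OF AE_V] in \<open>simp add: nrm_nonneg[OF X]\<close>)
      note g1 = integral_le_powr_norm[OF s gm nrm_nonneg[OF X] gi]
      note f1 = integral_le_powr_norm[OF s fmi nrm_nonneg[OF X] fi, of ?n]
      have "2 * (\<integral>\<omega>. ?V \<omega> \<partial>m_inf) = (\<integral>\<omega>. 2 * ?V (evens \<omega>) \<partial>m_inf)"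
        using integral_evens[OF Vm] by simp
      also have "\<dots> \<le> (\<integral>\<omega>. nrm X (g \<omega>) + nrm X (f ?n \<omega>) \<partial>m_inf)"
        using ie g1(1) f1(1) by (intro integral_mono pointwise) auto
      also have "\<dots> = (\<integral>\<omega>. nrm X (g \<omega>) \<partial>m_inf) + (\<integral>\<omega>. nrm X (f ?n \<omega>) \<partial>m_inf)"
        using g1(1) f1(1) by simp
      also have "\<dots> \<le> C * F + F" using g1(2) f1(2) g_le by (simp add: F_def)
      finally show ?thesis using F_le by simp
    qed
    let ?E = "esssup m_inf (\<lambda>\<omega>. ennreal (?Y \<omega>))"
    have Ym: "?Y \<in> borel_measurable m_inf" by (rule sel_meas[OF B(2)])
    have AE_Yb: "AE \<omega> in m_inf. ?Y \<omega> \<le> ?d * b" by (rule AE_sel) (rule B(3))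
    have "?E \<le> ennreal (?d * b)"
    proof (rule esssup_I)
      show "AE \<omega> in m_inf. ennreal (?Y \<omega>) \<le> ennreal (?d * b)"
        using AE_Yb by eventually_elim (rule ennreal_leI)
    qed (use Ym in simp)
    then have Efin: "?E < \<infinity>" by (rule le_less_trans) simp
    define M where "M = enn2real ?E"
    have EM: "?E = ennreal M" using Efin by (simp add: M_def ennreal_enn2real_if)
    have M0: "0 \<le> M" by (simp add: M_def)
    have AE_Y: "AE \<omega> in m_inf. ?Y \<omega> \<le> M"
      using esssup_AE[of "\<lambda>\<omega>. ennreal (?Y \<omega>)" m_inf] unfolding EM
      by eventually_elim (use M0 in \<open>simp add: ennreal_le_iff\<close>)
    \<comment> \<open>Up to unimodular factors the martingale at time \<open>2 * N + 1\<close> is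
      \<open>E_N(\<theta>_k)\<close> in the even coordinates, and conditional expectation does not
      increase the norm by \<open>nrm_integral_le\<close>.\<close>
    have F_M: "F \<le> M"
    proof -
      have \<theta>i: "integrable m_inf (\<theta> k)" if "k \<le> N" for k
        by (rule integrable_m_inf_bounded[OF B(2)[OF that] B(3)[OF that]])
      have "AE \<omega> in m_inf. \<forall>k\<in>{..N}. cexp N (\<theta> k) \<omega> = (\<integral>\<omega>'. \<theta> k (mix {1..N} \<omega> \<omega>') \<partial>m_inf) \<and> integrable m_inf (\<lambda>\<omega>'. \<theta> k (mix {1..N} \<omega> \<omega>'))"
        using cexp_filt[OF \<theta>i] integral_mix(3)[OF \<theta>i] by (intro AE_finite_allI eventually_conj) auto
      then have "AE \<omega> in m_inf. nrm X (\<lambda>i. sel (\<lambda>k. cexp N (\<theta> k) \<omega>) i) \<le> M"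
        using AE_mix[OF AE_Y, of "{1..N}"] AE_space
      proof eventually_elim
        case (elim \<omega>)
        let ?S = "\<lambda>\<omega>' i. sel (\<lambda>k. \<theta> k (mix {1..N} \<omega> \<omega>')) i"
        have mS: "(\<lambda>\<omega>'. nrm X (?S \<omega>')) \<in> borel_measurable m_inf"
          using measurable_compose[OF measurable_mix_slice[OF elim(3)] Ym] by simp
        have iS: "integrable m_inf (\<lambda>\<omega>'. ?S \<omega>' i)" for i
          using elim(1) J(1)[of i] by (cases "i \<in> \<iota> ` {..N}") (simp_all add: sel_def)
        have "sel (\<lambda>k. cexp N (\<theta> k) \<omega>) i = (\<integral>\<omega>'. ?S \<omega>' i \<partial>m_inf)" for i
          using elim(1) J(1)[of i] by (cases "i \<in> \<iota> ` {..N}") (simp_all add: sel_def)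
        then have "nrm X (\<lambda>i. sel (\<lambda>k. cexp N (\<theta> k) \<omega>) i) = nrm X (\<lambda>i. \<integral>\<omega>'. ?S \<omega>' i \<partial>m_inf)" by simp
        also have "\<dots> \<le> (\<integral>\<omega>'. nrm X (?S \<omega>') \<partial>m_inf)" by (rule nrm_integral_le[OF X iS mS])
        also have "\<dots> \<le> (\<integral>\<omega>'. M \<partial>m_inf)"
        proof (rule integral_mono_AE)
          show "integrable m_inf (\<lambda>\<omega>'. nrm X (?S \<omega>'))"
            by (rule integrable_m_inf_bounded[OF mS, of M]) (use elim(2) in \<open>simp add: nrm_nonneg[OF X]\<close>)
        qed (use elim(2) prob_space_m_inf in \<open>auto intro!: finite_measure.integrable_const prob_space.finite_measure\<close>)
        finally show ?case using measure_m_inf_space by simp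
      qed
      from AE_evens[OF this] have "AE \<omega> in m_inf. nrm X (f ?n \<omega>) \<le> M"
        using AE_space
      proof eventually_elim
        case (elim \<omega>)
        have "cmod (f ?n \<omega> i) = cmod (sel (\<lambda>k. cexp N (\<theta> k) (evens \<omega>)) i)" for i
          using J(1)[of i] by (simp add: f_def sel_def interleave_def norm_mult cmod_component[OF elim(2)])
        then have "nrm X (f ?n \<omega>) = nrm X (\<lambda>i. sel (\<lambda>k. cexp N (\<theta> k) (evens \<omega>)) i)"
          by (intro nrm_cong[OF X]) simp
        then show ?case using elim(1) by simp
      qed
      from powr_norm_le_bound(2)[OF s fmi nrm_nonneg[OF X] this] show ?thesis by (simp add: F_def)
    qed
    have "Lnorm 1 m_inf ?V = ennreal (\<integral>\<omega>. ?V \<omega> \<partial>m_inf)"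
      using Lnorm_real(2)[of 1 ?V m_inf] Vm iV by (simp add: nrm_nonneg[OF X] Bochner_Integration.integral_nonneg)
    also have "\<dots> \<le> ennreal (C * M)"
      using L1 F_M C by (intro ennreal_leI) (meson mult_left_mono order_trans)
    also have "\<dots> = ennreal C * Lnorm \<infinity> m_inf ?Y"
      using C M0 by (simp add: Lnorm_def EM ennreal_mult)
    finally show "Lnorm 1 m_inf (\<lambda>\<omega>. nrm X (\<lambda>i. \<Sum>k\<le>N. cexp k (\<theta> k) \<omega> * basis_vec (\<iota> k) i))
      \<le> ennreal C * Lnorm \<infinity> m_inf (\<lambda>\<omega>. nrm X (\<lambda>i. \<Sum>k\<le>N. \<theta> k \<omega> * basis_vec (\<iota> k) i))"
      unfolding sel_sum .
  qed
qed

section \<open>Outer functions of two-valued modulus\<close>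

text \<open>\<open>(1 + z) / (1 - z)\<close> maps the disc to the right half-plane and the upper and
  lower half circles to the two halves of the imaginary axis, so the real part of
  \<open>half_arg\<close> is 1 and -1 there and lies strictly between on the disc. Since
  \<open>half_arg\<close> vanishes at 0, \<open>outer l\<close> is bounded on the disc with value 1
  at the centre.\<close>

definition half_arg :: "complex \<Rightarrow> complex" where
  "half_arg z = - \<i> * (2 / pi) * Ln ((1 + z) / (1 - z))"

definition outer :: "real \<Rightarrow> complex \<Rightarrow> complex" where
  "outer l z = exp (of_real l * half_arg z)"

lemma Re_half_arg: "Re (half_arg z) = 2 / pi * Im (Ln ((1 + z) / (1 - z)))"
  by (simp add: half_arg_def)

lemma cmod_outer: "cmod (outer l z) = exp (l * (2 / pi * Im (Ln ((1 + z) / (1 - z)))))"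
  by (simp add: outer_def norm_exp_eq_Re Re_half_arg)

lemma cayley_boundary:
  assumes t: "cmod t = 1" "Im t \<noteq> 0"
  shows "(1 + t) / (1 - t) = \<i> * of_real (2 * Im t / (cmod (1 - t))\<^sup>2)" "1 - t \<noteq> 0"
proof -
  show n: "1 - t \<noteq> 0" using t by auto
  have "(1 + t) / (1 - t) = ((1 + t) * cnj (1 - t)) / of_real ((cmod (1 - t))\<^sup>2)"
    by (rule complex_div_cnj)
  also have "(1 + t) * cnj (1 - t) = t - cnj t"
    using complex_norm_square[of t] t by (simp add: algebra_simps)
  also have "t - cnj t = \<i> * of_real (2 * Im t)" by (simp add: complex_eq_iff)
  finally show "(1 + t) / (1 - t) = \<i> * of_real (2 * Im t / (cmod (1 - t))\<^sup>2)" by simp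
qed

lemma cmod_outer_boundary:
  assumes t: "cmod t = 1" "Im t \<noteq> 0"
  shows "cmod (outer l t) = exp (if 0 < Im t then l else - l)"
proof -
  define r where "r = 2 * Im t / (cmod (1 - t))\<^sup>2"
  have w: "(1 + t) / (1 - t) = \<i> * of_real r" using cayley_boundary[OF t] by (simp add: r_def)
  have "0 < (cmod (1 - t))\<^sup>2" using cayley_boundary(2)[OF t] by simp
  then have r: "0 < r \<longleftrightarrow> 0 < Im t" "r \<noteq> 0" using t(2) by (auto simp: r_def zero_less_divide_iff)
  have "Im (Ln (\<i> * of_real r)) = (if 0 < Im t then pi / 2 else - (pi / 2))"
    using r Im_Ln_eq_pi_half[of "\<i> * of_real r"] by (cases "0 < Im t") (auto simp: Im_Ln_eq_pi_half not_less)
  then show ?thesis unfolding cmod_outer w by (simp split: if_splits)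
qed

lemma Re_cayley_pos: "cmod z < 1 \<Longrightarrow> 0 < Re ((1 + z) / (1 - z))"
proof -
  assume z: "cmod z < 1"
  then have n: "1 - z \<noteq> 0" by auto
  have z2: "(cmod z)\<^sup>2 < 1" using z by (simp add: power_less_one_iff abs_square_less_1)
  have "(1 + z) / (1 - z) = ((1 + z) * cnj (1 - z)) / of_real ((cmod (1 - z))\<^sup>2)"
    by (rule complex_div_cnj)
  then have "Re ((1 + z) / (1 - z)) = Re ((1 + z) * cnj (1 - z)) / (cmod (1 - z))\<^sup>2"
    by (simp only: Re_divide_of_real)
  also have "Re ((1 + z) * cnj (1 - z)) = 1 - (cmod z)\<^sup>2"
    unfolding cmod_power2 by (simp add: algebra_simps power2_eq_square)
  finally show ?thesis using z2 n by simp
qed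

lemma cmod_outer_le:
  assumes "cmod z < 1" shows "cmod (outer l z) \<le> exp \<bar>l\<bar>"
proof -
  have "\<bar>Im (Ln ((1 + z) / (1 - z)))\<bar> < pi / 2" by (rule Re_Ln_pos_lt_imp[OF Re_cayley_pos[OF assms]])
  then have "\<bar>l * (2 / pi * Im (Ln ((1 + z) / (1 - z))))\<bar> \<le> \<bar>l\<bar> * 1"
    unfolding abs_mult by (intro mult_left_mono) (auto simp: field_simps)
  then have "l * (2 / pi * Im (Ln ((1 + z) / (1 - z)))) \<le> \<bar>l\<bar> * 1" by (rule order_trans[OF abs_ge_self])
  then show ?thesis unfolding cmod_outer by (simp only: exp_le_cancel_iff mult_1_right)
qed

lemma outer_0: "outer l 0 = 1"
  by (simp add: outer_def half_arg_def)

lemma isCont_outer: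
  fixes z :: complex
  assumes "1 - z \<noteq> 0" "(1 + z) / (1 - z) \<notin> \<real>\<^sub>\<le>\<^sub>0"
  shows "isCont (outer l) z"
  unfolding outer_def half_arg_def using assms by (intro continuous_intros) auto

lemma holomorphic_outer: "outer l holomorphic_on ball 0 1"
proof -
  have "(1 + z) / (1 - z) \<notin> \<real>\<^sub>\<le>\<^sub>0" "1 - z \<noteq> 0" if "z \<in> ball 0 1" for z :: complex
    using Re_cayley_pos[of z] that by (auto simp: complex_nonpos_Reals_iff)
  then show ?thesis unfolding outer_def half_arg_def by (intro holomorphic_intros) auto
qed

text \<open>Cauchy's integral formula at the centre, with \<open>circlepath\<close> reparametrised
  by the angle.\<close>

lemma integral_circ_holomorphic:
  assumes f: "f holomorphic_on ball 0 R" and R: "1 < R"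
  shows "(\<integral>t. f t \<partial>circ) = f 0"
proof -
  have cont: "continuous_on (sphere 0 1) f" "continuous_on (cball 0 1) f"
    using R holomorphic_on_imp_continuous_on[OF f] by (auto elim!: continuous_on_subset)
  have "(\<integral>t. f t \<partial>circ) = integral {0..2 * pi} (\<lambda>\<theta>. f (cis \<theta>)) /\<^sub>R (2 * pi)"
    by (rule integral_circ_continuous[OF cont(1)])
  moreover have "((\<lambda>\<theta>. f (cis \<theta>)) has_integral (2 * pi) *\<^sub>R f 0) {0..2 * pi}"
  proof -
    have "((\<lambda>u. f u / (u - 0)) has_contour_integral (2 * of_real pi * \<i> * f 0)) (circlepath 0 1)"
      by (rule Cauchy_integral_circlepath[OF cont(2)])
        (use R in \<open>auto intro: holomorphic_on_subset[OF f]\<close>)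
    then have "((\<lambda>x. f (circlepath 0 1 x) / (circlepath 0 1 x - 0) * vector_derivative (circlepath 0 1) (at x within {0..1}))
        has_integral (2 * of_real pi * \<i> * f 0)) {0..1}"
      unfolding has_contour_integral_def .
    then have "((\<lambda>x. (2 * of_real pi * \<i>) * f (exp (2 * of_real pi * \<i> * of_real x))) has_integral (2 * of_real pi * \<i> * f 0)) {0..1}"
      by (rule has_integral_eq[rotated]) (simp add: vector_derivative_circlepath01, simp add: circlepath)
    then have "((\<lambda>x. inverse (2 * of_real pi * \<i>) * ((2 * of_real pi * \<i>) * f (exp (2 * of_real pi * \<i> * of_real x)))) has_integral
        inverse (2 * of_real pi * \<i>) * (2 * of_real pi * \<i> * f 0)) {0..1}"
      by (rule has_integral_mult_right)
    then have "((\<lambda>x. f (exp (2 * of_real pi * \<i> * of_real x))) has_integral f 0) (cbox 0 1)"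
      by (simp add: field_simps)
    from has_integral_affinity[OF this, of "1 / (2 * pi)" 0]
    have "((\<lambda>x. f (exp (\<i> * of_real x))) has_integral (2 * pi) *\<^sub>R f 0) ((\<lambda>x. x * (2 * pi)) ` {0..1})"
      by (simp add: mult_ac)
    moreover have "(\<lambda>x. x * (2 * pi)) ` {0..1 :: real} = {0..2 * pi}"
      using image_mult_atLeastAtMost[of "2 * pi" 0 1] by (simp add: mult.commute)
    ultimately show ?thesis by (simp add: cis_conv_exp)
  qed
  ultimately show ?thesis by (simp add: integral_unique)
qed

lemma AE_circ_Im_nonzero: "AE t in circ. Im t \<noteq> 0"
proof -
  have *: "AE \<theta> in uniform_measure lborel {0..2 * pi}. Im (cis \<theta>) \<noteq> 0"
  proof -
    have "AE \<theta> in lborel. \<theta> \<notin> {0, pi, 2 * pi :: real}"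
      by (rule AE_not_in) (auto intro!: finite_imp_null_set_lborel)
    then have "AE \<theta> in lborel. \<theta> \<in> {0..2 * pi} \<longrightarrow> Im (cis \<theta>) \<noteq> 0"
    proof eventually_elim
      case (elim \<theta>)
      show ?case
      proof
        assume \<theta>: "\<theta> \<in> {0..2 * pi}"
        show "Im (cis \<theta>) \<noteq> 0"
        proof (cases "\<theta> < pi")
          case True
          then show ?thesis using \<theta> elim sin_gt_zero[of \<theta>] by auto
        next
          case False
          then show ?thesis using \<theta> elim sin_lt_zero[of \<theta>] by auto
        qed
      qed
    qed
    then show ?thesis by (intro AE_uniform_measureI) auto
  qed
  have "{t \<in> space (restrict_space borel (sphere 0 1)). Im t \<noteq> 0} \<in> sets (restrict_space borel (sphere 0 1))"
  proof -
    have "{t. Im t \<noteq> 0} \<in> sets borel" by (intro borel_open open_Collect_neq continuous_intros)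
    moreover have "{t \<in> space (restrict_space borel (sphere 0 1)). Im t \<noteq> 0} = sphere 0 1 \<inter> {t. Im t \<noteq> 0}"
      by (auto simp: space_restrict_space)
    ultimately show ?thesis by (auto simp: sets_restrict_space)
  qed
  then show ?thesis
    unfolding circ_def by (subst AE_distr_iff) (use * in auto)
qed

text \<open>Boundary values of bounded analytic functions on the disc. The bound is demanded at
  every point of the circle, so that products over coordinates are bounded everywhere on the
  torus.\<close>

definition boundary_fun :: "(complex \<Rightarrow> complex) \<Rightarrow> bool" where
  "boundary_fun \<phi> \<longleftrightarrow> \<phi> \<in> borel_measurable circ \<and> (\<exists>B. \<forall>t. cmod t = 1 \<longrightarrow> cmod (\<phi> t) \<le> B) \<and> (\<forall>k<0. fourier_coeff \<phi> k = 0)"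

lemma outer_borel: "outer l \<in> borel_measurable borel"
proof -
  have "half_arg \<in> borel_measurable borel"
    unfolding half_arg_def by measurable
  then show ?thesis unfolding outer_def[abs_def]
    by (intro measurable_compose[OF _ borel_measurable_continuous_onI[of exp]]) (auto intro!: continuous_intros)
qed

text \<open>At 1 and -1 the Cayley quotient degenerates and \<open>outer\<close> takes default
  values (division by zero, \<open>Ln 0\<close>); the bound includes these two values
  explicitly.\<close>

lemma cmod_outer_sphere_le:
  assumes t: "cmod t = 1"
  shows "cmod (outer l t) \<le> exp \<bar>l\<bar> + cmod (outer l 1) + cmod (outer l (- 1))"
proof (cases "Im t = 0")
  case True
  then have "t = of_real (Re t)" "\<bar>Re t\<bar> = 1" using t by (auto simp: complex_eq_iff cmod_eq_Re)
  then have "t = 1 \<or> t = - 1" by (metis abs_eq_iff' of_real_1 of_real_minus abs_minus_cancel)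
  then show ?thesis by (auto simp: add_increasing)
next
  case False
  have "exp (if 0 < Im t then l else - l) \<le> exp \<bar>l\<bar>" by (simp add: abs_ge_self abs_ge_minus_self)
  then show ?thesis unfolding cmod_outer_boundary[OF t False] by (meson add_increasing2 norm_ge_zero)
qed

text \<open>On the circle \<open>outer l\<close> need not be continuous at 1 and -1, so Cauchy's
  formula is applied to its dilations, which are holomorphic beyond the closed disc;
  \<open>cmod_outer_le\<close> allows dominated convergence back to the circle.\<close>

lemma fourier_coeff_outer:
  assumes "k \<le> 0" shows "fourier_coeff (outer l) k = (if k = 0 then 1 else 0)"
proof -
  define j where "j = nat (- k)"
  have k: "- k = int j" using assms by (simp add: j_def)
  define r where "r n = 1 - 1 / (real n + 2)" for n
  have r: "0 < r n" "r n < 1" for n by (auto simp: r_def field_simps)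
  have r_lim: "r \<longlonglongrightarrow> 1" unfolding r_def by real_asymp
  have "(\<lambda>n. \<integral>t. outer l (of_real (r n) * t) * t ^ j \<partial>circ) \<longlonglongrightarrow> (\<integral>t. outer l t * t ^ j \<partial>circ)"
  proof (rule integral_dominated_convergence[where w = "\<lambda>_. exp \<bar>l\<bar>"])
    have m: "(\<lambda>t. t ^ j) \<in> borel_measurable circ" "(\<lambda>t. of_real a * t) \<in> borel_measurable circ" for a :: real
      by (intro continuous_borel_circ continuous_intros)+
    show "(\<lambda>t. outer l t * t ^ j) \<in> borel_measurable circ"
      using measurable_compose[OF id_borel_circ outer_borel] m by auto
    show "(\<lambda>t. outer l (of_real (r n) * t) * t ^ j) \<in> borel_measurable circ" for n
      using measurable_compose[OF m(2) outer_borel] m by auto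
    show "AE t in circ. (\<lambda>n. outer l (of_real (r n) * t) * t ^ j) \<longlonglongrightarrow> outer l t * t ^ j"
      using AE_circ_Im_nonzero AE_space
    proof eventually_elim
      case (elim t)
      then have t: "cmod t = 1" by simp
      have "(1 + t) / (1 - t) \<notin> \<real>\<^sub>\<le>\<^sub>0"
      proof -
        have "0 < (cmod (1 - t))\<^sup>2" using cayley_boundary(2)[OF t elim(1)] by simp
        then show ?thesis
          unfolding cayley_boundary(1)[OF t elim(1)] using elim(1) by (auto simp: complex_nonpos_Reals_iff)
      qed
      then have "isCont (outer l) t" by (rule isCont_outer[OF cayley_boundary(2)[OF t elim(1)]])
      moreover have "(\<lambda>n. of_real (r n) * t) \<longlonglongrightarrow> of_real 1 * t"
        by (intro tendsto_intros r_lim)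
      ultimately have "(\<lambda>n. outer l (of_real (r n) * t)) \<longlonglongrightarrow> outer l t"
        by (intro isCont_tendsto_compose[of t "outer l"]) simp_all
      then show ?case by (intro tendsto_intros)
    qed
    show "AE t in circ. norm (outer l (of_real (r n) * t) * t ^ j) \<le> exp \<bar>l\<bar>" for n
    proof (rule AE_I2)
      fix t assume "t \<in> space circ"
      then have "cmod t = 1" by simp
      then show "norm (outer l (of_real (r n) * t) * t ^ j) \<le> exp \<bar>l\<bar>"
        using cmod_outer_le[of "of_real (r n) * t" l] r[of n] by (simp add: norm_mult norm_power)
    qed
  qed simp
  moreover have "(\<integral>t. outer l (of_real (r n) * t) * t ^ j \<partial>circ) = (if j = 0 then 1 else 0)" for n
  proof -
    have "(\<lambda>t. outer l (of_real (r n) * t) * t ^ j) holomorphic_on ball 0 (1 / r n)"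
    proof (intro holomorphic_intros holomorphic_on_compose_gen[OF _ holomorphic_outer, unfolded o_def])
      show "(\<lambda>t :: complex. of_real (r n) * t) ` ball 0 (1 / r n) \<subseteq> ball 0 1"
        using r[of n] by (auto simp: norm_mult field_simps)
    qed
    from integral_circ_holomorphic[OF this] r[of n] show ?thesis by (simp add: outer_0 power_0_left)
  qed
  ultimately have "(\<lambda>n :: nat. if j = 0 then 1 else 0) \<longlonglongrightarrow> (\<integral>t. outer l t * t ^ j \<partial>circ)"
    by (simp only:)
  from LIMSEQ_unique[OF this tendsto_const]
  have "(\<integral>t. outer l t * t ^ j \<partial>circ) = (if j = 0 then 1 else 0)" .
  moreover have "j = 0 \<longleftrightarrow> k = 0" using assms by (auto simp: j_def)
  ultimately show ?thesis unfolding fourier_coeff_def k power_int_of_nat by simp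
qed

text \<open>The parameter \<open>l = ln (x / y) / 2\<close> is chosen so that
  \<open>sqrt (x * y) * exp l = x\<close> and \<open>sqrt (x * y) * exp (- l) = y\<close>. As
  \<open>outer l\<close> has mean 1, the mean is the geometric mean of the two moduli.\<close>

definition two_valued :: "real \<Rightarrow> real \<Rightarrow> complex \<Rightarrow> complex" where
  "two_valued x y t = of_real (sqrt (x * y)) * outer (ln (x / y) / 2) t"

lemma cmod_two_valued:
  assumes xy: "0 < x" "0 < y" and t: "cmod t = 1" "Im t \<noteq> 0"
  shows "cmod (two_valued x y t) = (if 0 < Im t then x else y)"
proof -
  have e: "exp (ln (x / y) / 2) = sqrt (x / y)" "exp (- (ln (x / y) / 2)) = sqrt (y / x)"
    using xy by (simp_all add: ln_sqrt[symmetric] exp_minus real_sqrt_divide inverse_eq_divide)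
  have "sqrt (x * y) * sqrt (x / y) = x" "sqrt (x * y) * sqrt (y / x) = y"
    using xy by (simp_all add: real_sqrt_mult[symmetric])
  then show ?thesis
    using xy e by (simp add: two_valued_def norm_mult cmod_outer_boundary[OF t])
qed

lemma fourier_coeff_two_valued: "k \<le> 0 \<Longrightarrow> fourier_coeff (two_valued x y) k = (if k = 0 then of_real (sqrt (x * y)) else 0)"
  unfolding two_valued_def[abs_def] by (simp add: fourier_coeff_cmult fourier_coeff_outer)

lemma boundary_fun_two_valued: "boundary_fun (two_valued x y)"
  unfolding boundary_fun_def
proof (intro conjI exI allI impI)
  show "two_valued x y \<in> borel_measurable circ"
    unfolding two_valued_def[abs_def] using measurable_compose[OF id_borel_circ outer_borel] by auto
  fix t :: complex assume t: "cmod t = 1"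
  let ?l = "ln (x / y) / 2"
  show "cmod (two_valued x y t) \<le> \<bar>sqrt (x * y)\<bar> * (exp \<bar>?l\<bar> + cmod (outer ?l 1) + cmod (outer ?l (- 1)))"
    unfolding two_valued_def norm_mult norm_of_real by (intro mult_left_mono cmod_outer_sphere_le t) simp
qed (simp add: fourier_coeff_two_valued)

lemma boundary_fun_one: "boundary_fun (\<lambda>_. 1)"
proof -
  have "fourier_coeff (\<lambda>_. 1) k = (if k = 0 then 1 else 0)" for k using fourier_coeff_powi[of 0 k] by simp
  then show ?thesis by (auto simp: boundary_fun_def)
qed

section \<open>Products of boundary functions\<close>

definition coord_prod :: "nat \<Rightarrow> (nat \<Rightarrow> complex \<Rightarrow> complex) \<Rightarrow> torus \<Rightarrow> complex" where
  "coord_prod M \<phi> \<omega> = (\<Prod>v\<in>{1..M}. \<phi> v (\<omega> v))"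

text \<open>Conditional expectation at time \<open>n\<close> acts on a product over coordinates
  factor by factor, and unseen coordinates contribute their means.\<close>

definition truncated :: "nat \<Rightarrow> (nat \<Rightarrow> complex \<Rightarrow> complex) \<Rightarrow> nat \<Rightarrow> complex \<Rightarrow> complex" where
  "truncated n \<phi> v t = (if v \<le> n then \<phi> v t else fourier_coeff (\<phi> v) 0)"

definition bounded_measurable :: "(complex \<Rightarrow> complex) \<Rightarrow> bool" where
  "bounded_measurable \<phi> \<longleftrightarrow> \<phi> \<in> borel_measurable circ \<and> (\<exists>B. \<forall>t. cmod t = 1 \<longrightarrow> cmod (\<phi> t) \<le> B)"

lemma boundary_fun_iff: "boundary_fun \<phi> \<longleftrightarrow> bounded_measurable \<phi> \<and> (\<forall>k<0. fourier_coeff \<phi> k = 0)"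
  by (auto simp: boundary_fun_def bounded_measurable_def)

lemma bounded_measurable_const: "bounded_measurable (\<lambda>_. c)"
  by (auto simp: bounded_measurable_def)

lemma fourier_coeff_0: "fourier_coeff \<phi> 0 = (\<integral>t. \<phi> t \<partial>circ)"
  by (simp add: fourier_coeff_def)

context
  fixes \<phi> :: "nat \<Rightarrow> complex \<Rightarrow> complex"
  assumes \<phi>: "\<And>v. bounded_measurable (\<phi> v)"
begin

lemma measurable_coord_prod: "coord_prod M \<phi> \<in> borel_measurable m_inf"
  unfolding coord_prod_def
  by (intro borel_measurable_prod measurable_compose[OF measurable_component_m_inf])
    (use \<phi> in \<open>auto simp: bounded_measurable_def\<close>)

lemma coord_prod_bounded: "\<exists>B. 0 \<le> B \<and> (\<forall>\<omega>\<in>space m_inf. cmod (coord_prod M \<phi> \<omega>) \<le> B)"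
proof -
  obtain B where B: "\<And>v t. cmod t = 1 \<Longrightarrow> cmod (\<phi> v t) \<le> B v"
    using \<phi> unfolding bounded_measurable_def by metis
  have "cmod (coord_prod M \<phi> \<omega>) \<le> (\<Prod>v\<in>{1..M}. \<bar>B v\<bar>)" if \<omega>: "\<omega> \<in> space m_inf" for \<omega>
    unfolding coord_prod_def prod_norm[symmetric]
    by (intro prod_mono conjI norm_ge_zero order_trans[OF B abs_ge_self] cmod_component[OF \<omega>]) auto
  then show ?thesis by (intro exI[of _ "\<Prod>v\<in>{1..M}. \<bar>B v\<bar>"]) (auto intro: prod_nonneg)
qed

lemma integrable_coord_prod: "integrable m_inf (coord_prod M \<phi>)"
proof -
  obtain B where B: "0 \<le> B \<and> (\<forall>\<omega>\<in>space m_inf. cmod (coord_prod M \<phi> \<omega>) \<le> B)" using coord_prod_bounded by blast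
  then show ?thesis by (intro integrable_m_inf_bounded[OF measurable_coord_prod, of _ B] AE_I2) blast
qed

lemma integral_coord_prod: "(\<integral>\<omega>. coord_prod M \<phi> \<omega> \<partial>m_inf) = (\<Prod>v\<in>{1..M}. fourier_coeff (\<phi> v) 0)"
proof (induction M)
  case 0
  show ?case using measure_m_inf_space by (simp add: coord_prod_def)
next
  case (Suc M)
  have S: "{1..Suc M} = insert (Suc M) {1..M}" by auto
  have 1: "1 \<le> Suc M" by simp
  have upd: "coord_prod (Suc M) \<phi> (fun_upd \<omega> (Suc M) t) = \<phi> (Suc M) t * coord_prod M \<phi> \<omega>" for \<omega> t
    unfolding coord_prod_def S by (subst prod.insert) (auto intro!: prod.cong)
  have "(\<integral>\<omega>. coord_prod (Suc M) \<phi> \<omega> \<partial>m_inf) = (\<integral>\<omega>. (\<integral>t. coord_prod (Suc M) \<phi> (fun_upd \<omega> (Suc M) t) \<partial>circ) \<partial>m_inf)"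
    by (rule integral_upd(2)[OF 1 integrable_coord_prod, symmetric])
  also have "\<dots> = (\<integral>\<omega>. fourier_coeff (\<phi> (Suc M)) 0 * coord_prod M \<phi> \<omega> \<partial>m_inf)"
    by (simp add: upd fourier_coeff_0)
  also have "\<dots> = fourier_coeff (\<phi> (Suc M)) 0 * (\<integral>\<omega>. coord_prod M \<phi> \<omega> \<partial>m_inf)"
    by (rule integral_mult_right_zero)
  finally show ?case unfolding Suc.IH S by (subst prod.insert) auto
qed

end

lemma fourier_coeff_const: "fourier_coeff (\<lambda>_. c) k = (if k = 0 then c else 0)"
  using fourier_coeff_cmult[of c "\<lambda>t. t powi 0" k] fourier_coeff_powi[of 0 k] by simp

text \<open>With the first \<open>n\<close> coordinates fixed, the integral over the others is that
  of another product, whose factors at the seen coordinates are constants;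
  \<open>integral_coord_prod\<close> evaluates it.\<close>

lemma cexp_coord_prod:
  assumes \<phi>: "\<And>v. bounded_measurable (\<phi> v)"
  shows "AE \<omega> in m_inf. cexp n (coord_prod M \<phi>) \<omega> = coord_prod M (truncated n \<phi>) \<omega>"
  using cexp_filt[OF integrable_coord_prod[of \<phi>, OF \<phi>], of n M]
proof eventually_elim
  case (elim \<omega>)
  define \<psi> where "\<psi> v t = (if v \<le> n then \<phi> v (\<omega> v) else \<phi> v t)" for v t
  have \<psi>: "bounded_measurable (\<psi> v)" for v
    using \<phi>[of v] bounded_measurable_const by (cases "v \<le> n") (simp_all add: \<psi>_def[abs_def])
  have "coord_prod M \<phi> (mix {1..n} \<omega> \<omega>') = coord_prod M \<psi> \<omega>'" for \<omega>'
    unfolding coord_prod_def by (intro prod.cong) (auto simp: mix_def \<psi>_def)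
  then have "cexp n (coord_prod M \<phi>) \<omega> = (\<Prod>v\<in>{1..M}. fourier_coeff (\<psi> v) 0)"
    unfolding elim by (simp add: integral_coord_prod[of \<psi>, OF \<psi>])
  also have "\<dots> = coord_prod M (truncated n \<phi>) \<omega>"
    unfolding coord_prod_def
    by (intro prod.cong) (auto simp: truncated_def \<psi>_def[abs_def] fourier_coeff_const)
  finally show ?case .
qed

lemma cexp_tower:
  assumes f: "integrable m_inf f" and mn: "m \<le> n"
  shows "AE \<omega> in m_inf. cexp m (cexp n f) \<omega> = cexp m f \<omega>"
proof -
  interpret F: finite_measure_subalgebra m_inf "filt m" by unfold_locales (rule subalgebra_filt)
  note nested = F.real_cond_exp_nested_subalg[OF subalgebra_filt subalgebra_filt_mono[OF mn]]
  from nested[OF integrable_Re[OF f]] nested[OF integrable_Im[OF f]] show ?thesis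
    by eventually_elim (simp add: cexp_def)
qed

text \<open>The \<open>n\<close>-th difference of the martingale is \<open>\<phi> n\<close> minus
  its mean, times a factor independent of coordinate \<open>n\<close>; subtracting the mean removes
  the coefficient with index 0.\<close>

lemma hardy_space_coord_prod:
  assumes \<phi>: "\<And>v. boundary_fun (\<phi> v)"
  shows "coord_prod M \<phi> \<in> hardy_space \<infinity>"
proof -
  have bm: "bounded_measurable (\<phi> v)" for v using \<phi> boundary_fun_iff by blast
  let ?f = "coord_prod M \<phi>"
  have f: "?f \<in> borel_measurable m_inf" by (rule measurable_coord_prod[of \<phi>, OF bm])
  have fi: "integrable m_inf ?f" by (rule integrable_coord_prod[of \<phi>, OF bm])
  obtain B where B: "0 \<le> B" "\<And>\<omega>. \<omega> \<in> space m_inf \<Longrightarrow> cmod (?f \<omega>) \<le> B"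
    using coord_prod_bounded[of \<phi> M, OF bm] by blast
  have AE_f: "AE \<omega> in m_inf. cmod (?f \<omega>) \<le> B" by (rule AE_I2) (rule B(2))
  have Linf: "Lnorm \<infinity> m_inf (\<lambda>\<omega>. cmod (g \<omega>)) \<le> ennreal B"
    if "g \<in> borel_measurable m_inf" "AE \<omega> in m_inf. cmod (g \<omega>) \<le> B" for g :: "torus \<Rightarrow> complex"
  proof -
    have "AE \<omega> in m_inf. ennreal (cmod (g \<omega>)) \<le> ennreal B"
      using that(2) by eventually_elim (rule ennreal_leI)
    then show ?thesis unfolding Lnorm_def using that(1) by (simp add: esssup_I)
  qed
  have "hardy_martingale \<infinity> scalars (\<lambda>n \<omega> _. cexp n ?f \<omega>)"
    unfolding hardy_martingale_def
  proof (intro conjI allI impI ballI)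
    show "(\<lambda>\<omega>. cexp n ?f \<omega>) \<in> borel_measurable (filt n)" for n using measurable_cexp by simp
    show "AE \<omega> in m_inf. cexp m (\<lambda>\<omega>. cexp n ?f \<omega>) \<omega> = cexp m ?f \<omega>" if "m \<le> n" for m n
      using cexp_tower[OF fi that] by simp
    have "Lnorm \<infinity> m_inf (\<lambda>\<omega>. nrm scalars (\<lambda>_. cexp n ?f \<omega>)) \<le> ennreal B" for n
      using Linf[OF measurable_filt[OF measurable_cexp] AE_norm_cexp_le[OF f AE_f]] by (simp add: scalars_def)
    then have "(SUP n. Lnorm \<infinity> m_inf (\<lambda>\<omega>. nrm scalars (\<lambda>_. cexp n ?f \<omega>))) \<le> ennreal B" by (rule SUP_least)
    then show "(SUP n. Lnorm \<infinity> m_inf (\<lambda>\<omega>. nrm scalars (\<lambda>_. cexp n ?f \<omega>))) < \<infinity>" by (rule le_less_trans) simp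
    fix n :: nat assume n: "1 \<le> n"
    show "analytic_in_last scalars n (diffs (\<lambda>n \<omega> _. cexp n ?f \<omega>) n)"
    proof (rule analytic_in_lastI[OF n])
      fix i :: "bool list"
      have d: "diffs (\<lambda>n \<omega> _. cexp n ?f \<omega>) n \<omega> i = cexp n ?f \<omega> - cexp (n - 1) ?f \<omega>" for \<omega>
        using n by (simp add: diffs_def)
      have cm: "cexp (n - 1) ?f \<in> borel_measurable (filt n)"
        by (rule measurable_from_subalg[OF subalgebra_filt_mono measurable_cexp]) simp
      then show "(\<lambda>\<omega>. diffs (\<lambda>n \<omega> _. cexp n ?f \<omega>) n \<omega> i) \<in> borel_measurable (filt n)"
        unfolding d by (intro borel_measurable_diff measurable_cexp)
      have "AE \<omega> in m_inf. cexp n ?f \<omega> - cexp (n - 1) ?f \<omega> = coord_prod M (truncated n \<phi>) \<omega> - coord_prod M (truncated (n - 1) \<phi>) \<omega>"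
        using cexp_coord_prod[of \<phi> n M, OF bm] cexp_coord_prod[of \<phi> "n - 1" M, OF bm] by eventually_elim simp
      from AE_upd[OF n this] AE_space
      show "AE \<omega> in m_inf. \<forall>k\<le>0. fourier_coeff (\<lambda>t. diffs (\<lambda>n \<omega> _. cexp n ?f \<omega>) n (fun_upd \<omega> n t) i) k = 0"
      proof eventually_elim
        case (elim \<omega>)
        show ?case
        proof (intro allI impI)
          fix k :: int assume k: "k \<le> 0"
          \<comment> \<open>For \<open>n > M\<close> no factor involves coordinate \<open>n\<close>,
            and the difference is 0.\<close>
          define c where "c = (if n \<le> M then (\<Prod>v\<in>{1..M} - {n}. truncated n \<phi> v (\<omega> v)) else 0)"
          have prod: "coord_prod M (truncated n \<phi>) (fun_upd \<omega> n t) - coord_prod M (truncated (n - 1) \<phi>) (fun_upd \<omega> n t)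
              = c * (\<phi> n t - fourier_coeff (\<phi> n) 0)" for t
          proof (cases "n \<le> M")
            case True
            have split: "coord_prod M \<psi> (fun_upd \<omega> n t) = \<psi> n t * (\<Prod>v\<in>{1..M} - {n}. \<psi> v (\<omega> v))" for \<psi>
              unfolding coord_prod_def using True n by (subst prod.remove[of _ n]) (auto intro!: prod.cong)
            have trunc: "truncated n \<phi> n t = \<phi> n t" "truncated (n - 1) \<phi> n t = fourier_coeff (\<phi> n) 0"
              using n by (auto simp: truncated_def)
            have eq: "(\<Prod>v\<in>{1..M} - {n}. truncated (n - 1) \<phi> v (\<omega> v)) = (\<Prod>v\<in>{1..M} - {n}. truncated n \<phi> v (\<omega> v))"
              by (intro prod.cong) (auto simp: truncated_def)
            show ?thesis unfolding split trunc eq c_def if_P[OF True] by (simp add: algebra_simps)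
          next
            case False
            have "coord_prod M (truncated n \<phi>) \<omega>' = coord_prod M (truncated (n - 1) \<phi>) \<omega>'" for \<omega>'
              unfolding coord_prod_def using False by (intro prod.cong) (auto simp: truncated_def)
            then show ?thesis using False by (simp add: c_def)
          qed
          note sl = measurable_compose[OF measurable_upd_slice[OF n elim(2)]]
          have pm: "(\<lambda>t :: complex. t powi - k) \<in> borel_measurable circ"
            by (intro continuous_borel_circ continuous_intros) auto
          have \<phi>m: "\<phi> n \<in> borel_measurable circ" using bm by (simp add: bounded_measurable_def)
          have "fourier_coeff (\<lambda>t. diffs (\<lambda>n \<omega> _. cexp n ?f \<omega>) n (fun_upd \<omega> n t) i) k
              = fourier_coeff (\<lambda>t. c * (\<phi> n t - fourier_coeff (\<phi> n) 0)) k"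
            unfolding fourier_coeff_def[of _ k] d
          proof (rule integral_cong_AE)
            show "(\<lambda>t. (cexp n ?f (fun_upd \<omega> n t) - cexp (n - 1) ?f (fun_upd \<omega> n t)) * t powi - k) \<in> borel_measurable circ"
              by (intro borel_measurable_times borel_measurable_diff sl measurable_filt[OF measurable_cexp] pm)
            show "(\<lambda>t. c * (\<phi> n t - fourier_coeff (\<phi> n) 0) * t powi - k) \<in> borel_measurable circ"
              by (intro borel_measurable_times borel_measurable_diff \<phi>m pm borel_measurable_const)
            show "AE t in circ. (cexp n ?f (fun_upd \<omega> n t) - cexp (n - 1) ?f (fun_upd \<omega> n t)) * t powi - k
                = c * (\<phi> n t - fourier_coeff (\<phi> n) 0) * t powi - k"
              using elim(1) by eventually_elim (simp only: prod)
          qed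
          also have "\<dots> = c * (fourier_coeff (\<phi> n) k - fourier_coeff (\<lambda>_. fourier_coeff (\<phi> n) 0) k)"
          proof -
            obtain B where "\<forall>t. cmod t = 1 \<longrightarrow> cmod (\<phi> n t) \<le> B" using bm unfolding bounded_measurable_def by blast
            then have "integrable circ (\<phi> n)" by (intro integrable_circ_bounded[OF \<phi>m, of B]) simp
            from integrable_powi_mult[OF this, of "- k"]
            have "integrable circ (\<lambda>t. \<phi> n t * t powi - k)" by (simp only: mult.commute)
            moreover have "integrable circ (\<lambda>t. fourier_coeff (\<phi> n) 0 * t powi - k)"
              by (intro integrable_circ_continuous continuous_intros) auto
            ultimately show ?thesis
              unfolding fourier_coeff_cmult by (simp add: fourier_coeff_def[of _ k] left_diff_distrib)
          qed
          also have "\<dots> = 0" using k \<phi>[of n] by (auto simp: fourier_coeff_const boundary_fun_def)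
          finally show "fourier_coeff (\<lambda>t. diffs (\<lambda>n \<omega> _. cexp n ?f \<omega>) n (fun_upd \<omega> n t) i) k = 0" .
        qed
      qed
    qed
  qed
  moreover have "Lnorm \<infinity> m_inf (\<lambda>\<omega>. cmod (?f \<omega>)) < \<infinity>"
    using Linf[OF f AE_f] by (rule le_less_trans) simp
  ultimately show ?thesis using f by (simp add: hardy_space_def)
qed

section \<open>Tensor words and the lower bound\<close>

definition digit :: "bool \<Rightarrow> bool \<Rightarrow> nat" where
  "digit b c = (if c then 2 else 0) + (if b then 1 else 0)"

lemma digit_le: "digit b c \<le> 3"
  by (simp add: digit_def)

lemma digit_inj: "digit b c = digit b' c' \<longleftrightarrow> b = b' \<and> c = c'"
  by (simp add: digit_def)

text \<open>A word of \<open>2n\<close> letters is read as \<open>n\<close> digits in base 4. The second letter of a pair (the \<open>\<ell>\<^sub>q\<close> index)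
  is the high bit, since it decides whether the variable of the pair is averaged out, and
  conditional expectations must occur in increasing order.\<close>

fun word_pos :: "nat \<Rightarrow> nat \<Rightarrow> bool list \<Rightarrow> nat" where
  "word_pos (Suc n) a (b # c # w) = word_pos n (a + digit b c * 4 ^ n) w"
| "word_pos n a w = a"

text \<open>The words below a node with base \<open>a\<close> fill four consecutive blocks of length
  \<open>4 ^ n\<close>. The index \<open>a + 2 * 4 ^ n\<close> is the start of the upper two, those
  with second letter \<open>True\<close>, so it separates the words that have to see the variable
  from those that have to average it.\<close>

fun word_factor :: "(bool \<Rightarrow> bool \<Rightarrow> complex \<Rightarrow> complex) \<Rightarrow> nat \<Rightarrow> nat \<Rightarrow> bool list \<Rightarrow> nat \<Rightarrow> complex \<Rightarrow> complex" where
  "word_factor F (Suc n) a (b # c # w) v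
    = (if v = a + 2 * 4 ^ n then F b c else word_factor F n (a + digit b c * 4 ^ n) w v)"
| "word_factor F n a w v = (\<lambda>_. 1)"

text \<open>The product of the factors along a word, in a recursive form that matches the recursion
  of \<open>E_space\<close>.\<close>

fun word_value :: "(bool \<Rightarrow> bool \<Rightarrow> complex \<Rightarrow> complex) \<Rightarrow> nat \<Rightarrow> nat \<Rightarrow> bool list \<Rightarrow> torus \<Rightarrow> complex" where
  "word_value F (Suc n) a (b # c # w) \<omega>
    = F b c (\<omega> (a + 2 * 4 ^ n)) * word_value F n (a + digit b c * 4 ^ n) w \<omega>"
| "word_value F n a w \<omega> = 1"

lemma idx_E_space_Suc: "w \<in> idx (E_space p q (Suc n)) \<longleftrightarrow> (\<exists>b c w'. w = b # c # w' \<and> w' \<in> idx (E_space p q n))"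
  by (auto simp: ell2_def)

lemma idx_scalars: "idx scalars = {[]}"
  by (simp add: scalars_def)

lemma word_pos_bounds:
  "w \<in> idx (E_space p q n) \<Longrightarrow> a \<le> word_pos n a w \<and> word_pos n a w < a + 4 ^ n"
proof (induction n arbitrary: a w)
  case 0
  then show ?case by (simp add: idx_scalars)
next
  case (Suc n)
  then obtain b c w' where w: "w = b # c # w'" "w' \<in> idx (E_space p q n)"
    unfolding idx_E_space_Suc by blast
  have "digit b c * 4 ^ n \<le> 3 * 4 ^ n" using digit_le by (intro mult_right_mono) auto
  then show ?case using Suc.IH[OF w(2), of "a + digit b c * 4 ^ n"]
    unfolding w(1) word_pos.simps power_Suc by linarith
qed

lemma word_pos_inj:
  "w \<in> idx (E_space p q n) \<Longrightarrow> w' \<in> idx (E_space p q n) \<Longrightarrow> word_pos n a w = word_pos n a w' \<Longrightarrow> w = w'"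
proof (induction n arbitrary: a w w')
  case 0
  then show ?case by (simp add: idx_scalars)
next
  case (Suc n)
  obtain b c u where w: "w = b # c # u" "u \<in> idx (E_space p q n)"
    using Suc.prems(1) unfolding idx_E_space_Suc by blast
  obtain b' c' u' where w': "w' = b' # c' # u'" "u' \<in> idx (E_space p q n)"
    using Suc.prems(2) unfolding idx_E_space_Suc by blast
  let ?d = "digit b c" and ?d' = "digit b' c'"
  have eq: "word_pos n (a + ?d * 4 ^ n) u = word_pos n (a + ?d' * 4 ^ n) u'"
    using Suc.prems(3) by (simp add: w w')
  have le: "x \<le> y" if "x * 4 ^ n < y * 4 ^ n + 4 ^ n" for x y :: nat
  proof -
    have "x * 4 ^ n < Suc y * 4 ^ n" using that by simp
    then show ?thesis by (simp only: mult_less_cancel2 less_Suc_eq_le)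
  qed
  have "?d * 4 ^ n < ?d' * 4 ^ n + 4 ^ n" "?d' * 4 ^ n < ?d * 4 ^ n + 4 ^ n"
    using eq word_pos_bounds[OF w(2), of "a + ?d * 4 ^ n"] word_pos_bounds[OF w'(2), of "a + ?d' * 4 ^ n"] by linarith+
  then have d: "?d = ?d'" using le by (metis le_antisym)
  then have "u = u'" using eq Suc.IH[OF w(2) w'(2)] by simp
  with d show ?case by (simp add: w w' digit_inj)
qed

text \<open>All variables used below a node lie strictly inside its block. This keeps the variable
  of a node apart from those further down, so no variable occurs twice along a word.\<close>

lemma word_factor_outside:
  "w \<in> idx (E_space p q n) \<Longrightarrow> v \<le> a \<or> a + 4 ^ n \<le> v \<Longrightarrow> word_factor F n a w v = (\<lambda>_. 1)"
proof (induction n arbitrary: a w)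
  case 0
  then show ?case by (simp add: idx_scalars)
next
  case (Suc n)
  then obtain b c w' where w: "w = b # c # w'" "w' \<in> idx (E_space p q n)"
    unfolding idx_E_space_Suc by blast
  have d: "digit b c * 4 ^ n \<le> 3 * 4 ^ n" using digit_le by (intro mult_right_mono) auto
  have p: "(0::nat) < 4 ^ n" by simp
  have "v \<le> a + digit b c * 4 ^ n \<or> a + digit b c * 4 ^ n + 4 ^ n \<le> v" "v \<noteq> a + 2 * 4 ^ n"
    using Suc.prems(2) d p unfolding power_Suc by linarith+
  then show ?case using Suc.IH[OF w(2), of "a + digit b c * 4 ^ n"] by (simp add: w(1))
qed

text \<open>A variable is revealed at the position of a word exactly when the corresponding second letter is
  \<open>True\<close>; replacing the other factors by constants gives the conditional expectation.\<close>

lemma prod_word_factor: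
  assumes "w \<in> idx (E_space p q n)" "a + 4 ^ n \<le> Suc M" "K = word_pos n a w"
  shows "(\<Prod>v\<in>{1..M}. word_factor F n a w v (\<omega> v)) = word_value F n a w \<omega>"
    and "(\<Prod>v\<in>{1..M}. truncated K (word_factor F n a w) v (\<omega> v))
      = word_value (\<lambda>b c. if c then F b c else (\<lambda>_. fourier_coeff (F b c) 0)) n a w \<omega>"
proof -
  have one: "fourier_coeff (\<lambda>_. 1) 0 = 1" by (simp add: fourier_coeff_const)
  have "(\<Prod>v\<in>{1..M}. word_factor F n a w v (\<omega> v)) = word_value F n a w \<omega> \<and>
    (\<Prod>v\<in>{1..M}. truncated K (word_factor F n a w) v (\<omega> v))
      = word_value (\<lambda>b c. if c then F b c else (\<lambda>_. fourier_coeff (F b c) 0)) n a w \<omega>"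
    using assms
  proof (induction n arbitrary: a w)
    case 0
    have "truncated K (\<lambda>_ _. 1) v t = 1" for v t
      by (cases "v \<le> K") (simp_all add: truncated_def one)
    then show ?case by simp
  next
    case (Suc n)
    then obtain b c u where w: "w = b # c # u" "u \<in> idx (E_space p q n)"
      unfolding idx_E_space_Suc by blast
    let ?d = "digit b c" let ?a = "a + ?d * 4 ^ n" and ?v = "a + 2 * 4 ^ n"
    have d: "?d * 4 ^ n \<le> 3 * 4 ^ n" using digit_le by (intro mult_right_mono) auto
    have p: "(0::nat) < 4 ^ n" by simp
    have K: "K = word_pos n ?a u" using Suc.prems(3) by (simp add: w)
    have le: "?a + 4 ^ n \<le> Suc M" using Suc.prems(2) d unfolding power_Suc by linarith
    note IH = Suc.IH[OF w(2) le K]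
    have "1 \<le> ?v \<and> ?v \<le> M" using Suc.prems(2) p unfolding power_Suc by linarith
    then have vM: "?v \<in> {1..M}" by simp
    have out: "word_factor F n ?a u ?v = (\<lambda>_. 1)"
    proof (rule word_factor_outside[OF w(2)])
      show "?v \<le> ?a \<or> ?a + 4 ^ n \<le> ?v" by (cases b; cases c) (simp_all add: digit_def)
    qed
    \<comment> \<open>\<open>K\<close> lies in the block of the first digit; as \<open>c\<close> is
      the high bit, that block starts at or after \<open>?v\<close> exactly when \<open>c\<close>
      holds, and otherwise ends before it.\<close>
    have Kv: "?v \<le> K \<longleftrightarrow> c"
    proof -
      have "?a \<le> K" "K < ?a + 4 ^ n" using word_pos_bounds[OF w(2), of ?a] K by auto
      then show ?thesis by (cases b; cases c) (simp_all add: digit_def)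
    qed
    have "(\<Prod>v\<in>{1..M}. word_factor F (Suc n) a w v (\<omega> v))
        = F b c (\<omega> ?v) * (\<Prod>v\<in>{1..M} - {?v}. word_factor F n ?a u v (\<omega> v))"
      using vM by (subst prod.remove[of _ ?v]) (auto simp: w intro!: prod.cong)
    also have "(\<Prod>v\<in>{1..M} - {?v}. word_factor F n ?a u v (\<omega> v)) = (\<Prod>v\<in>{1..M}. word_factor F n ?a u v (\<omega> v))"
      using vM by (subst (2) prod.remove[of _ ?v]) (auto simp: out)
    finally have 1: "(\<Prod>v\<in>{1..M}. word_factor F (Suc n) a w v (\<omega> v)) = word_value F (Suc n) a w \<omega>"
      using IH by (simp add: w)
    have tr: "truncated K (word_factor F (Suc n) a w) ?v t = (if c then F b c t else fourier_coeff (F b c) 0)"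
      "v \<noteq> ?v \<Longrightarrow> truncated K (word_factor F (Suc n) a w) v t = truncated K (word_factor F n ?a u) v t" for v t
      by (simp_all add: truncated_def Kv w)
    have "(\<Prod>v\<in>{1..M}. truncated K (word_factor F (Suc n) a w) v (\<omega> v))
        = truncated K (word_factor F (Suc n) a w) ?v (\<omega> ?v) * (\<Prod>v\<in>{1..M} - {?v}. truncated K (word_factor F (Suc n) a w) v (\<omega> v))"
      using vM by (intro prod.remove) auto
    also have "(\<Prod>v\<in>{1..M} - {?v}. truncated K (word_factor F (Suc n) a w) v (\<omega> v))
        = (\<Prod>v\<in>{1..M} - {?v}. truncated K (word_factor F n ?a u) v (\<omega> v))"
      by (intro prod.cong refl tr(2)) simp
    also have "(\<Prod>v\<in>{1..M} - {?v}. truncated K (word_factor F n ?a u) v (\<omega> v)) = (\<Prod>v\<in>{1..M}. truncated K (word_factor F n ?a u) v (\<omega> v))"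
    proof -
      have "truncated K (word_factor F n ?a u) ?v t = 1" for t
        by (cases "?v \<le> K") (simp_all add: truncated_def out one)
      then show ?thesis using prod.remove[of "{1..M}" ?v "\<lambda>v. truncated K (word_factor F n ?a u) v (\<omega> v)"] vM by simp
    qed
    finally have eq2: "(\<Prod>v\<in>{1..M}. truncated K (word_factor F (Suc n) a w) v (\<omega> v))
      = truncated K (word_factor F (Suc n) a w) ?v (\<omega> ?v) * (\<Prod>v\<in>{1..M}. truncated K (word_factor F n ?a u) v (\<omega> v))" .
    have "word_value (\<lambda>b c. if c then F b c else (\<lambda>_. fourier_coeff (F b c) 0)) (Suc n) a w \<omega>
      = (if c then F b c (\<omega> ?v) else fourier_coeff (F b c) 0) * word_value (\<lambda>b c. if c then F b c else (\<lambda>_. fourier_coeff (F b c) 0)) n ?a u \<omega>"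
      by (simp add: w)
    then have 2: "(\<Prod>v\<in>{1..M}. truncated K (word_factor F (Suc n) a w) v (\<omega> v))
      = word_value (\<lambda>b c. if c then F b c else (\<lambda>_. fourier_coeff (F b c) 0)) (Suc n) a w \<omega>"
      using IH by (simp only: eq2 tr(1))
    show ?case using 1 2 by blast
  qed
  then show "(\<Prod>v\<in>{1..M}. word_factor F n a w v (\<omega> v)) = word_value F n a w \<omega>"
    "(\<Prod>v\<in>{1..M}. truncated K (word_factor F n a w) v (\<omega> v))
      = word_value (\<lambda>b c. if c then F b c else (\<lambda>_. fourier_coeff (F b c) 0)) n a w \<omega>"
    by blast+
qed

lemma boundary_fun_word_factor:
  assumes "\<And>b c. boundary_fun (F b c)" shows "boundary_fun (word_factor F n a w v)"
  using assms by (induction F n a w v rule: word_factor.induct) (simp_all add: boundary_fun_one)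

text \<open>The norm of \<open>E_space p q 1\<close> as a function of four moduli, with
  \<open>b\<close> as the outer index for \<open>p\<close> and \<open>c\<close> as the inner one for
  \<open>q\<close>.\<close>

definition block_norm :: "real \<Rightarrow> real \<Rightarrow> (bool \<Rightarrow> bool \<Rightarrow> real) \<Rightarrow> real" where
  "block_norm p q x = ((x False False powr q + x False True powr q) powr (p / q)
     + (x True False powr q + x True True powr q) powr (p / q)) powr (1 / p)"

text \<open>By homogeneity each level multiplies the norm by the block norm at its own variable.
  That block norm is the constant \<open>\<rho>\<close>, so the four branches may use different
  variables.\<close>

lemma nrm_word_value:
  assumes pq: "1 \<le> p" "1 \<le> q"
    and G: "\<And>v. 1 \<le> v \<Longrightarrow> block_norm p q (\<lambda>b c. cmod (G b c (\<omega> v))) = \<rho>" and \<rho>: "0 \<le> \<rho>"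
  shows "nrm (E_space p q n) (\<lambda>w. word_value G n a w \<omega>) = \<rho> ^ n"
proof (induction n arbitrary: a)
  case 0
  show ?case by (simp add: scalars_def)
next
  case (Suc n)
  let ?t = "\<omega> (a + 2 * 4 ^ n)"
  let ?r = "\<rho> ^ n"
  have r: "0 \<le> ?r" using \<rho> by simp
  note X = lattice_normed_E_space[OF pq, of n]
  have inner: "nrm (E_space p q n) (\<lambda>w. word_value G (Suc n) a (b # c # w) \<omega>) = cmod (G b c ?t) * ?r" for b c
    by (simp add: nrm_scale[OF X] Suc.IH)
  have mid: "nrm (ell2 q (E_space p q n)) (\<lambda>w. word_value G (Suc n) a (b # w) \<omega>) powr p
      = (cmod (G b False ?t) powr q + cmod (G b True ?t) powr q) powr (p / q) * ?r powr p" for b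
  proof -
    have "nrm (ell2 q (E_space p q n)) (\<lambda>w. word_value G (Suc n) a (b # w) \<omega>)
        = ((cmod (G b False ?t) powr q + cmod (G b True ?t) powr q) * ?r powr q) powr (1 / q)"
      unfolding nrm_ell2 inner by (simp only: powr_mult distrib_right)
    then show ?thesis using pq r by (simp add: powr_mult powr_powr)
  qed
  have "nrm (E_space p q (Suc n)) (\<lambda>w. word_value G (Suc n) a w \<omega>)
     = (((cmod (G False False ?t) powr q + cmod (G False True ?t) powr q) powr (p / q)
       + (cmod (G True False ?t) powr q + cmod (G True True ?t) powr q) powr (p / q)) * ?r powr p) powr (1 / p)"
    unfolding E_space.simps nrm_ell2[of p] mid by (simp only: distrib_right)
  also have "\<dots> = block_norm p q (\<lambda>b c. cmod (G b c ?t)) * ?r"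
    using pq r by (simp add: block_norm_def powr_mult powr_powr)
  also have "block_norm p q (\<lambda>b c. cmod (G b c ?t)) = \<rho>" by (rule G) (simp add: Suc_le_eq)
  finally show ?case by simp
qed

lemma AE_Im_nonzero: "AE \<omega> in m_inf. \<forall>v\<ge>1. Im (\<omega> v) \<noteq> 0"
proof -
  have "AE \<omega> in m_inf. Im (\<omega> v) \<noteq> 0" if "1 \<le> v" for v
    using m_inf.AE_component[of v "\<lambda>t. Im t \<noteq> 0"] that AE_circ_Im_nonzero by simp
  then have "AE \<omega> in m_inf. 1 \<le> v \<longrightarrow> Im (\<omega> v) \<noteq> 0" for v
    by (cases "1 \<le> v") simp_all
  then show ?thesis by (simp add: AE_all_countable)
qed

lemma S_constant_lower:
  assumes pq: "1 \<le> p" "1 \<le> q" and f: "0 < f1" "0 < f2" and g: "0 < g1" "0 < g2"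
    and C: "0 \<le> C" and S: "\<And>(N :: nat) \<iota> \<theta>. inj_on \<iota> {..N} \<Longrightarrow> \<iota> ` {..N} \<subseteq> idx (E_space p q n) \<Longrightarrow> (\<forall>k\<le>N. \<theta> k \<in> hardy_space \<infinity>) \<Longrightarrow>
      Lnorm 1 m_inf (\<lambda>\<omega>. nrm (E_space p q n) (\<lambda>i. \<Sum>k\<le>N. cexp k (\<theta> k) \<omega> * basis_vec (\<iota> k) i))
      \<le> ennreal C * Lnorm \<infinity> m_inf (\<lambda>\<omega>. nrm (E_space p q n) (\<lambda>i. \<Sum>k\<le>N. \<theta> k \<omega> * basis_vec (\<iota> k) i))"
  shows "(((sqrt (f1 * f2) powr q + g1 powr q) powr (p / q) + (sqrt (f1 * f2) powr q + g2 powr q) powr (p / q)) powr (1 / p)) ^ n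
    \<le> C * (((f1 powr q + g1 powr q) powr (p / q) + (f2 powr q + g2 powr q) powr (p / q)) powr (1 / p)) ^ n"
proof -
  let ?X = "E_space p q n" and ?\<mu> = "sqrt (f1 * f2)"
  note X = lattice_normed_E_space[OF pq, of n]
  \<comment> \<open>Entries with second letter \<open>False\<close> carry \<open>f\<close> and are
    averaged, those with \<open>True\<close> carry \<open>g\<close> and are kept. The first letter
    reverses the two values, so going to the other half circle swaps the two rows of the block and
    leaves \<open>block_norm\<close> unchanged.\<close>
  define F where "F b c = (if c then (if b then two_valued g2 g1 else two_valued g1 g2)
     else (if b then two_valued f2 f1 else two_valued f1 f2))" for b c
  define G where "G b c = (if c then F b c else (\<lambda>_. fourier_coeff (F b c) 0))" for b c
  define \<rho> \<rho>' where "\<rho> = ((f1 powr q + g1 powr q) powr (p / q) + (f2 powr q + g2 powr q) powr (p / q)) powr (1 / p)"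
    and "\<rho>' = ((?\<mu> powr q + g1 powr q) powr (p / q) + (?\<mu> powr q + g2 powr q) powr (p / q)) powr (1 / p)"
  have \<rho>0: "0 \<le> \<rho>" "0 \<le> \<rho>'" by (auto simp: \<rho>_def \<rho>'_def)
  have bF: "boundary_fun (F b c)" for b c by (simp add: F_def boundary_fun_two_valued)
  have mean: "cmod (fourier_coeff (F b False) 0) = ?\<mu>" for b
    using f by (simp add: F_def fourier_coeff_two_valued mult.commute)
  have norms: "block_norm p q (\<lambda>b c. cmod (F b c t)) = \<rho>" "block_norm p q (\<lambda>b c. cmod (G b c t)) = \<rho>'"
    if t: "cmod t = 1" "Im t \<noteq> 0" for t
    using f g by (simp_all add: block_norm_def \<rho>_def \<rho>'_def G_def mean)
      (simp_all add: F_def cmod_two_valued[OF _ _ t] add.commute)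
  define M where "M = (4 ^ n - 1 :: nat)"
  have M4: "Suc M = 4 ^ n" by (simp add: M_def)
  \<comment> \<open>The numbering is forced: the \<open>k\<close>-th function is conditioned at time
    \<open>k\<close>, and a word averages exactly the intended variables only at the time
    \<open>word_pos\<close>.\<close>
  define \<iota> where "\<iota> = inv_into (idx ?X) (word_pos n 0)"
  have bij: "bij_betw (word_pos n 0) (idx ?X) {..M}"
    unfolding bij_betw_def
  proof
    show inj: "inj_on (word_pos n 0) (idx ?X)" by (auto intro!: inj_onI word_pos_inj)
    have sub: "word_pos n 0 ` idx ?X \<subseteq> {..M}" using word_pos_bounds[of _ p q n 0] by (fastforce simp: M_def)
    show "word_pos n 0 ` idx ?X = {..M}"
      by (rule card_subset_eq[OF _ sub]) (simp_all add: card_image[OF inj] card_E_space M4)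
  qed
  have \<iota>: "bij_betw \<iota> {..M} (idx ?X)" unfolding \<iota>_def by (rule bij_betw_inv_into[OF bij])
  have pos_\<iota>: "word_pos n 0 (\<iota> k) = k" if "k \<le> M" for k
    using bij that unfolding \<iota>_def by (intro f_inv_into_f) (simp add: bij_betw_def)
  have \<iota>_idx: "\<iota> k \<in> idx ?X" if "k \<le> M" for k using \<iota> that by (auto simp: bij_betw_def)
  define \<theta> where "\<theta> k = coord_prod M (word_factor F n 0 (\<iota> k))" for k
  have \<theta>H: "\<theta> k \<in> hardy_space \<infinity>" for k
    unfolding \<theta>_def by (intro hardy_space_coord_prod boundary_fun_word_factor bF)
  have \<theta>_val: "\<theta> k \<omega> = word_value F n 0 (\<iota> k) \<omega>" if "k \<le> M" for k \<omega>
    unfolding \<theta>_def coord_prod_def by (rule prod_word_factor(1)[OF \<iota>_idx[OF that] _ refl]) (simp add: M4)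
  have bm: "bounded_measurable (word_factor F n 0 (\<iota> k) v)" for k v
    using boundary_fun_word_factor[of F, OF bF] boundary_fun_iff by blast
  have cexp_val: "AE \<omega> in m_inf. cexp k (\<theta> k) \<omega> = word_value G n 0 (\<iota> k) \<omega>" if k: "k \<le> M" for k
    using cexp_coord_prod[of "word_factor F n 0 (\<iota> k)" k M, OF bm]
  proof eventually_elim
    case (elim \<omega>)
    then show ?case
      unfolding \<theta>_def coord_prod_def G_def
      by (subst (asm) prod_word_factor(2)[OF \<iota>_idx[OF k] _ pos_\<iota>[OF k, symmetric]]) (simp_all add: M4)
  qed
  have expand: "nrm ?X (\<lambda>i. \<Sum>k\<le>M. c k * basis_vec (\<iota> k) i) = nrm ?X (\<lambda>w. h w)"
    if "\<And>k. k \<le> M \<Longrightarrow> c k = h (\<iota> k)" for c and h :: "bool list \<Rightarrow> complex"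
  proof (rule nrm_cong[OF X])
    fix w assume w: "w \<in> idx ?X"
    then obtain k0 where k0: "k0 \<le> M" "w = \<iota> k0" using \<iota> by (auto simp: bij_betw_def)
    have "(\<Sum>k\<le>M. c k * basis_vec (\<iota> k) w) = (\<Sum>k\<le>M. if k = k0 then h w else 0)"
    proof (intro sum.cong refl)
      fix k assume k: "k \<in> {..M}"
      have "w = \<iota> k \<longleftrightarrow> k = k0" using \<iota> k k0 by (auto simp: bij_betw_def inj_on_def)
      then show "c k * basis_vec (\<iota> k) w = (if k = k0 then h w else 0)"
        using that[of k] k by (auto simp: basis_vec_def)
    qed
    also have "\<dots> = h w" using k0 by simp
    finally show "cmod (\<Sum>k\<le>M. c k * basis_vec (\<iota> k) w) = cmod (h w)" by simp
  qed
  let ?Y = "\<lambda>\<omega>. nrm ?X (\<lambda>i. \<Sum>k\<le>M. \<theta> k \<omega> * basis_vec (\<iota> k) i)"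
  let ?V = "\<lambda>\<omega>. nrm ?X (\<lambda>i. \<Sum>k\<le>M. cexp k (\<theta> k) \<omega> * basis_vec (\<iota> k) i)"
  have Y: "AE \<omega> in m_inf. ?Y \<omega> = \<rho> ^ n"
    using AE_Im_nonzero AE_space
  proof eventually_elim
    case (elim \<omega>)
    have "?Y \<omega> = nrm ?X (\<lambda>w. word_value F n 0 w \<omega>)" by (rule expand) (rule \<theta>_val)
    also have "\<dots> = \<rho> ^ n"
      by (rule nrm_word_value[OF pq norms(1) \<rho>0(1)]) (use elim cmod_component in auto)
    finally show ?case .
  qed
  have V: "AE \<omega> in m_inf. ?V \<omega> = \<rho>' ^ n"
  proof -
    have "AE \<omega> in m_inf. \<forall>k\<in>{..M}. cexp k (\<theta> k) \<omega> = word_value G n 0 (\<iota> k) \<omega>"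
      using cexp_val by (intro AE_finite_allI) auto
    then show ?thesis using AE_Im_nonzero AE_space
    proof eventually_elim
      case (elim \<omega>)
      have "?V \<omega> = nrm ?X (\<lambda>w. word_value G n 0 w \<omega>)" by (rule expand) (use elim(1) in simp)
      also have "\<dots> = \<rho>' ^ n"
        by (rule nrm_word_value[OF pq norms(2) \<rho>0(2)]) (use elim cmod_component in auto)
      finally show ?case .
    qed
  qed
  have \<theta>m: "\<theta> k \<in> borel_measurable m_inf" for k using \<theta>H[of k] by (simp add: hardy_space_def)
  have Ym: "?Y \<in> borel_measurable m_inf"
    by (intro measurable_nrm_E_space borel_measurable_sum borel_measurable_times \<theta>m borel_measurable_const)
  have Vm: "?V \<in> borel_measurable m_inf"
    by (intro measurable_nrm_E_space borel_measurable_sum borel_measurable_times measurable_filt[OF measurable_cexp] borel_measurable_const)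
  have iV: "integrable m_inf ?V"
    by (rule integrable_m_inf_bounded[OF Vm, of "\<rho>' ^ n"]) (use V \<rho>0 in \<open>auto elim!: eventually_mono\<close>)
  have "(\<integral>\<omega>. ?V \<omega> \<partial>m_inf) = (\<integral>\<omega>. \<rho>' ^ n \<partial>m_inf)"
    by (rule integral_cong_AE) (use Vm V in auto)
  then have IV: "(\<integral>\<omega>. ?V \<omega> \<partial>m_inf) = \<rho>' ^ n" using measure_m_inf_space by simp
  have LV: "Lnorm 1 m_inf ?V = ennreal (\<rho>' ^ n)"
    using Lnorm_real(2)[of 1 ?V m_inf] Vm iV \<rho>0 IV by (simp add: nrm_nonneg[OF X])
  have LY: "Lnorm \<infinity> m_inf ?Y \<le> ennreal (\<rho> ^ n)"
    unfolding Lnorm_def using Ym Y by (auto intro!: esssup_I elim!: eventually_mono)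
  have "Lnorm 1 m_inf ?V \<le> ennreal C * Lnorm \<infinity> m_inf ?Y"
    by (rule S) (use \<iota> \<theta>H in \<open>auto simp: bij_betw_def\<close>)
  also have "\<dots> \<le> ennreal C * ennreal (\<rho> ^ n)" by (intro mult_left_mono LY) simp
  finally have "\<rho>' ^ n \<le> C * \<rho> ^ n"
    unfolding LV using C \<rho>0 by (simp add: ennreal_mult[symmetric] ennreal_le_iff)
  then show ?thesis by (simp add: \<rho>_def \<rho>'_def)
qed

section \<open>Comparison of \<open>S_constant\<close> with \<open>kappa\<close>\<close>

lemma integral_two_valued:
  fixes h :: "complex \<Rightarrow> real"
  assumes A: "A \<in> sets circ" "measure circ A = 1 / 2" and B: "B \<in> sets circ" "measure circ B = 1 / 2"
    and AB: "A \<union> B = sphere 0 1" "A \<inter> B = {}"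
    and h: "\<And>t. t \<in> A \<Longrightarrow> h t = x" "\<And>t. t \<in> B \<Longrightarrow> h t = y"
  shows "(\<integral>t. h t \<partial>circ) = (x + y) / 2"
proof -
  have "(\<integral>t. h t \<partial>circ) = (\<integral>t. x * indicator A t + y * indicator B t \<partial>circ)"
    using AB h by (intro Bochner_Integration.integral_cong) (auto simp: indicator_def)
  also have "\<dots> = x * measure circ A + y * measure circ B"
    using A(1) B(1) sets.sets_into_space[OF A(1)] sets.sets_into_space[OF B(1)] circ.emeasure_finite
    by (subst Bochner_Integration.integral_add) (auto simp: Int_absorb2 less_top[symmetric])
  finally show ?thesis using A B by (simp add: field_simps)
qed

text \<open>For two-valued functions on sets of measure 1/2 the integrals in \<open>kappa\<close>
  are averages of two numbers and the geometric mean is \<open>sqrt (f1 * f2)\<close>, whatever the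
  partition. Taking \<open>n\<close>-th roots in \<open>S_constant_lower\<close> therefore makes
  \<open>C powr (1 / n)\<close> admissible for \<open>kappa\<close>.\<close>

lemma kappa_pow_le_S:
  assumes pq: "1 \<le> p" "1 \<le> q" and n: "1 \<le> n"
  shows "kappa p q ^ n \<le> S_constant (E_space p q n) (idx (E_space p q n)) basis_vec"
  unfolding S_constant_def
proof (rule le_best_constant)
  fix C :: real
  assume C: "0 \<le> C" and S: "\<forall>(N :: nat) \<iota> \<theta>. inj_on \<iota> {..N} \<and> \<iota> ` {..N} \<subseteq> idx (E_space p q n) \<and> (\<forall>k\<le>N. \<theta> k \<in> hardy_space \<infinity>) \<longrightarrow>
      Lnorm 1 m_inf (\<lambda>\<omega>. nrm (E_space p q n) (\<lambda>i. \<Sum>k\<le>N. cexp k (\<theta> k) \<omega> * basis_vec (\<iota> k) i))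
      \<le> ennreal C * Lnorm \<infinity> m_inf (\<lambda>\<omega>. nrm (E_space p q n) (\<lambda>i. \<Sum>k\<le>N. \<theta> k \<omega> * basis_vec (\<iota> k) i))"
  define D where "D = C powr (1 / n)"
  have D: "0 \<le> D" "D ^ n = C"
  proof -
    show "0 \<le> D" by (simp add: D_def)
    show "D ^ n = C"
    proof (cases "C = 0")
      case False
      then have "D ^ n = D powr real n" using C by (simp add: D_def powr_realpow)
      then show ?thesis using False C n by (simp add: D_def powr_powr)
    qed (use n in \<open>simp add: D_def\<close>)
  qed
  have pos: "(sqrt (f1 * f2) powr q + g1 powr q) powr (p / q) + (sqrt (f1 * f2) powr q + g2 powr q) powr (p / q)
      \<le> D powr p * ((f1 powr q + g1 powr q) powr (p / q) + (f2 powr q + g2 powr q) powr (p / q))"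
    (is "?a \<le> _ * ?b") if fg: "0 < f1" "0 < f2" "0 < g1" "0 < g2" for f1 f2 g1 g2 :: real
  proof -
    have "(?a powr (1 / p)) ^ n \<le> C * (?b powr (1 / p)) ^ n"
      by (rule S_constant_lower[OF pq fg C]) (use S in blast)
    also have "\<dots> = (D * ?b powr (1 / p)) ^ n" by (simp add: power_mult_distrib D)
    finally have le: "?a powr (1 / p) \<le> D * ?b powr (1 / p)"
      using power_mono_iff[of "?a powr (1 / p)" "D * ?b powr (1 / p)" n] n D by simp
    have ab: "0 \<le> ?a" "0 \<le> ?b" by (auto intro: add_nonneg_nonneg)
    have "?a = (?a powr (1 / p)) powr p" using pq ab by (simp add: powr_powr)
    also have "\<dots> \<le> (D * ?b powr (1 / p)) powr p" using le pq by (intro powr_mono2) auto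
    also have "\<dots> = D powr p * ?b" using pq ab by (simp add: powr_mult powr_powr)
    finally show ?thesis .
  qed
  \<comment> \<open>\<open>two_valued\<close> needs positive moduli, so vanishing values of
    \<open>g\<close> are reached by a limit from the right.\<close>
  have nonneg: "(sqrt (f1 * f2) powr q + g1 powr q) powr (p / q) + (sqrt (f1 * f2) powr q + g2 powr q) powr (p / q)
      \<le> D powr p * ((f1 powr q + g1 powr q) powr (p / q) + (f2 powr q + g2 powr q) powr (p / q))"
    if fg: "0 < f1" "0 < f2" "0 \<le> g1" "0 \<le> g2" for f1 f2 g1 g2 :: real
  proof (rule tendsto_le[of "at_right 0"])
    have c: "((\<lambda>d. (f powr q + (g + d) powr q) powr (p / q)) \<longlongrightarrow> (f powr q + (g + 0) powr q) powr (p / q)) (at_right 0)"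
      if "0 < f" "0 \<le> g" for f g :: real
    proof -
      have 1: "((\<lambda>d. (g + d) powr q) \<longlongrightarrow> (g + 0) powr q) (at_right 0)"
      proof (rule tendsto_powr'[OF tendsto_add[OF tendsto_const tendsto_ident_at] tendsto_const])
        show "g + 0 \<noteq> 0 \<or> 0 < q \<and> (\<forall>\<^sub>F x in at_right 0. 0 \<le> g + x)"
          using pq that by (auto simp: eventually_at_filter)
      qed
      have "f powr q + (g + 0) powr q \<noteq> 0" using that by (smt (verit) powr_gt_zero powr_ge_zero)
      then show ?thesis by (rule tendsto_powr[OF tendsto_add[OF tendsto_const 1] tendsto_const])
    qed
    let ?\<mu> = "sqrt (f1 * f2)"
    have \<mu>: "0 < ?\<mu>" using fg by simp
    show "((\<lambda>d. (?\<mu> powr q + (g1 + d) powr q) powr (p / q) + (?\<mu> powr q + (g2 + d) powr q) powr (p / q)) \<longlongrightarrow>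
       (?\<mu> powr q + g1 powr q) powr (p / q) + (?\<mu> powr q + g2 powr q) powr (p / q)) (at_right 0)"
      using tendsto_add[OF c[OF \<mu> fg(3)] c[OF \<mu> fg(4)]] by simp
    show "((\<lambda>d. D powr p * ((f1 powr q + (g1 + d) powr q) powr (p / q) + (f2 powr q + (g2 + d) powr q) powr (p / q))) \<longlongrightarrow>
       D powr p * ((f1 powr q + g1 powr q) powr (p / q) + (f2 powr q + g2 powr q) powr (p / q))) (at_right 0)"
      using tendsto_mult[OF tendsto_const tendsto_add[OF c[OF fg(1,3)] c[OF fg(2,4)]], of "D powr p"] by simp
    show "\<forall>\<^sub>F d in at_right 0. (?\<mu> powr q + (g1 + d) powr q) powr (p / q) + (?\<mu> powr q + (g2 + d) powr q) powr (p / q)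
      \<le> D powr p * ((f1 powr q + (g1 + d) powr q) powr (p / q) + (f2 powr q + (g2 + d) powr q) powr (p / q))"
      unfolding eventually_at_filter using fg by (intro always_eventually allI impI pos) auto
  qed simp
  have key: "(\<integral>t. (geometric_mean (\<lambda>t. \<bar>f1 * indicator A t + f2 * indicator B t\<bar>) powr q
        + cmod (g1 * indicator A t + g2 * indicator B t) powr q) powr (p / q) \<partial>circ)
      \<le> D powr p * (\<integral>t. (\<bar>f1 * indicator A t + f2 * indicator B t\<bar> powr q
        + cmod (g1 * indicator A t + g2 * indicator B t) powr q) powr (p / q) \<partial>circ)"
    if A: "A \<in> sets circ" and B: "B \<in> sets circ" and AB: "A \<union> B = sphere 0 1" "A \<inter> B = {}"
      and m: "measure circ A = 1 / 2" "measure circ B = 1 / 2" and f: "0 < f1" "0 < f2"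
    for A B :: "complex set" and f1 f2 :: real and g1 g2 :: complex
  proof -
    define F where "F t = f1 * indicator A t + f2 * indicator B t" for t :: complex
    define G where "G t = g1 * indicator A t + g2 * indicator B t" for t :: complex
    have FA: "F t = f1" "G t = g1" if "t \<in> A" for t using that AB by (auto simp: F_def G_def indicator_def)
    have FB: "F t = f2" "G t = g2" if "t \<in> B" for t using that AB by (auto simp: F_def G_def indicator_def)
    note two = integral_two_valued[OF A m(1) B m(2) AB]
    have "(\<integral>t. ln \<bar>F t\<bar> \<partial>circ) = (ln f1 + ln f2) / 2"
      by (rule two) (use FA FB f in auto)
    also have "\<dots> = ln (sqrt (f1 * f2))" using f by (simp add: ln_sqrt ln_mult)
    finally have gm: "geometric_mean (\<lambda>t. \<bar>F t\<bar>) = sqrt (f1 * f2)"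
      using f by (simp add: geometric_mean_def)
    let ?L = "\<integral>t. (geometric_mean (\<lambda>t. \<bar>F t\<bar>) powr q + cmod (G t) powr q) powr (p / q) \<partial>circ"
    let ?R = "\<integral>t. (\<bar>F t\<bar> powr q + cmod (G t) powr q) powr (p / q) \<partial>circ"
    have R: "?R = ((f1 powr q + cmod g1 powr q) powr (p / q) + (f2 powr q + cmod g2 powr q) powr (p / q)) / 2"
      by (rule two) (use FA FB f in auto)
    have "?L = ((sqrt (f1 * f2) powr q + cmod g1 powr q) powr (p / q) + (sqrt (f1 * f2) powr q + cmod g2 powr q) powr (p / q)) / 2"
      unfolding gm by (rule two) (use FA FB in auto)
    also have "\<dots> \<le> D powr p * ((f1 powr q + cmod g1 powr q) powr (p / q) + (f2 powr q + cmod g2 powr q) powr (p / q)) / 2"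
      using nonneg[OF f, of "cmod g1" "cmod g2"] by simp
    also have "\<dots> = D powr p * ?R" unfolding R by simp
    finally show ?thesis unfolding F_def G_def .
  qed
  have "kappa p q \<le> ennreal D"
    unfolding kappa_def Let_def
    by (rule Inf_lower, rule CollectI, rule exI[of _ D]) (intro conjI refl D(1) allI impI, elim conjE, rule key)
  then have "kappa p q ^ n \<le> ennreal D ^ n" by (rule power_mono) simp
  also have "\<dots> = ennreal C" using D by (simp add: ennreal_power)
  finally show "kappa p q ^ n \<le> ennreal C" .
qed

theorem theorem4p6:
  fixes p q :: real
  assumes "1 \<le> p" and "1 \<le> q" and "p \<noteq> q"
  shows "(\<forall>s::real. \<forall>n::nat. 1 \<le> s \<and> 1 \<le> n \<longrightarrow>
            AUMD_constant s (E_space p q n) \<ge> S_constant (E_space p q n) (idx (E_space p q n)) basis_vec \<and>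
            S_constant (E_space p q n) (idx (E_space p q n)) basis_vec \<ge> kappa p q ^ n)
       \<and> (1 < p \<and> 1 < q \<longrightarrow>
            (\<forall>s::real. 1 \<le> s \<longrightarrow>
               (\<exists>\<kappa>2::real. \<forall>n::nat. 1 \<le> n \<longrightarrow>
                  AUMD_constant s (E_space p q n) \<le> ennreal \<kappa>2 ^ n)))"
proof (intro conjI allI impI)
  fix s :: real and n :: nat
  assume sn: "1 \<le> s \<and> 1 \<le> n"
  show "S_constant (E_space p q n) (idx (E_space p q n)) basis_vec \<le> AUMD_constant s (E_space p q n)"
    by (rule S_le_AUMD[OF lattice_normed_E_space[OF assms(1,2)] measurable_norm_E_space]) (use sn in auto)
  show "kappa p q ^ n \<le> S_constant (E_space p q n) (idx (E_space p q n)) basis_vec"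
    using kappa_pow_le_S[OF assms(1,2)] sn by blast
next
  fix s :: real assume "1 \<le> s"
  then show "\<exists>\<kappa>2::real. \<forall>n::nat. 1 \<le> n \<longrightarrow> AUMD_constant s (E_space p q n) \<le> ennreal \<kappa>2 ^ n"
    using AUMD_constant_E_space_le[OF assms(1,2)] by blast
qed

end
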